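(* Let $A_1,\dots,A_d$ be Hermitian $n\times n$ matrices, and let $Q=\{\rho=0\}\subset\mathbb{C}^{N}=\mathbb{C}^n_z\times\mathbb{C}^d_w$ be the quadric submanifold of real codimension $d$ with $\rho=(\rho_1,\dots,\rho_d)$, $\rho_j(z,w)=\mathrm{Re}\, w_j-{}^t\bar zA_jz$. Assume that $Q$ is $\mathfrak{D}$-nondegenerate at $0$. Let $c=(c_1,\dots,c_d)\in\mathbb{R}^d$ and $V\in\mathbb{C}^n$ be given by conditions $(\mathfrak{t})$ and $(\mathfrak{d})$ respectively, put $A=\sum_{j=1}^d c_jA_j$, and consider the initial disc $\boldsymbol{f_0}\in\mathcal{S}_0(Q)$ given by $$\boldsymbol{f_0}(\zeta)=\left((1-\zeta)V,\,2(1-\zeta)\,{}^t\overline{V}A_1V,\ldots,2(1-\zeta)\,{}^t\overline{V}A_dV,\,(1-\zeta)\,{}^t\overline{V}A,\,\tfrac{\zeta}{2}c\right).$$ Then there exist an open neighborhood $U$ of $\rho$ in $(\mathcal{C}^4(\mathbb{B}))^{d}$ and $\varepsilon>0$ such that for all $r\in U$ the $1$-jet map $\mathfrak{j}_1$ at $\zeta=1$, $$\mathfrak{j}_1(\boldsymbol f)=\left(\boldsymbol f(1),\frac{\partial\boldsymbol f}{\partial\zeta}(1)\right),$$ is injective on $$\{\boldsymbol{f}\in\mathcal{S}_0(\{r=0\})\;:\;\|\boldsymbol{f}-\boldsymbol{f_0}\|_{1,\alpha}<\varepsilon\}.$$ In other words, such discs are determined by their $1$-jet at $1$.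
   Context: $\Delta$ is the open unit disc in $\mathbb{C}$, $\mathbb{B}$ the unit ball of $\mathbb{C}^N$, and $0<\alpha<1$ is fixed. $\mathfrak{D}$-nondegeneracy of $Q$ at $0$ means: $(\mathfrak{t})$ there exist real numbers $c_1,\dots,c_d$ such that $A=\sum_{j=1}^d c_jA_j$ is invertible; and $(\mathfrak{d})$ there exists $V\in\mathbb{C}^n$ such that, if $D$ is the $n\times d$ matrix with $j$-th column $A_jV$ and $B={}^t\overline{D}A^{-1}D$, then $\mathrm{Re}\, B$ is invertible. $\mathcal{A}^{1,\alpha}$ is the space of functions $\overline\Delta\to\mathbb{C}$ holomorphic on $\Delta$ whose trace on $\partial\Delta$ is of class $\mathcal{C}^{1,\alpha}$; $\|\cdot\|_{1,\alpha}$ denotes the usual $\mathcal{C}^{1,\alpha}$ norm on $\partial\Delta$. For a submanifold $M=\{r=0\}$ with $r=(r_1,\dots,r_d)$, let $N^*_{q}M=\mathrm{span}_{\mathbb{R}}\{\partial r_1(q),\dots,\partial r_d(q)\}$ be the conormal fiber at $q\in M$. $\mathcal{S}(M)$ is the set of discs $\boldsymbol f=(f,\tilde f):\overline\Delta\to T^*\mathbb{C}^N\cong\mathbb{C}^{2N}$, continuous on $\overline\Delta$ and holomorphic on $\Delta$, with $f$ non-constant, such that for all $\zeta\in\partial\Delta$ one has $f(\zeta)\in M$ and $\tilde f(\zeta)\in\zeta N^*_{f(\zeta)}M\setminus\{0\}$ (lifts of stationary discs). $\mathcal{A}\subset(\mathcal{A}^{1,\alpha})^{2N}$ is the affine space of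 discs of the form $\left((1-\zeta)h,(1-\zeta)g,(1-\zeta)\tilde h,(1-\zeta)\tilde g+\frac{\zeta}{2}c\right)$ with $h,\tilde h\in(\mathcal{A}^{1,\alpha})^n$ and $g,\tilde g\in(\mathcal{A}^{1,\alpha})^d$ (so their value at $\zeta=1$ is $(0,0,0,c/2)$), and $\mathcal{S}_0(M)=\mathcal{S}(M)\cap\mathcal{A}$. *)

theory Defs
  imports "HOL-Analysis.Analysis"
begin

unbundle no fps_syntax

section \<open>Spaces\<close>

text \<open>The space \<open>\<complex>\<^sup>N = \<complex>\<^sup>n\<^sub>z \<times> \<complex>\<^sup>d\<^sub>w\<close>; the product norm is the Euclidean one, so
  \<^term>\<open>ball 0 1\<close> is the unit ball. The cotangent bundle is identified with pairs (point, covector).\<close>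

type_synonym ('n, 'd) cspace = "(complex ^ 'n) \<times> (complex ^ 'd)"
type_synonym ('n, 'd) disc = "complex \<Rightarrow> ('n, 'd) cspace \<times> ('n, 'd) cspace"

definition cscale :: "complex \<Rightarrow> ('n::finite, 'd::finite) cspace \<Rightarrow> ('n, 'd) cspace" where
  "cscale a p = (a *s fst p, a *s snd p)"


section \<open>Quadrics and nondegeneracy\<close>

definition conj_transpose :: "complex ^ 'n ^ 'm \<Rightarrow> complex ^ 'm ^ 'n" where
  "conj_transpose M = map_matrix cnj (transpose M)"

definition hermitian :: "complex ^ 'n ^ 'n \<Rightarrow> bool" where
  "hermitian M \<longleftrightarrow> conj_transpose M = M"

definition conj_vec :: "complex ^ 'n \<Rightarrow> complex ^ 'n" where
  "conj_vec v = (\<chi> k. cnj (v $ k))"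

definition herm_form :: "complex ^ 'n ^ 'n \<Rightarrow> complex ^ 'n \<Rightarrow> complex" where
  "herm_form M v = (\<Sum>k\<in>UNIV. cnj (v $ k) * (M *v v) $ k)"

text \<open>\<^const>\<open>herm_form\<close> of a Hermitian matrix is real; \<^const>\<open>Re\<close> is only a type conversion.\<close>

definition quadric :: "('d \<Rightarrow> complex ^ 'n ^ 'n) \<Rightarrow> ('n::finite, 'd::finite) cspace \<Rightarrow> real ^ 'd" where
  "quadric A p = (\<chi> j. Re (snd p $ j) - Re (herm_form (A j) (fst p)))"

definition pencil :: "('d::finite \<Rightarrow> complex ^ 'n ^ 'n) \<Rightarrow> real ^ 'd \<Rightarrow> complex ^ 'n ^ 'n" where
  "pencil A c = (\<Sum>j\<in>UNIV. c $ j *\<^sub>R A j)"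

definition D_matrix :: "('d \<Rightarrow> complex ^ 'n ^ 'n) \<Rightarrow> complex ^ 'n \<Rightarrow> complex ^ 'd ^ 'n" where
  "D_matrix A V = (\<chi> k j. (A j *v V) $ k)"

definition B_matrix ::
  "('d::finite \<Rightarrow> complex ^ 'n ^ 'n) \<Rightarrow> real ^ 'd \<Rightarrow> complex ^ 'n \<Rightarrow> complex ^ 'd ^ 'd" where
  "B_matrix A c V = conj_transpose (D_matrix A V) ** matrix_inv (pencil A c) ** D_matrix A V"

definition cond_t :: "('d::finite \<Rightarrow> complex ^ 'n ^ 'n) \<Rightarrow> real ^ 'd \<Rightarrow> bool" where
  "cond_t A c \<longleftrightarrow> invertible (pencil A c)"

definition cond_d :: "('d::finite \<Rightarrow> complex ^ 'n ^ 'n) \<Rightarrow> real ^ 'd \<Rightarrow> complex ^ 'n \<Rightarrow> bool" where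
  "cond_d A c V \<longleftrightarrow> invertible (map_matrix Re (B_matrix A c V))"

definition D_nondegenerate :: "('d::finite \<Rightarrow> complex ^ 'n ^ 'n) \<Rightarrow> bool" where
  "D_nondegenerate A \<longleftrightarrow> (\<exists>c. cond_t A c \<and> (\<exists>V. cond_d A c V))"


section \<open>The space of \<open>d\<close>-tuples of \<open>\<C>\<^sup>4\<close> functions on the unit ball\<close>

text \<open>Iterated partial derivatives along the directions in a list, last entry first.\<close>

primrec iter_deriv ::
  "'a::euclidean_space list \<Rightarrow> ('a \<Rightarrow> 'b::real_normed_vector) \<Rightarrow> 'a \<Rightarrow> 'b" where
  "iter_deriv [] f = f"
| "iter_deriv (b # bs) f = (\<lambda>x. frechet_derivative (iter_deriv bs f) (at x) b)"

definition multi_indices :: "nat \<Rightarrow> 'a::euclidean_space list set" where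
  "multi_indices m = {bs. set bs \<subseteq> Basis \<and> length bs \<le> m}"

text \<open>The Banach space of functions of class \<open>\<C>\<^sup>m\<close> on the open unit ball all of whose derivatives of
  order at most \<open>m\<close> are bounded, with the sup norm and its topology. Functions are total, but
  only their values on the ball matter. With \<open>f\<close> taking values in \<open>\<real>\<^sup>d\<close> this is the space of
  \<open>d\<close>-tuples.\<close>

definition Cspace :: "nat \<Rightarrow> ('a::euclidean_space \<Rightarrow> 'b::real_normed_vector) set" where
  "Cspace m = {f.
     (\<forall>bs\<in>multi_indices m.
        continuous_on (ball 0 1) (iter_deriv bs f) \<and>
        bounded (iter_deriv bs f ` ball 0 1) \<and>
        (length bs < m \<longrightarrow> iter_deriv bs f differentiable_on ball 0 1))}"

definition Cnorm :: "nat \<Rightarrow> ('a::euclidean_space \<Rightarrow> 'b::real_normed_vector) \<Rightarrow> real" where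
  "Cnorm m f = (SUP (bs, x) \<in> multi_indices m \<times> ball 0 1. norm (iter_deriv bs f x))"

definition Copen :: "nat \<Rightarrow> ('a::euclidean_space \<Rightarrow> 'b::real_normed_vector) set \<Rightarrow> bool" where
  "Copen m U \<longleftrightarrow> U \<subseteq> Cspace m \<and>
     (\<forall>r\<in>U. \<exists>\<delta>>0. \<forall>s\<in>Cspace m. Cnorm m (\<lambda>x. s x - r x) < \<delta> \<longrightarrow> s \<in> U)"


section \<open>\<open>\<C>\<^bsup>1,\<alpha>\<^esup>\<close> functions on the circle\<close>

definition circle_deriv :: "(complex \<Rightarrow> 'a::real_normed_vector) \<Rightarrow> real \<Rightarrow> 'a" where
  "circle_deriv v \<theta> = vector_derivative (\<lambda>t. v (cis t)) (at \<theta>)"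

definition C1_holder :: "real \<Rightarrow> (complex \<Rightarrow> 'a::real_normed_vector) \<Rightarrow> bool" where
  "C1_holder \<alpha> v \<longleftrightarrow>
     (\<forall>\<theta>. (\<lambda>t. v (cis t)) differentiable (at \<theta>)) \<and>
     (\<exists>K. \<forall>\<theta> \<phi>. norm (circle_deriv v \<theta> - circle_deriv v \<phi>) \<le> K * dist (cis \<theta>) (cis \<phi>) powr \<alpha>)"

text \<open>Only meaningful for functions satisfying \<^const>\<open>C1_holder\<close>, for which the suprema are finite.\<close>

definition C1_holder_norm :: "real \<Rightarrow> (complex \<Rightarrow> 'a::real_normed_vector) \<Rightarrow> real" where
  "C1_holder_norm \<alpha> v =
     (SUP \<theta>. norm (v (cis \<theta>))) +
     (SUP \<theta>. norm (circle_deriv v \<theta>)) +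
     (SUP (\<theta>, \<phi>) \<in> {(\<theta>, \<phi>). cis \<theta> \<noteq> cis \<phi>}.
        norm (circle_deriv v \<theta> - circle_deriv v \<phi>) / dist (cis \<theta>) (cis \<phi>) powr \<alpha>)"

definition A1 :: "real \<Rightarrow> (complex \<Rightarrow> complex) set" where
  "A1 \<alpha> = {u. continuous_on (cball 0 1) u \<and> u holomorphic_on ball 0 1 \<and> C1_holder \<alpha> u}"

definition A1_vec :: "real \<Rightarrow> (complex \<Rightarrow> complex ^ 'k) set" where
  "A1_vec \<alpha> = {u. \<forall>k. (\<lambda>\<zeta>. u \<zeta> $ k) \<in> A1 \<alpha>}"


section \<open>Lifts of stationary discs\<close>

text \<open>The \<open>(1,0)\<close>-differential \<open>\<partial>u\<close>, with coefficients \<open>\<partial>u/\<partial>z\<^sub>k = (\<partial>u/\<partial>x\<^sub>k - \<i> \<partial>u/\<partial>y\<^sub>k) / 2\<close>.\<close>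

definition del :: "(('n::finite, 'd::finite) cspace \<Rightarrow> real) \<Rightarrow> ('n, 'd) cspace \<Rightarrow> ('n, 'd) cspace" where
  "del u q =
     (let L = frechet_derivative u (at q) in
      ((\<chi> k. (of_real (L (axis k 1, 0)) - \<i> * of_real (L (axis k \<i>, 0))) / 2),
       (\<chi> j. (of_real (L (0, axis j 1)) - \<i> * of_real (L (0, axis j \<i>))) / 2)))"

definition conormal ::
  "(('n::finite, 'd::finite) cspace \<Rightarrow> real ^ 'd) \<Rightarrow> ('n, 'd) cspace \<Rightarrow> ('n, 'd) cspace set" where
  "conormal r q = span (range (\<lambda>j. del (\<lambda>p. r p $ j) q))"

text \<open>Here \<open>M = {q \<in> \<Omega>. r q = 0}\<close>, where the open set \<open>\<Omega>\<close> is the domain of \<open>r\<close>. A disc is a function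
  on the closed unit disc, encoded as an extensional function, so that equality of
  discs is equality in HOL.\<close>

definition stationary_lifts ::
  "('n::finite, 'd::finite) cspace set \<Rightarrow> (('n, 'd) cspace \<Rightarrow> real ^ 'd) \<Rightarrow> ('n, 'd) disc set" where
  "stationary_lifts \<Omega> r = {f \<in> extensional (cball 0 1).
     continuous_on (cball 0 1) f \<and>
     (\<forall>k. (\<lambda>\<zeta>. fst (fst (f \<zeta>)) $ k) holomorphic_on ball 0 1) \<and>
     (\<forall>j. (\<lambda>\<zeta>. snd (fst (f \<zeta>)) $ j) holomorphic_on ball 0 1) \<and>
     (\<forall>k. (\<lambda>\<zeta>. fst (snd (f \<zeta>)) $ k) holomorphic_on ball 0 1) \<and>
     (\<forall>j. (\<lambda>\<zeta>. snd (snd (f \<zeta>)) $ j) holomorphic_on ball 0 1) \<and>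
     \<not> (\<lambda>\<zeta>. fst (f \<zeta>)) constant_on cball 0 1 \<and>
     (\<forall>\<zeta>\<in>sphere 0 1.
        fst (f \<zeta>) \<in> \<Omega> \<and> r (fst (f \<zeta>)) = 0 \<and>
        snd (f \<zeta>) \<in> cscale \<zeta> ` conormal r (fst (f \<zeta>)) - {0})}"

definition affine_discs :: "real \<Rightarrow> real ^ 'd \<Rightarrow> ('n::finite, 'd::finite) disc set" where
  "affine_discs \<alpha> c =
     {restrict (\<lambda>\<zeta>. (((1 - \<zeta>) *s h \<zeta>, (1 - \<zeta>) *s g \<zeta>),
                     ((1 - \<zeta>) *s h' \<zeta>, (1 - \<zeta>) *s g' \<zeta> + (\<chi> j. \<zeta> / 2 * of_real (c $ j))))) (cball 0 1)
      | h g h' g'. h \<in> A1_vec \<alpha> \<and> g \<in> A1_vec \<alpha> \<and> h' \<in> A1_vec \<alpha> \<and> g' \<in> A1_vec \<alpha>}"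

definition stationary_lifts0 ::
  "real \<Rightarrow> real ^ 'd \<Rightarrow> ('n::finite, 'd::finite) cspace set \<Rightarrow>
   (('n, 'd) cspace \<Rightarrow> real ^ 'd) \<Rightarrow> ('n, 'd) disc set" where
  "stationary_lifts0 \<alpha> c \<Omega> r = stationary_lifts \<Omega> r \<inter> affine_discs \<alpha> c"

definition initial_disc ::
  "('d \<Rightarrow> complex ^ 'n ^ 'n) \<Rightarrow> real ^ 'd \<Rightarrow> complex ^ 'n \<Rightarrow> ('n::finite, 'd::finite) disc" where
  "initial_disc A c V = restrict (\<lambda>\<zeta>.
     (((1 - \<zeta>) *s V, (\<chi> j. 2 * (1 - \<zeta>) * herm_form (A j) V)),
      ((1 - \<zeta>) *s (conj_vec V v* pencil A c), (\<chi> j. \<zeta> / 2 * of_real (c $ j))))) (cball 0 1)"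

text \<open>Discs live on the closed disc only, so the complex derivative at the boundary point \<open>1\<close> is
  taken within it.\<close>

definition deriv_at_1 :: "('n::finite, 'd::finite) disc \<Rightarrow> ('n, 'd) cspace \<times> ('n, 'd) cspace" where
  "deriv_at_1 f =
     (THE D. (f has_derivative (\<lambda>t. (cscale t (fst D), cscale t (snd D)))) (at 1 within cball 0 1))"

definition jet1 ::
  "('n::finite, 'd::finite) disc \<Rightarrow>
   (('n, 'd) cspace \<times> ('n, 'd) cspace) \<times> (('n, 'd) cspace \<times> ('n, 'd) cspace)" where
  "jet1 f = (f 1, deriv_at_1 f)"


section \<open>The initial disc is attached to the quadric\<close>

lemma herm_swap:
  assumes "hermitian M"
  shows "M $ k $ l = cnj (M $ l $ k)"
proof -
  have "conj_transpose M $ k $ l = M $ k $ l" using assms by (simp add: hermitian_def)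
  then show ?thesis by (simp add: conj_transpose_def map_matrix_def transpose_def)
qed

lemma herm_vec:
  assumes "hermitian M"
  shows "conj_vec v v* M = conj_vec (M *v v)"
  by (simp add: vec_eq_iff conj_vec_def vector_matrix_mult_def matrix_vector_mult_def)
     (intro allI sum.cong refl, metis assms herm_swap mult.commute)

lemma pencil_nth: "pencil A c $ k $ l = (\<Sum>j\<in>UNIV. of_real (c $ j) * A j $ k $ l)"
  by (simp add: pencil_def scaleR_conv_of_real[where 'a = complex])

lemma hermitian_pencil:
  assumes "\<And>j. hermitian (A j)"
  shows "hermitian (pencil A c)"
  unfolding hermitian_def
proof (simp add: vec_eq_iff conj_transpose_def map_matrix_def transpose_def pencil_nth, intro allI sum.cong refl)
  fix k l j show "complex_of_real (c $ j) * cnj (A j $ l $ k) = complex_of_real (c $ j) * A j $ k $ l"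
    using herm_swap[OF assms, of j k l] by simp
qed

lemma pencil_mv: "(pencil A c *v z) $ k = (\<Sum>j\<in>UNIV. of_real (c $ j) * (A j *v z) $ k)"
proof -
  have "(pencil A c *v z) $ k = (\<Sum>l\<in>UNIV. \<Sum>j\<in>UNIV. of_real (c $ j) * A j $ k $ l * z $ l)"
    by (simp add: matrix_vector_mult_def pencil_nth sum_distrib_right)
  also have "\<dots> = (\<Sum>j\<in>UNIV. \<Sum>l\<in>UNIV. of_real (c $ j) * A j $ k $ l * z $ l)"
    by (rule sum.swap)
  finally show ?thesis by (simp add: matrix_vector_mult_def sum_distrib_left mult.assoc)
qed

lemma quadric_deriv:
  "((\<lambda>p. quadric A p $ j) has_derivative
    (\<lambda>(u, v). Re (v $ j) - (\<Sum>k\<in>UNIV. Re (cnj (u $ k) * (A j *v z) $ k + cnj (z $ k) * (A j *v u) $ k)))) (at (z, w))"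
proof -
  note re = bounded_linear.has_derivative[OF bounded_linear_Re]
  note cn = bounded_linear.has_derivative[OF bounded_linear_cnj]
  have f: "((\<lambda>p :: ('a, 'b) cspace. fst p $ k) has_derivative (\<lambda>h. fst h $ k)) F" for k F
    by (intro bounded_linear_imp_has_derivative bounded_linear_compose[OF bounded_linear_vec_nth]
        bounded_linear_fst)
  have s: "((\<lambda>p :: ('a, 'b) cspace. snd p $ l) has_derivative (\<lambda>h. snd h $ l)) F" for l F
    by (intro bounded_linear_imp_has_derivative bounded_linear_compose[OF bounded_linear_vec_nth]
        bounded_linear_snd)
  have m: "((\<lambda>p :: ('a, 'b) cspace. (A j *v fst p) $ k) has_derivative (\<lambda>h. (A j *v fst h) $ k)) F" for k F
    unfolding matrix_vector_mult_def vec_lambda_beta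
    by (intro has_derivative_sum has_derivative_mult_right f)
  have p: "((\<lambda>p :: ('a, 'b) cspace. Re (cnj (fst p $ k) * (A j *v fst p) $ k)) has_derivative
      (\<lambda>h. Re (cnj (fst h $ k) * (A j *v z) $ k + cnj (z $ k) * (A j *v fst h) $ k))) (at (z, w))" for k
    using re[OF has_derivative_mult[OF cn[OF f] m], of k k "(z, w)" UNIV]
    by (simp only: fst_conv add.commute)
  have "((\<lambda>p :: ('a, 'b) cspace. Re (snd p $ j) - (\<Sum>k\<in>UNIV. Re (cnj (fst p $ k) * (A j *v fst p) $ k))) has_derivative
      (\<lambda>h. Re (snd h $ j) - (\<Sum>k\<in>UNIV. Re (cnj (fst h $ k) * (A j *v z) $ k + cnj (z $ k) * (A j *v fst h) $ k)))) (at (z, w))"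
    by (rule has_derivative_diff[OF re[OF s] has_derivative_sum[OF p]])
  then show ?thesis
    unfolding quadric_def herm_form_def vec_lambda_beta Re_sum split_def .
qed

lemma sum_axis: "(\<Sum>k\<in>UNIV. f k * axis i x $ k) = f i * (x::complex)" for i :: "'n::finite"
  by (simp add: axis_def if_distrib cong: if_cong)

lemma del_quadric:
  assumes "hermitian (A j)"
  shows "del (\<lambda>p. quadric A p $ j) (z, w) = (- conj_vec (A j *v z), axis j (1/2))"
proof -
  define L where "L = (\<lambda>(u :: complex^'a, v :: complex^'b). Re (v $ j) - (\<Sum>k\<in>UNIV. Re (cnj (u $ k) * (A j *v z) $ k + cnj (z $ k) * (A j *v u) $ k)))"
  have L: "frechet_derivative (\<lambda>p. quadric A p $ j) (at (z, w)) = L"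
    unfolding L_def by (rule frechet_derivative_at[OF quadric_deriv, symmetric])
  have sw: "(\<Sum>k\<in>UNIV. cnj (z $ k) * (A j *v axis i a) $ k) = cnj ((A j *v z) $ i) * a" for i a
  proof -
    have "(\<Sum>k\<in>UNIV. cnj (z $ k) * (A j *v axis i a) $ k) = (\<Sum>k\<in>UNIV. cnj (z $ k) * (A j $ k $ i) * a)"
      by (simp add: matrix_vector_mult_def sum_axis mult.assoc)
    also have "\<dots> = (\<Sum>k\<in>UNIV. cnj (A j $ i $ k * z $ k) * a)"
      by (intro sum.cong refl) (simp add: herm_swap[OF assms, of i])
    finally show ?thesis by (simp add: matrix_vector_mult_def sum_distrib_right)
  qed
  have s1: "(\<Sum>k\<in>UNIV. cnj (axis i a $ k) * (A j *v z) $ k) = cnj a * (A j *v z) $ i" for i a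
  proof -
    have "cnj (axis i a $ k) = axis i (cnj a) $ k" for k by (simp add: axis_def)
    then show ?thesis using sum_axis[of "\<lambda>k. (A j *v z) $ k" i "cnj a"] by (simp add: mult.commute)
  qed
  have Lz: "L (axis i a, 0) = - Re (cnj a * (A j *v z) $ i + cnj ((A j *v z) $ i) * a)" for i a
  proof -
    have "L (axis i a, 0) = - Re (\<Sum>k\<in>UNIV. cnj (axis i a $ k) * (A j *v z) $ k + cnj (z $ k) * (A j *v axis i a) $ k)"
      unfolding L_def by simp
    then show ?thesis by (simp only: sum.distrib s1 sw)
  qed
  have Lw: "L (0, axis i a) = (if i = j then Re a else 0)" for i a
    unfolding L_def by (simp add: axis_def)
  show ?thesis unfolding del_def L Let_def Lz Lw
    by (auto simp: vec_eq_iff conj_vec_def axis_def complex_eq_iff)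
qed

lemma not_invertible_0: "\<not> invertible (0 :: ('a::{comm_semiring_1} ^ 'n ^ 'm))"
proof
  assume "invertible (0 :: 'a ^ 'n ^ 'm)"
  then obtain B :: "'a ^ 'm ^ 'n" where "0 ** B = mat 1"
    unfolding invertible_def by blast
  then have "(0 ** B) $ undefined $ undefined = (mat 1 :: 'a ^ 'm ^ 'm) $ undefined $ undefined"
    by simp
  then show False by (simp add: matrix_matrix_mult_def mat_def)
qed

lemma A1_const: "(\<lambda>_. a) \<in> A1 \<alpha>"
  by (auto simp: A1_def C1_holder_def circle_deriv_def vector_derivative_const_at intro!: exI[of _ 0])

lemma initial_disc_in_lifts:
  assumes "\<And>j. hermitian (A j)" and t: "cond_t A c" and "cond_d A c V"
  shows "initial_disc A c V \<in> stationary_lifts0 \<alpha> c UNIV (quadric A)"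
proof -
  have V: "V \<noteq> 0"
  proof
    assume "V = 0"
    then have "D_matrix A V = 0" by (simp add: D_matrix_def vec_eq_iff matrix_vector_mult_def)
    then have "map_matrix Re (B_matrix A c V) = 0"
      by (simp add: B_matrix_def map_matrix_def vec_eq_iff matrix_matrix_mult_def)
    with assms(3) show False by (simp add: cond_d_def not_invertible_0)
  qed
  have c: "c \<noteq> 0"
  proof
    assume "c = 0"
    then have "pencil A c = 0" by (simp add: pencil_def)
    with t show False by (simp add: cond_t_def not_invertible_0)
  qed
  have aff: "initial_disc A c V \<in> affine_discs \<alpha> c"
    unfolding affine_discs_def initial_disc_def mem_Collect_eq
    by (rule exI[of _ "\<lambda>_. V"], rule exI[of _ "\<lambda>_. \<chi> j. 2 * herm_form (A j) V"],
        rule exI[of _ "\<lambda>_. conj_vec V v* pencil A c"], rule exI[of _ "\<lambda>_. 0"])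
       (auto simp: A1_vec_def A1_const vec_eq_iff algebra_simps intro!: ext arg_cong2[where f = restrict])
  let ?F = "\<lambda>\<zeta>. (((1 - \<zeta>) *s V, (\<chi> j. 2 * (1 - \<zeta>) * herm_form (A j) V)),
      ((1 - \<zeta>) *s (conj_vec V v* pencil A c), (\<chi> j. \<zeta> / 2 * of_real (c $ j))))"
  have F: "initial_disc A c V \<zeta> = ?F \<zeta>" if "\<zeta> \<in> cball 0 1" for \<zeta>
    using that by (simp add: initial_disc_def)
  have Fball: "X (?F \<zeta>) = X (initial_disc A c V \<zeta>)" if "\<zeta> \<in> ball 0 1"
    for \<zeta> and X :: "_ \<Rightarrow> complex"
    using that by (simp add: F)
  have cont: "continuous_on (cball 0 1) (initial_disc A c V)"
  proof (rule continuous_on_eq)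
    show "continuous_on (cball 0 1) ?F"
      unfolding vector_scalar_mult_def by (intro continuous_intros) auto
  qed (simp add: F)
  have nc: "\<not> (\<lambda>\<zeta>. fst (initial_disc A c V \<zeta>)) constant_on cball 0 1"
  proof
    assume "(\<lambda>\<zeta>. fst (initial_disc A c V \<zeta>)) constant_on cball 0 1"
    then obtain a where "\<And>\<zeta>. \<zeta> \<in> cball 0 1 \<Longrightarrow> fst (initial_disc A c V \<zeta>) = a"
      unfolding constant_on_def by blast
    then have "fst (initial_disc A c V 0) = a" "fst (initial_disc A c V 1) = a" by simp_all
    moreover have "fst (fst (initial_disc A c V 0)) = V" "fst (fst (initial_disc A c V 1)) = 0"
      by (simp_all add: initial_disc_def)
    ultimately show False using V by simp
  qed
  have im: "Im (herm_form (A j) v) = 0" for j v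
  proof -
    have "herm_form (A j) v = (\<Sum>l\<in>UNIV. (conj_vec v v* A j) $ l * v $ l)"
      unfolding herm_form_def vector_matrix_mult_def matrix_vector_mult_def conj_vec_def
      by (simp add: sum_distrib_left sum_distrib_right mult_ac) (rule sum.swap)
    also have "\<dots> = (\<Sum>l\<in>UNIV. cnj ((A j *v v) $ l) * v $ l)"
      unfolding herm_vec[OF assms(1)] by (simp add: conj_vec_def)
    also have "\<dots> = cnj (herm_form (A j) v)"
      by (simp add: herm_form_def mult.commute)
    finally have "herm_form (A j) v = cnj (herm_form (A j) v)" .
    then show ?thesis by (simp add: complex_eq_iff)
  qed
  have bd: "quadric A (fst (?F \<zeta>)) = 0 \<and>
      snd (?F \<zeta>) \<in> cscale \<zeta> ` conormal (quadric A) (fst (?F \<zeta>)) - {0}" if "\<zeta> \<in> sphere 0 1" for \<zeta>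
  proof -
    have n: "cmod \<zeta> = 1" using that by simp
    then have nn: "\<zeta> * cnj \<zeta> = 1" by (simp add: complex_norm_square[symmetric])
    have hs: "herm_form M (a *s v) = a * cnj a * herm_form M v" for a v and M :: "complex^'b^'b"
      by (simp add: herm_form_def matrix_vector_mult_def sum_distrib_left mult_ac)
    have rr: "Re ((1 - \<zeta>) * cnj (1 - \<zeta>) * x) = Re (2 * (1 - \<zeta>) * x)" if "Im x = 0" for x
    proof -
      have "(1 - \<zeta>) * cnj (1 - \<zeta>) = 2 - \<zeta> - cnj \<zeta>" using nn by (simp add: algebra_simps)
      then show ?thesis using that by (simp add: algebra_simps)
    qed
    have q: "quadric A (fst (?F \<zeta>)) = 0"
      unfolding quadric_def vec_eq_iff fst_conv snd_conv vec_lambda_beta hs rr[OF im] by simp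
    let ?q = "fst (?F \<zeta>)"
    let ?\<nu> = "\<Sum>j\<in>UNIV. c $ j *\<^sub>R del (\<lambda>p. quadric A p $ j) ?q"
    have "?\<nu> \<in> conormal (quadric A) ?q"
      unfolding conormal_def by (rule span_sum, rule span_scale, rule span_base, rule rangeI)
    moreover have "snd (?F \<zeta>) = cscale \<zeta> ?\<nu>"
    proof -
      have z: "cnj (1 - \<zeta>) * \<zeta> = - (1 - \<zeta>)" using nn by (simp add: algebra_simps)
      have a: "fst ?\<nu> = - conj_vec (pencil A c *v ((1 - \<zeta>) *s V))"
        by (simp add: del_quadric[OF assms(1)] fst_sum vec_eq_iff conj_vec_def pencil_mv scaleR_conv_of_real[where 'a = complex] sum_negf)
      have b: "snd ?\<nu> = (\<chi> j. of_real (c $ j) / 2)"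
        by (simp add: del_quadric[OF assms(1)] snd_sum vec_eq_iff scaleR_conv_of_real[where 'a = complex] axis_def if_distrib cong: if_cong)
      have e1: "(1 - \<zeta>) *s (conj_vec V v* pencil A c) = \<zeta> *s fst ?\<nu>"
      proof -
        have cv: "conj_vec (M *v (a *s V)) = cnj a *s conj_vec (M *v V)" for a and M :: "complex^'b^'b"
          by (simp add: vec_eq_iff conj_vec_def matrix_vector_mult_def sum_distrib_left mult_ac)
        have "\<zeta> *s fst ?\<nu> = - ((cnj (1 - \<zeta>) * \<zeta>) *s conj_vec (pencil A c *v V))"
          unfolding a cv vec_eq_iff uminus_vec_def by (simp add: mult_ac del: complex_cnj_diff)
        then show ?thesis unfolding z herm_vec[OF hermitian_pencil[of A, OF assms(1)]]
          by (simp add: vec_eq_iff)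
      qed
      have e2: "(\<chi> j. \<zeta> / 2 * of_real (c $ j)) = \<zeta> *s snd ?\<nu>"
        unfolding b by (simp add: vec_eq_iff)
      show ?thesis unfolding cscale_def e1[symmetric] e2[symmetric] by (rule snd_conv)
    qed
    moreover have "snd (?F \<zeta>) \<noteq> 0"
    proof
      assume "snd (?F \<zeta>) = 0"
      then have "snd (snd (?F \<zeta>)) = 0" by (simp only: snd_zero)
      then have "\<zeta> / 2 * of_real (c $ j) = 0" for j by (simp only: snd_conv vec_eq_iff vec_lambda_beta zero_index)
      then have "c $ j = 0" for j using n by fastforce
      then show False using c by (simp add: vec_eq_iff)
    qed
    ultimately show ?thesis using q by blast
  qed
  have "initial_disc A c V \<in> stationary_lifts UNIV (quadric A)"
    unfolding stationary_lifts_def mem_Collect_eq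
  proof (intro conjI allI ballI cont nc)
    show "initial_disc A c V \<in> extensional (cball 0 1)" by (simp add: initial_disc_def)
  next
    fix \<zeta> :: complex assume z: "\<zeta> \<in> sphere 0 1"
    then have "\<zeta> \<in> cball 0 1" by simp
    from F[OF this] bd[OF z] show "quadric A (fst (initial_disc A c V \<zeta>)) = 0"
      "snd (initial_disc A c V \<zeta>) \<in> cscale \<zeta> ` conormal (quadric A) (fst (initial_disc A c V \<zeta>)) - {0}"
      by simp_all
  qed (rule holomorphic_transform[OF _ Fball], auto intro!: holomorphic_intros)+
  with aff show ?thesis by (simp add: stationary_lifts0_def)
qed

end

theory Submission
  imports Defs "HOL-Complex_Analysis.Cauchy_Integral_Formula"
begin

text \<open>Let \<open>f\<^sub>1\<close>, \<open>f\<^sub>2\<close> be two lifts close to the initial disc, attached to \<open>r = 0\<close> and with the same \<open>1\<close>-jet.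
Both lie in \<open>\<A>\<close>, so equality of the jets makes \<open>f\<^sub>1 - f\<^sub>2\<close> vanish to second order:
\<open>f\<^sub>1 - f\<^sub>2 = (1 - \<zeta>)\<^sup>2 \<omega>\<close> on the circle, where \<open>\<omega> = (z, w, p, q)\<close> is bounded on the circle
and extends holomorphically to the disc. Subtracting the two sets of boundary conditions (the defining equation and the
conormal condition, after elimination of the real multipliers) gives a real-linear system for \<open>f\<^sub>1 - f\<^sub>2\<close>. It
is the linearisation at the initial disc for the quadric, up to an error of size \<open>\<eta> \<bar>f\<^sub>1 - f\<^sub>2\<bar>\<close>, where
\<open>\<eta>\<close> is as small as desired if \<open>r\<close> is close to \<open>\<rho>\<close> and the discs are close to the initial one
(\<open>boundary_linearization\<close>, \<open>conormal_boundary_estimate\<close>). Dividing by \<open>\<bar>1 - \<zeta>\<bar>\<^sup>2\<close> turns it into the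
following system on the circle, up to an error \<open>\<eta> \<bar>\<omega>\<bar>\<close> (\<open>boundary_system_divided\<close>):

  \<^item> \<open>Im q = 0\<close>;
  \<^item> \<open>p + 2 (1 - cnj \<zeta>) cnj D q + cnj \<zeta> cnj (A z) = 0\<close>;
  \<^item> \<open>Re (\<zeta> w) + 2 Re ((1 - \<zeta>) D\<^sup>* z) = 0\<close>.

For \<open>\<eta> = 0\<close> only \<open>\<omega> = 0\<close> solves it. A holomorphic function with real boundary values is constant, so
\<open>q = a \<in> \<real>\<^sup>d\<close>. The second equation then says \<open>(p + 2 cnj (D a)) + cnj \<zeta> cnj (A z - 2 D a) = 0\<close>, a sum
of terms with nonnegative frequencies and of terms with negative ones, so both vanish and
\<open>z = 2 A\<^sup>-\<^sup>1 D a\<close>. The third becomes \<open>Re (\<zeta> w) + 4 Re ((1 - \<zeta>) B a) = 0\<close>, whose mean over the circle is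
\<open>4 (Re B) a = 0\<close>. Since \<open>Re B\<close> is invertible, \<open>a = 0\<close>, and then \<open>z\<close>, \<open>p\<close>, \<open>q\<close> and \<open>w\<close> vanish.

Each of these steps is an inequality between \<open>L\<^sup>2\<close> norms on the circle, obtained from the mean value property
alone (\<open>L2n_hardy_Im\<close>, \<open>L2n_hardy_le\<close>, \<open>circle_mean_le_L2n\<close>), and so survives pointwise errors. The result
is \<open>\<parallel>\<omega>\<parallel> \<le> C \<eta> \<parallel>\<omega>\<parallel>\<close> with \<open>C\<close> depending only on \<open>A\<^sub>1, \<dots>, A\<^sub>d\<close>, \<open>c\<close> and \<open>V\<close>
(\<open>linear_system_estimate\<close>). Hence \<open>\<omega> = 0\<close> if \<open>\<eta>\<close> is small, and \<open>f\<^sub>1 = f\<^sub>2\<close>.\<close>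

section \<open>Means over the circle\<close>

text \<open>Differences of discs are divided by powers of \<open>1 - \<zeta>\<close>, and the quotients need not extend continuously to
\<open>\<zeta> = 1\<close>. That point is left out of the circle, and the parameter interval is open, so that no
value at \<open>1\<close> ever enters.\<close>

definition pcircle :: "complex set" where
  "pcircle = sphere 0 1 - {1}"

definition unit_arc :: "real measure" where
  "unit_arc = restrict_space lborel {0<..<1}"

definition cpoint :: "real \<Rightarrow> complex" where
  "cpoint t = cis (2 * pi * t)"

definition circle_mean :: "(complex \<Rightarrow> 'a::{banach, second_countable_topology}) \<Rightarrow> 'a" where
  "circle_mean g = (\<integral>t. g (cpoint t) \<partial>unit_arc)"

text \<open>Integrands on the circle: this class is closed under the algebraic operations, and each of its
members has a mean.\<close>

definition tame :: "(complex \<Rightarrow> 'a::real_normed_vector) \<Rightarrow> bool" where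
  "tame g \<longleftrightarrow> continuous_on pcircle g \<and> bounded (g ` pcircle)"

lemma space_unit_arc: "space unit_arc = {0<..<1}"
  by (simp add: unit_arc_def space_restrict_space)

lemma prob_unit_arc: "measure unit_arc (space unit_arc) = 1" and finite_measure_unit_arc: "finite_measure unit_arc"
proof -
  have e: "emeasure unit_arc (space unit_arc) = 1"
    by (simp add: space_unit_arc) (simp add: unit_arc_def emeasure_restrict_space)
  then show "measure unit_arc (space unit_arc) = 1" by (simp add: measure_def)
  show "finite_measure unit_arc" by (rule finite_measureI) (simp add: e)
qed

lemma cpoint_in_pcircle: "t \<in> {0<..<1} \<Longrightarrow> cpoint t \<in> pcircle"
proof -
  assume t: "t \<in> {0<..<1}"
  have "cis (2 * pi * t) \<noteq> 1"
  proof
    assume "cis (2 * pi * t) = 1"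
    then have "cos (2 * pi * t) = 1" by (metis Re_complex_of_real cis.sel(1) of_real_1)
    then obtain n :: int where "2 * pi * t = of_int n * 2 * pi" by (auto simp: cos_one_2pi_int)
    then have "t = of_int n" by simp
    with t have "0 < n" "n < 1" by auto
    then show False by simp
  qed
  then show ?thesis by (simp add: cpoint_def pcircle_def)
qed

lemma continuous_on_cpoint: "continuous_on A cpoint"
  unfolding cpoint_def by (intro continuous_intros)

lemma tame_integrable:
  fixes g :: "complex \<Rightarrow> 'a::{banach, second_countable_topology}"
  assumes "tame g"
  shows "integrable unit_arc (\<lambda>t. g (cpoint t))"
proof -
  obtain b where b: "\<And>\<zeta>. \<zeta> \<in> pcircle \<Longrightarrow> norm (g \<zeta>) \<le> b"
    using assms by (auto simp: tame_def bounded_iff)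
  have "continuous_on {0<..<1} (\<lambda>t. g (cpoint t))"
    by (rule continuous_on_compose2[of pcircle g])
       (use assms cpoint_in_pcircle continuous_on_cpoint in \<open>auto simp: tame_def\<close>)
  then have "(\<lambda>t. g (cpoint t)) \<in> borel_measurable unit_arc"
    unfolding unit_arc_def
    by (metis borel_measurable_continuous_on_restrict measurable_cong_sets sets_lborel sets_restrict_space_cong)
  then show ?thesis
    by (intro finite_measure.integrable_const_bound[OF finite_measure_unit_arc, of _ b] AE_I2)
       (auto simp: space_unit_arc intro!: b cpoint_in_pcircle)
qed

lemma tame_const: "tame (\<lambda>_. a)"
  by (auto simp: tame_def bounded_iff)

lemma tame_bounded_linear:
  assumes "bounded_linear L" "tame g"
  shows "tame (\<lambda>\<zeta>. L (g \<zeta>))"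
  using bounded_linear_image[of "g ` pcircle" L] bounded_linear.continuous_on[of L pcircle g] assms
  by (simp add: tame_def image_image)

lemma tame_add: "tame f \<Longrightarrow> tame g \<Longrightarrow> tame (\<lambda>\<zeta>. f \<zeta> + g \<zeta>)"
  unfolding tame_def by (blast intro: continuous_on_add bounded_plus_comp)

lemma tame_diff: "tame f \<Longrightarrow> tame g \<Longrightarrow> tame (\<lambda>\<zeta>. f \<zeta> - g \<zeta>)"
  unfolding tame_def by (blast intro: continuous_on_diff bounded_minus_comp)

lemma tame_mult:
  fixes f g :: "complex \<Rightarrow> 'a::real_normed_algebra"
  assumes "tame f" "tame g" shows "tame (\<lambda>\<zeta>. f \<zeta> * g \<zeta>)"
proof -
  obtain a b where a: "\<And>\<zeta>. \<zeta> \<in> pcircle \<Longrightarrow> norm (f \<zeta>) \<le> a" and b: "\<And>\<zeta>. \<zeta> \<in> pcircle \<Longrightarrow> norm (g \<zeta>) \<le> b"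
    using assms by (auto simp: tame_def bounded_iff)
  have "norm (f \<zeta> * g \<zeta>) \<le> a * b" if "\<zeta> \<in> pcircle" for \<zeta>
    using norm_mult_ineq[of "f \<zeta>" "g \<zeta>"] mult_mono[OF a[OF that] b[OF that]] a[OF that]
      norm_ge_zero[of "f \<zeta>"] norm_ge_zero[of "g \<zeta>"] by linarith
  then have "bounded ((\<lambda>\<zeta>. f \<zeta> * g \<zeta>) ` pcircle)"
    unfolding bounded_iff by blast
  then show ?thesis using assms continuous_on_mult unfolding tame_def by blast
qed

lemma tame_norm: "tame g \<Longrightarrow> tame (\<lambda>\<zeta>. norm (g \<zeta>))"
  by (simp add: tame_def bounded_iff continuous_on_norm)

lemma tame_continuous:
  assumes "continuous_on (sphere 0 1) g"
  shows "tame g"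
proof -
  have "compact (g ` sphere 0 1)" by (rule compact_continuous_image[OF assms]) simp
  then show ?thesis
    using continuous_on_subset[OF assms, of pcircle] bounded_subset[OF compact_imp_bounded, of "g ` sphere 0 1" "g ` pcircle"]
    unfolding tame_def pcircle_def by blast
qed

lemma tame_ident: "tame (\<lambda>\<zeta>. \<zeta>)"
  by (intro tame_continuous continuous_intros)

lemma tame_sum: "(\<And>i. i \<in> I \<Longrightarrow> tame (f i)) \<Longrightarrow> tame (\<lambda>\<zeta>. \<Sum>i\<in>I. f i \<zeta>)"
  by (induction I rule: infinite_finite_induct) (auto simp: tame_const intro: tame_add)

lemmas tame_Re = tame_bounded_linear[OF bounded_linear_Re]
lemmas tame_Im = tame_bounded_linear[OF bounded_linear_Im]
lemmas tame_cnj = tame_bounded_linear[OF bounded_linear_cnj]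
lemmas tame_intros = tame_const tame_add tame_diff tame_mult tame_norm tame_ident tame_sum tame_Re tame_Im tame_cnj

lemma circle_mean_const: "circle_mean (\<lambda>_. a) = a"
  by (simp add: circle_mean_def prob_unit_arc)

lemma circle_mean_add: "tame f \<Longrightarrow> tame g \<Longrightarrow> circle_mean (\<lambda>\<zeta>. f \<zeta> + g \<zeta>) = circle_mean f + circle_mean g"
  by (simp add: circle_mean_def tame_integrable)

lemma circle_mean_mult_left:
  fixes f :: "complex \<Rightarrow> 'a::{real_normed_field, banach, second_countable_topology}"
  shows "tame f \<Longrightarrow> circle_mean (\<lambda>\<zeta>. a * f \<zeta>) = a * circle_mean f"
  by (simp add: circle_mean_def tame_integrable)

lemma circle_mean_bounded_linear:
  "bounded_linear L \<Longrightarrow> tame f \<Longrightarrow> circle_mean (\<lambda>\<zeta>. L (f \<zeta>)) = L (circle_mean f)"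
  unfolding circle_mean_def by (rule integral_bounded_linear[OF _ tame_integrable])

lemma circle_mean_mono:
  fixes f g :: "complex \<Rightarrow> real"
  assumes "tame f" "tame g" "\<And>\<zeta>. \<zeta> \<in> pcircle \<Longrightarrow> f \<zeta> \<le> g \<zeta>"
  shows "circle_mean f \<le> circle_mean g"
  unfolding circle_mean_def
  by (intro integral_mono tame_integrable assms) (simp_all add: space_unit_arc cpoint_in_pcircle)

lemma circle_mean_cong:
  assumes "\<And>\<zeta>. \<zeta> \<in> pcircle \<Longrightarrow> f \<zeta> = g \<zeta>"
  shows "circle_mean f = circle_mean g"
  unfolding circle_mean_def
  by (rule Bochner_Integration.integral_cong) (use assms in \<open>auto simp: space_unit_arc cpoint_in_pcircle\<close>)

text \<open>Cauchy's integral formula on the unit circle: there \<open>d\<zeta> = \<i> \<zeta> dt\<close>, which accounts for the factor \<open>\<zeta>\<close>.\<close>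

lemma cauchy_circle_mean:
  assumes F: "continuous_on (cball 0 1) F" "F holomorphic_on ball 0 1" and w: "w \<in> ball 0 1"
  shows "circle_mean (\<lambda>\<zeta>. F \<zeta> * \<zeta> / (\<zeta> - w)) = F w"
proof -
  let ?g = "\<lambda>\<zeta>. F \<zeta> * \<zeta> / (\<zeta> - w)"
  have "((\<lambda>u. F u / (u - w)) has_contour_integral (2 * of_real pi * \<i> * F w)) (circlepath 0 1)"
    by (rule Cauchy_integral_circlepath[OF F]) (use w in simp)
  then have "((\<lambda>x. F (circlepath 0 1 x) / (circlepath 0 1 x - w) * vector_derivative (circlepath 0 1) (at x))
      has_integral (2 * of_real pi * \<i> * F w)) {0..1}"
    unfolding has_contour_integral .
  moreover have "circlepath 0 1 = cpoint"
    by (auto simp: circlepath cpoint_def cis_conv_exp mult_ac)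
  moreover have "vector_derivative (circlepath 0 1) (at x) = 2 * of_real pi * \<i> * cpoint x" for x
    by (simp add: vector_derivative_circlepath cpoint_def cis_conv_exp mult_ac)
  ultimately have "((\<lambda>x. (2 * of_real pi * \<i>) * ?g (cpoint x))
      has_integral (2 * of_real pi * \<i> * F w)) {0..1}"
    by (simp add: mult_ac)
  then have i: "((\<lambda>x. ?g (cpoint x)) has_integral F w) {0<..<1}"
    using has_integral_mult_right[of _ _ "{0..1::real}" "inverse (2 * of_real pi * \<i>)"]
    by (fastforce simp: has_integral_Icc_iff_Ioo field_simps)
  have "continuous_on (sphere 0 1) ?g"
    by (intro continuous_intros continuous_on_subset[OF F(1)]) (use w in auto)
  then have "set_integrable lborel {0<..<1} (\<lambda>x. ?g (cpoint x))"
    using tame_integrable[OF tame_continuous]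
    by (simp add: unit_arc_def set_integrable_def integrable_restrict_space)
  from set_borel_integral_eq_integral[OF this] i
  have "(LINT x:{0<..<1}|lborel. ?g (cpoint x)) = F w"
    by (metis integral_unique)
  then show ?thesis
    by (simp add: circle_mean_def unit_arc_def integral_restrict_space set_lebesgue_integral_def)
qed

section \<open>Boundary values of bounded holomorphic functions\<close>

text \<open>Boundary values of bounded holomorphic functions whose only singularity on the circle is at \<open>1\<close>, where a
power of \<open>1 - \<zeta>\<close> removes it; \<open>a\<close> is the value at the centre. Asking for a holomorphic multiple \<open>F\<close> instead
of a bounded holomorphic extension of \<open>g\<close> itself makes membership easy to check, since no maximum principle
at the exceptional point is involved.\<close>

definition hardy :: "(complex \<Rightarrow> complex) \<Rightarrow> complex \<Rightarrow> bool" where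
  "hardy g a \<longleftrightarrow> tame g \<and> (\<exists>k F. continuous_on (cball 0 1) F \<and> F holomorphic_on ball 0 1 \<and> F 0 = a \<and>
     (\<forall>\<zeta>\<in>pcircle. (1 - \<zeta>) ^ k * g \<zeta> = F \<zeta>))"

lemma hardy_tame: "hardy g a \<Longrightarrow> tame g"
  by (simp add: hardy_def)

text \<open>The mean value property. For \<open>s < 1\<close> the functions \<open>F / (1 - s \<zeta>)\<^sup>k\<close> are continuous on the closed disc and
take the value \<open>F 0\<close> at the centre. On the circle \<open>\<bar>1 - \<zeta>\<bar> \<le> 2 \<bar>1 - s \<zeta>\<bar>\<close>, so they are dominated by a
multiple of \<open>\<bar>g\<bar>\<close> and their means converge to that of \<open>g\<close> as \<open>s\<close> tends to \<open>1\<close>.\<close>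

lemma hardy_circle_mean:
  assumes "hardy g a"
  shows "circle_mean g = a"
proof -
  obtain k F where F: "continuous_on (cball 0 1) F" "F holomorphic_on ball 0 1" "F 0 = a"
    and gF: "\<And>\<zeta>. \<zeta> \<in> pcircle \<Longrightarrow> (1 - \<zeta>) ^ k * g \<zeta> = F \<zeta>" and g: "tame g"
    using assms by (auto simp: hardy_def)
  define s where "s m = 1 - inverse (real (Suc m))" for m
  define G where "G m \<zeta> = F \<zeta> / (1 - of_real (s m) * \<zeta>) ^ k" for m \<zeta>
  have s: "0 \<le> s m" "s m < 1" for m
    by (auto simp: s_def field_simps)
  have nz: "1 - of_real (s m) * \<zeta> \<noteq> 0" if "norm \<zeta> \<le> 1" for m and \<zeta> :: complex
  proof
    assume "1 - of_real (s m) * \<zeta> = 0"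
    then have "norm (of_real (s m) * \<zeta>) = 1" by (metis eq_iff_diff_eq_0 norm_one)
    then have "s m * norm \<zeta> = 1" using s[of m] by (simp add: norm_mult)
    with s[of m] that show False
      by (metis mult_left_le mult.commute not_less norm_ge_zero)
  qed
  have meanG: "circle_mean (G m) = a" for m
  proof -
    have "circle_mean (\<lambda>\<zeta>. G m \<zeta> * \<zeta> / (\<zeta> - 0)) = G m 0"
      unfolding G_def
      by (rule cauchy_circle_mean)
         (use nz in \<open>auto intro!: continuous_intros holomorphic_intros F\<close>)
    moreover have "circle_mean (\<lambda>\<zeta>. G m \<zeta> * \<zeta> / (\<zeta> - 0)) = circle_mean (G m)"
      by (rule circle_mean_cong) (auto simp: pcircle_def)
    ultimately show ?thesis by (simp add: G_def F)
  qed
  have tameG: "tame (G m)" for m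
    unfolding G_def by (rule tame_continuous)
      (use nz in \<open>auto intro!: continuous_intros continuous_on_subset[OF F(1)]\<close>)
  have bound: "norm (G m \<zeta>) \<le> 2 ^ k * norm (g \<zeta>)" if z: "\<zeta> \<in> pcircle" for m \<zeta>
  proof -
    have n: "norm \<zeta> = 1" using z by (simp add: pcircle_def)
    have "norm (1 - \<zeta>) \<le> norm (1 - of_real (s m) * \<zeta>) + norm (of_real (s m - 1) * \<zeta>)"
      using norm_triangle_ineq[of "1 - of_real (s m) * \<zeta>" "of_real (s m - 1) * \<zeta>"] by (simp add: algebra_simps)
    moreover have "norm (of_real (s m - 1) * \<zeta>) = 1 - s m"
      using s[of m] n by (simp only: norm_mult norm_of_real) simp
    moreover have "1 - s m \<le> norm (1 - of_real (s m) * \<zeta>)"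
      using norm_triangle_ineq2[of 1 "of_real (s m) * \<zeta>"] s[of m] n by (simp add: norm_mult)
    ultimately have "norm (1 - \<zeta>) \<le> 2 * norm (1 - of_real (s m) * \<zeta>)" by simp
    then have "norm (1 - \<zeta>) ^ k \<le> (2 * norm (1 - of_real (s m) * \<zeta>)) ^ k"
      by (intro power_mono) auto
    then have "norm (g \<zeta>) * norm (1 - \<zeta>) ^ k \<le> norm (g \<zeta>) * (2 ^ k * norm (1 - of_real (s m) * \<zeta>) ^ k)"
      by (intro mult_left_mono) (auto simp: power_mult_distrib)
    then show ?thesis
      using nz[of \<zeta> m] n by (simp add: G_def gF[OF z, symmetric] norm_mult norm_divide norm_power divide_simps mult_ac)
  qed
  have lim: "(\<lambda>m. G m \<zeta>) \<longlonglongrightarrow> g \<zeta>" if z: "\<zeta> \<in> pcircle" for \<zeta>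
  proof -
    have "s \<longlonglongrightarrow> 1 - 0" unfolding s_def by (intro tendsto_intros LIMSEQ_inverse_real_of_nat)
    then have "(\<lambda>m. G m \<zeta>) \<longlonglongrightarrow> F \<zeta> / (1 - of_real 1 * \<zeta>) ^ k"
      unfolding G_def by (intro tendsto_intros) (use z in \<open>auto simp: pcircle_def\<close>)
    moreover have "F \<zeta> / (1 - of_real 1 * \<zeta>) ^ k = g \<zeta>"
      using z by (simp add: gF[OF z, symmetric] pcircle_def)
    ultimately show ?thesis by simp
  qed
  have "(\<lambda>m. circle_mean (G m)) \<longlonglongrightarrow> circle_mean g"
    unfolding circle_mean_def
  proof (rule integral_dominated_convergence)
    show "integrable unit_arc (\<lambda>t. 2 ^ k * norm (g (cpoint t)))"
      using tame_integrable[OF tame_norm[OF g]] by simp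
    show "AE t in unit_arc. (\<lambda>m. G m (cpoint t)) \<longlonglongrightarrow> g (cpoint t)"
      by (rule AE_I2) (simp add: space_unit_arc lim cpoint_in_pcircle)
    show "AE t in unit_arc. norm (G m (cpoint t)) \<le> 2 ^ k * norm (g (cpoint t))" for m
      by (rule AE_I2) (simp add: space_unit_arc bound cpoint_in_pcircle)
  qed (use tame_integrable[OF g] tame_integrable[OF tameG] in auto)
  then show ?thesis using meanG by (simp add: LIMSEQ_const_iff)
qed

lemma hardyI:
  assumes "continuous_on (cball 0 1) F" "F holomorphic_on ball 0 1"
    and "tame g" "\<And>\<zeta>. \<zeta> \<in> pcircle \<Longrightarrow> (1 - \<zeta>) ^ k * g \<zeta> = F \<zeta>"
  shows "hardy g (F 0)"
  unfolding hardy_def using assms by blast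

lemma hardy_const: "hardy (\<lambda>_. a) a"
  by (rule hardyI[where k = 0 and F = "\<lambda>_. a"]) (auto intro: tame_const)

lemma hardy_ident: "hardy (\<lambda>\<zeta>. \<zeta>) 0"
  by (rule hardyI[where k = 0 and F = "\<lambda>\<zeta>. \<zeta>"]) (auto intro!: continuous_intros holomorphic_intros tame_ident)

lemma hardy_mult:
  assumes "hardy f a" "hardy g b"
  shows "hardy (\<lambda>\<zeta>. f \<zeta> * g \<zeta>) (a * b)"
proof -
  obtain k F l G where F: "continuous_on (cball 0 1) F" "F holomorphic_on ball 0 1" "F 0 = a"
      "\<And>\<zeta>. \<zeta> \<in> pcircle \<Longrightarrow> (1 - \<zeta>) ^ k * f \<zeta> = F \<zeta>"
    and G: "continuous_on (cball 0 1) G" "G holomorphic_on ball 0 1" "G 0 = b"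
      "\<And>\<zeta>. \<zeta> \<in> pcircle \<Longrightarrow> (1 - \<zeta>) ^ l * g \<zeta> = G \<zeta>"
    using assms unfolding hardy_def by metis
  have "hardy (\<lambda>\<zeta>. f \<zeta> * g \<zeta>) ((\<lambda>\<zeta>. F \<zeta> * G \<zeta>) 0)"
  proof (rule hardyI)
    show "(1 - \<zeta>) ^ (k + l) * (f \<zeta> * g \<zeta>) = F \<zeta> * G \<zeta>" if "\<zeta> \<in> pcircle" for \<zeta>
      using F(4)[OF that, symmetric] G(4)[OF that, symmetric] by (simp add: power_add mult_ac)
  qed (use assms in \<open>auto intro!: continuous_intros holomorphic_intros F G tame_mult simp: hardy_tame\<close>)
  then show ?thesis by (simp add: F G)
qed

lemma hardy_add:
  assumes "hardy f a" "hardy g b"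
  shows "hardy (\<lambda>\<zeta>. f \<zeta> + g \<zeta>) (a + b)"
proof -
  obtain k F l G where F: "continuous_on (cball 0 1) F" "F holomorphic_on ball 0 1" "F 0 = a"
      "\<And>\<zeta>. \<zeta> \<in> pcircle \<Longrightarrow> (1 - \<zeta>) ^ k * f \<zeta> = F \<zeta>"
    and G: "continuous_on (cball 0 1) G" "G holomorphic_on ball 0 1" "G 0 = b"
      "\<And>\<zeta>. \<zeta> \<in> pcircle \<Longrightarrow> (1 - \<zeta>) ^ l * g \<zeta> = G \<zeta>"
    using assms unfolding hardy_def by metis
  have "hardy (\<lambda>\<zeta>. f \<zeta> + g \<zeta>) ((\<lambda>\<zeta>. (1 - \<zeta>) ^ l * F \<zeta> + (1 - \<zeta>) ^ k * G \<zeta>) 0)"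
  proof (rule hardyI)
    show "(1 - \<zeta>) ^ (k + l) * (f \<zeta> + g \<zeta>) = (1 - \<zeta>) ^ l * F \<zeta> + (1 - \<zeta>) ^ k * G \<zeta>" if "\<zeta> \<in> pcircle" for \<zeta>
      using F(4)[OF that, symmetric] G(4)[OF that, symmetric] by (simp add: power_add algebra_simps)
  qed (use assms in \<open>auto intro!: continuous_intros holomorphic_intros F G tame_add simp: hardy_tame\<close>)
  then show ?thesis by (simp add: F G)
qed

lemma hardy_cmult: "hardy g a \<Longrightarrow> hardy (\<lambda>\<zeta>. b * g \<zeta>) (b * a)"
  by (rule hardy_mult[OF hardy_const])

lemma hardy_sum: "(\<And>i. i \<in> I \<Longrightarrow> hardy (f i) (a i)) \<Longrightarrow> hardy (\<lambda>\<zeta>. \<Sum>i\<in>I. f i \<zeta>) (\<Sum>i\<in>I. a i)"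
  by (induction I rule: infinite_finite_induct) (auto intro: hardy_const hardy_add)

section \<open>The square norm on the circle\<close>

definition L2n :: "(complex \<Rightarrow> 'a::real_normed_vector) \<Rightarrow> real" where
  "L2n g = sqrt (circle_mean (\<lambda>\<zeta>. (norm (g \<zeta>))\<^sup>2))"

lemma tame_norm_sq: "tame g \<Longrightarrow> tame (\<lambda>\<zeta>. (norm (g \<zeta>))\<^sup>2)"
  unfolding power2_eq_square by (intro tame_intros)

lemma circle_mean_nonneg:
  fixes f :: "complex \<Rightarrow> real"
  assumes "tame f" "\<And>\<zeta>. \<zeta> \<in> pcircle \<Longrightarrow> 0 \<le> f \<zeta>"
  shows "0 \<le> circle_mean f"
  using circle_mean_mono[OF tame_const assms(1), of 0] assms(2) by (simp add: circle_mean_const)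

lemma L2n_nonneg: "tame g \<Longrightarrow> 0 \<le> L2n g"
  by (simp add: L2n_def circle_mean_nonneg tame_norm_sq)

lemma L2n_sq: "tame g \<Longrightarrow> (L2n g)\<^sup>2 = circle_mean (\<lambda>\<zeta>. (norm (g \<zeta>))\<^sup>2)"
  by (simp add: L2n_def circle_mean_nonneg tame_norm_sq)

lemma L2n_const: "L2n (\<lambda>_. a) = norm a"
  by (simp add: L2n_def circle_mean_const)

lemma L2n_mono:
  assumes "tame f" "tame g" "\<And>\<zeta>. \<zeta> \<in> pcircle \<Longrightarrow> norm (f \<zeta>) \<le> norm (g \<zeta>)"
  shows "L2n f \<le> L2n g"
  unfolding L2n_def
  by (intro real_sqrt_le_mono circle_mean_mono tame_norm_sq assms power_mono) auto

lemma L2n_cong: "(\<And>\<zeta>. \<zeta> \<in> pcircle \<Longrightarrow> norm (f \<zeta>) = norm (g \<zeta>)) \<Longrightarrow> L2n f = L2n g"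
  unfolding L2n_def by (metis (mono_tags, lifting) circle_mean_cong)

lemma L2n_scale:
  assumes "tame g"
  shows "L2n (\<lambda>\<zeta>. a * norm (g \<zeta>)) = \<bar>a\<bar> * L2n g"
  using circle_mean_mult_left[OF tame_norm_sq[OF assms], of "a\<^sup>2"]
  by (simp add: L2n_def abs_mult power_mult_distrib real_sqrt_mult)

lemma circle_mean_Cauchy_Schwarz:
  fixes f g :: "complex \<Rightarrow> real"
  assumes f: "tame f" and g: "tame g"
  shows "circle_mean (\<lambda>\<zeta>. f \<zeta> * g \<zeta>) \<le> L2n f * L2n g"
proof -
  define a b c where "a = (L2n f)\<^sup>2" and "b = (L2n g)\<^sup>2" and "c = circle_mean (\<lambda>\<zeta>. f \<zeta> * g \<zeta>)"
  have pos: "0 \<le> a + (2 * t * c + t\<^sup>2 * b)" for t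
  proof -
    have "0 \<le> circle_mean (\<lambda>\<zeta>. (f \<zeta> + t * g \<zeta>)\<^sup>2)"
      unfolding power2_eq_square by (intro circle_mean_nonneg tame_intros f g) simp
    also have "\<dots> = circle_mean (\<lambda>\<zeta>. (norm (f \<zeta>))\<^sup>2 + (2 * t * (f \<zeta> * g \<zeta>) + t\<^sup>2 * (norm (g \<zeta>))\<^sup>2))"
      by (intro arg_cong[of _ _ circle_mean] ext) (simp add: power2_eq_square algebra_simps)
    also have "\<dots> = a + (2 * t * c + t\<^sup>2 * b)"
      unfolding a_def b_def c_def L2n_sq[OF f] L2n_sq[OF g]
      by (subst circle_mean_add circle_mean_mult_left | intro tame_intros tame_norm_sq f g | simp)+
    finally show ?thesis .
  qed
  have "c\<^sup>2 \<le> a * b"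
  proof (cases "b = 0")
    case True
    have "c = 0"
    proof (rule ccontr)
      assume "c \<noteq> 0"
      then show False using pos[of "- (a + 1) / (2 * c)"] True by (simp add: field_simps)
    qed
    then show ?thesis using True by simp
  next
    case False
    then have "b > 0" by (simp add: b_def)
    then show ?thesis using pos[of "- c / b"] by (simp add: field_simps power2_eq_square)
  qed
  then have "c\<^sup>2 \<le> (L2n f * L2n g)\<^sup>2" by (simp add: a_def b_def power_mult_distrib)
  then show ?thesis
    unfolding c_def by (rule power2_le_imp_le) (simp add: L2n_nonneg f g)
qed

lemma L2n_triangle:
  assumes f: "tame f" and g: "tame g"
  shows "L2n (\<lambda>\<zeta>. f \<zeta> + g \<zeta>) \<le> L2n f + L2n g"
proof -
  have n: "L2n (\<lambda>\<zeta>. norm (h \<zeta>)) = L2n h" for h :: "complex \<Rightarrow> 'a" by (simp add: L2n_def)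
  have "(L2n (\<lambda>\<zeta>. f \<zeta> + g \<zeta>))\<^sup>2 = circle_mean (\<lambda>\<zeta>. (norm (f \<zeta> + g \<zeta>))\<^sup>2)"
    by (intro L2n_sq tame_intros f g)
  also have "\<dots> \<le> circle_mean (\<lambda>\<zeta>. (norm (f \<zeta>))\<^sup>2 + (2 * (norm (f \<zeta>) * norm (g \<zeta>)) + (norm (g \<zeta>))\<^sup>2))"
  proof (intro circle_mean_mono tame_norm_sq tame_intros f g)
    show "(norm (f \<zeta> + g \<zeta>))\<^sup>2 \<le> (norm (f \<zeta>))\<^sup>2 + (2 * (norm (f \<zeta>) * norm (g \<zeta>)) + (norm (g \<zeta>))\<^sup>2)" for \<zeta>
      using power_mono[OF norm_triangle_ineq[of "f \<zeta>" "g \<zeta>"], of 2] by (simp add: power2_sum algebra_simps)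
  qed
  also have "\<dots> = (L2n f)\<^sup>2 + (2 * circle_mean (\<lambda>\<zeta>. norm (f \<zeta>) * norm (g \<zeta>)) + (L2n g)\<^sup>2)"
    unfolding L2n_sq[OF f] L2n_sq[OF g]
    by (subst circle_mean_add circle_mean_mult_left | intro tame_intros tame_norm_sq f g | simp)+
  also have "\<dots> \<le> (L2n f + L2n g)\<^sup>2"
    using circle_mean_Cauchy_Schwarz[OF tame_norm[OF f] tame_norm[OF g]]
    by (simp add: n power2_sum)
  finally show ?thesis
    by (rule power2_le_imp_le) (simp add: L2n_nonneg f g)
qed

lemma L2n_sum_le:
  assumes "\<And>i. i \<in> I \<Longrightarrow> tame (g i)"
  shows "L2n (\<lambda>\<zeta>. \<Sum>i\<in>I. g i \<zeta>) \<le> (\<Sum>i\<in>I. L2n (g i))"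
  using assms
proof (induction I rule: infinite_finite_induct)
  case (insert i I)
  then show ?case
    using L2n_triangle[of "g i" "\<lambda>\<zeta>. \<Sum>i\<in>I. g i \<zeta>"] by (force intro: tame_sum)
qed (simp_all add: L2n_const)

text \<open>The triangle inequality in the form in which pointwise error bounds are integrated: \<open>h\<close> is the total
difference, entering with a small factor, and the \<open>g i\<close> are quantities that have been estimated before.\<close>

lemma L2n_le:
  assumes "tame f" "tame h" "\<And>i. i \<in> I \<Longrightarrow> tame (g i)" "0 \<le> a" "0 \<le> b"
    and le: "\<And>\<zeta>. \<zeta> \<in> pcircle \<Longrightarrow> norm (f \<zeta>) \<le> a * norm (h \<zeta>) + (\<Sum>i\<in>I. b * norm (g i \<zeta>))"
  shows "L2n f \<le> a * L2n h + (\<Sum>i\<in>I. b * L2n (g i))"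
proof -
  have "L2n f \<le> L2n (\<lambda>\<zeta>. a * norm (h \<zeta>) + (\<Sum>i\<in>I. b * norm (g i \<zeta>)))"
    by (intro L2n_mono tame_intros assms) (use le assms in \<open>auto intro: order_trans[OF _ abs_ge_self]\<close>)
  also have "\<dots> \<le> L2n (\<lambda>\<zeta>. a * norm (h \<zeta>)) + L2n (\<lambda>\<zeta>. \<Sum>i\<in>I. b * norm (g i \<zeta>))"
    by (intro L2n_triangle tame_intros assms)
  also have "\<dots> \<le> L2n (\<lambda>\<zeta>. a * norm (h \<zeta>)) + (\<Sum>i\<in>I. L2n (\<lambda>\<zeta>. b * norm (g i \<zeta>)))"
    by (intro add_left_mono L2n_sum_le tame_intros assms)
  also have "\<dots> = a * L2n h + (\<Sum>i\<in>I. b * L2n (g i))"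
    using assms by (simp add: L2n_scale)
  finally show ?thesis .
qed

lemma circle_mean_le_L2n:
  fixes f :: "complex \<Rightarrow> real"
  assumes "tame f"
  shows "\<bar>circle_mean f\<bar> \<le> L2n f"
proof -
  have "circle_mean (\<lambda>\<zeta>. f \<zeta> * 1) \<le> L2n f * 1" "circle_mean (\<lambda>\<zeta>. f \<zeta> * (-1)) \<le> L2n f * 1"
    using circle_mean_Cauchy_Schwarz[OF assms tame_const, of 1] circle_mean_Cauchy_Schwarz[OF assms tame_const, of "-1"]
    by (simp_all add: L2n_const)
  moreover have "circle_mean (\<lambda>\<zeta>. f \<zeta> * (-1)) = - circle_mean f"
    using circle_mean_mult_left[OF assms, of "-1"] by simp
  ultimately show ?thesis by simp
qed

text \<open>The function \<open>\<psi> = g - Re a\<close> has mean \<open>\<i> Im a\<close>, so \<open>\<psi>\<^sup>2\<close> has mean \<open>- (Im a)\<^sup>2 \<le> 0\<close>. Hence the square norm of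
\<open>Re \<psi>\<close> is at most that of \<open>Im \<psi> = Im g\<close>. For vanishing \<open>Im g\<close> this says that a holomorphic function
with real boundary values is a real constant.\<close>

lemma L2n_hardy_Im:
  assumes h: "hardy g a"
  shows "L2n (\<lambda>\<zeta>. g \<zeta> - of_real (Re a)) \<le> 2 * L2n (\<lambda>\<zeta>. Im (g \<zeta>))"
proof -
  define \<psi> where "\<psi> \<zeta> = g \<zeta> - of_real (Re a)" for \<zeta>
  have "hardy (\<lambda>\<zeta>. g \<zeta> + (- of_real (Re a))) (a + (- of_real (Re a)))"
    by (intro hardy_add h hardy_const)
  then have hp: "hardy \<psi> (\<i> * of_real (Im a))"
    by (simp add: \<psi>_def[abs_def]) (metis add_diff_cancel_left' complex_eq)
  note t = hardy_tame[OF h] hardy_tame[OF hp]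
  have "circle_mean (\<lambda>\<zeta>. \<psi> \<zeta> * \<psi> \<zeta>) = - of_real ((Im a)\<^sup>2)"
    using hardy_circle_mean[OF hardy_mult[OF hp hp]] by (simp add: power2_eq_square algebra_simps)
  then have "circle_mean (\<lambda>\<zeta>. Re (\<psi> \<zeta> * \<psi> \<zeta>)) = - (Im a)\<^sup>2"
    by (subst circle_mean_bounded_linear[OF bounded_linear_Re]) (auto intro!: tame_intros t)
  moreover have "circle_mean (\<lambda>\<zeta>. (norm (\<psi> \<zeta>))\<^sup>2) = circle_mean (\<lambda>\<zeta>. Re (\<psi> \<zeta> * \<psi> \<zeta>) + 2 * (norm (Im (g \<zeta>)))\<^sup>2)"
    by (intro arg_cong[of _ _ circle_mean] ext) (simp only: cmod_power2, simp add: \<psi>_def power2_eq_square)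
  moreover have "\<dots> = circle_mean (\<lambda>\<zeta>. Re (\<psi> \<zeta> * \<psi> \<zeta>)) + 2 * circle_mean (\<lambda>\<zeta>. (norm (Im (g \<zeta>)))\<^sup>2)"
    by (subst circle_mean_add circle_mean_mult_left | intro tame_norm_sq tame_intros t | simp)+
  ultimately have "(L2n \<psi>)\<^sup>2 = - (Im a)\<^sup>2 + 2 * (L2n (\<lambda>\<zeta>. Im (g \<zeta>)))\<^sup>2"
    using L2n_sq[OF t(2)] L2n_sq[OF tame_Im[OF t(1)]] by simp
  moreover have "(2 * L2n (\<lambda>\<zeta>. Im (g \<zeta>)))\<^sup>2 = 4 * (L2n (\<lambda>\<zeta>. Im (g \<zeta>)))\<^sup>2"
    by (simp add: power_mult_distrib)
  ultimately have "(L2n \<psi>)\<^sup>2 \<le> (2 * L2n (\<lambda>\<zeta>. Im (g \<zeta>)))\<^sup>2"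
    using zero_le_power2[of "Im a"] zero_le_power2[of "L2n (\<lambda>\<zeta>. Im (g \<zeta>))"] by linarith
  then show ?thesis
    unfolding \<psi>_def[abs_def] by (rule power2_le_imp_le) (simp add: L2n_nonneg tame_Im t)
qed

lemma L2n_hardy_Re:
  assumes h: "hardy g 0"
  shows "L2n g \<le> 2 * L2n (\<lambda>\<zeta>. Re (g \<zeta>))"
proof -
  have "hardy (\<lambda>\<zeta>. \<i> * g \<zeta>) 0" using hardy_cmult[OF h, of \<i>] by simp
  from L2n_hardy_Im[OF this] show ?thesis by (simp add: L2n_def norm_mult)
qed

text \<open>\<open>X\<close> has nonnegative frequencies and \<open>cnj \<zeta> cnj Y\<close> negative ones. Their inner product is the mean of
\<open>X \<zeta> Y\<close>, which vanishes at the centre.\<close>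

lemma L2n_hardy_orthogonal:
  assumes X: "hardy X a" and Y: "hardy Y b"
  shows "(L2n X)\<^sup>2 + (L2n Y)\<^sup>2 = (L2n (\<lambda>\<zeta>. X \<zeta> + cnj \<zeta> * cnj (Y \<zeta>)))\<^sup>2"
proof -
  note t = hardy_tame[OF X] hardy_tame[OF Y]
  have "circle_mean (\<lambda>\<zeta>. X \<zeta> * (\<zeta> * Y \<zeta>)) = 0"
    using hardy_circle_mean[OF hardy_mult[OF X hardy_mult[OF hardy_ident Y]]] by simp
  then have r: "circle_mean (\<lambda>\<zeta>. Re (X \<zeta> * (\<zeta> * Y \<zeta>))) = 0"
    by (subst circle_mean_bounded_linear[OF bounded_linear_Re]) (auto intro!: tame_intros t)
  have "circle_mean (\<lambda>\<zeta>. (norm (X \<zeta> + cnj \<zeta> * cnj (Y \<zeta>)))\<^sup>2)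
      = circle_mean (\<lambda>\<zeta>. ((norm (X \<zeta>))\<^sup>2 + (norm (Y \<zeta>))\<^sup>2) + 2 * Re (X \<zeta> * (\<zeta> * Y \<zeta>)))"
  proof (rule circle_mean_cong)
    fix \<zeta> assume "\<zeta> \<in> pcircle"
    then have n: "norm \<zeta> = 1" by (simp add: pcircle_def)
    have "(norm (x + cnj y))\<^sup>2 = ((norm x)\<^sup>2 + (norm y)\<^sup>2) + 2 * Re (x * y)" for x y
      by (simp only: cmod_power2) (simp add: power2_eq_square algebra_simps)
    from this[of "X \<zeta>" "\<zeta> * Y \<zeta>"] n
    show "(norm (X \<zeta> + cnj \<zeta> * cnj (Y \<zeta>)))\<^sup>2 = ((norm (X \<zeta>))\<^sup>2 + (norm (Y \<zeta>))\<^sup>2) + 2 * Re (X \<zeta> * (\<zeta> * Y \<zeta>))"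
      by (simp add: norm_mult)
  qed
  also have "\<dots> = circle_mean (\<lambda>\<zeta>. (norm (X \<zeta>))\<^sup>2) + circle_mean (\<lambda>\<zeta>. (norm (Y \<zeta>))\<^sup>2)"
    using r by (subst circle_mean_add circle_mean_mult_left | intro tame_norm_sq tame_intros t | simp)+
  finally show ?thesis
    using L2n_sq[OF t(1)] L2n_sq[OF t(2)] L2n_sq[of "\<lambda>\<zeta>. X \<zeta> + cnj \<zeta> * cnj (Y \<zeta>)"] t
    by (simp add: tame_intros)
qed

lemma L2n_hardy_le:
  assumes "hardy X a" "hardy Y b"
  shows "L2n X \<le> L2n (\<lambda>\<zeta>. X \<zeta> + cnj \<zeta> * cnj (Y \<zeta>))" "L2n Y \<le> L2n (\<lambda>\<zeta>. X \<zeta> + cnj \<zeta> * cnj (Y \<zeta>))"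
proof -
  note t = hardy_tame[OF assms(1)] hardy_tame[OF assms(2)]
  have n: "0 \<le> L2n (\<lambda>\<zeta>. X \<zeta> + cnj \<zeta> * cnj (Y \<zeta>))" by (intro L2n_nonneg tame_intros t)
  have "(L2n X)\<^sup>2 \<le> (L2n (\<lambda>\<zeta>. X \<zeta> + cnj \<zeta> * cnj (Y \<zeta>)))\<^sup>2"
       "(L2n Y)\<^sup>2 \<le> (L2n (\<lambda>\<zeta>. X \<zeta> + cnj \<zeta> * cnj (Y \<zeta>)))\<^sup>2"
    using L2n_hardy_orthogonal[OF assms] zero_le_power2[of "L2n X"] zero_le_power2[of "L2n Y"] by linarith+
  then show "L2n X \<le> L2n (\<lambda>\<zeta>. X \<zeta> + cnj \<zeta> * cnj (Y \<zeta>))" "L2n Y \<le> L2n (\<lambda>\<zeta>. X \<zeta> + cnj \<zeta> * cnj (Y \<zeta>))"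
    using n by (auto intro: power2_le_imp_le)
qed

text \<open>A function that vanishes almost everywhere on the circle vanishes inside the disc by Cauchy's formula, and up
to the boundary by continuity.\<close>

lemma eq_zero_if_L2n_eq_zero:
  assumes F: "continuous_on (cball 0 1) F" "F holomorphic_on ball 0 1"
    and g: "tame g" "L2n g = 0" "\<And>\<zeta>. \<zeta> \<in> pcircle \<Longrightarrow> g \<zeta> = 0 \<Longrightarrow> F \<zeta> = 0"
    and z: "\<zeta> \<in> cball 0 1"
  shows "F \<zeta> = 0"
proof -
  have ae: "AE t in unit_arc. g (cpoint t) = 0"
  proof -
    have "(\<integral>t. (norm (g (cpoint t)))\<^sup>2 \<partial>unit_arc) = 0"
      using g(2) by (simp add: L2n_def circle_mean_def)
    moreover have "integrable unit_arc (\<lambda>t. (norm (g (cpoint t)))\<^sup>2)"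
      by (rule tame_integrable[OF tame_norm_sq[OF g(1)]])
    ultimately have "AE t in unit_arc. (norm (g (cpoint t)))\<^sup>2 = 0"
      using integral_nonneg_eq_0_iff_AE[of unit_arc "\<lambda>t. (norm (g (cpoint t)))\<^sup>2"] by simp
    then show ?thesis by simp
  qed
  have "F w = 0" if w: "w \<in> ball 0 1" for w
  proof -
    have "circle_mean (\<lambda>\<zeta>. F \<zeta> * \<zeta> / (\<zeta> - w)) = (\<integral>t. 0 \<partial>unit_arc)"
      unfolding circle_mean_def
    proof (rule integral_cong_AE)
      have "continuous_on (sphere 0 1) (\<lambda>\<zeta>. F \<zeta> * \<zeta> / (\<zeta> - w))"
        by (intro continuous_intros continuous_on_subset[OF F(1)]) (use w in auto)
      from tame_integrable[OF tame_continuous[OF this]]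
      show "(\<lambda>t. F (cpoint t) * cpoint t / (cpoint t - w)) \<in> borel_measurable unit_arc"
        by (rule borel_measurable_integrable)
      show "AE t in unit_arc. F (cpoint t) * cpoint t / (cpoint t - w) = 0"
        using ae AE_space by eventually_elim (simp add: g(3) cpoint_in_pcircle space_unit_arc)
    qed simp
    then show ?thesis using cauchy_circle_mean[OF F w] by simp
  qed
  then show ?thesis
    using continuous_constant_on_closure[of "ball 0 1" F 0 \<zeta>] F(1) z by simp
qed

section \<open>Rigidity of the reduced linear boundary system\<close>

lemma norm_le_sum_components: "norm (x :: 'a::real_normed_vector ^ 'n::finite) \<le> (\<Sum>i\<in>UNIV. norm (x $ i))"
  by (simp add: norm_vec_def L2_set_le_sum)

lemma norm_entry_le: "norm ((M :: complex ^ 'a::finite ^ 'b::finite) $ i $ j) \<le> norm M"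
  using Finite_Cartesian_Product.norm_nth_le[of "M $ i" j] Finite_Cartesian_Product.norm_nth_le[of M i] by linarith

lemma norm_mult_vec_component_le:
  fixes M :: "'a::real_normed_field ^ 'm::finite ^ 'k::finite"
  assumes "\<And>i j. norm (M $ i $ j) \<le> K"
  shows "norm ((M *v x) $ i) \<le> (\<Sum>j\<in>UNIV. K * norm (x $ j))"
proof -
  have "norm ((M *v x) $ i) \<le> (\<Sum>j\<in>UNIV. norm (M $ i $ j * x $ j))"
    unfolding matrix_vector_mult_def by (simp add: norm_sum)
  also have "\<dots> \<le> (\<Sum>j\<in>UNIV. K * norm (x $ j))"
    by (intro sum_mono) (simp add: norm_mult mult_right_mono assms)
  finally show ?thesis .
qed

lemma sum_const_mult_le:
  fixes f :: "'a::finite \<Rightarrow> real"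
  assumes "\<And>i. f i \<le> s" "0 \<le> s" "0 \<le> b" "real CARD('a) \<le> K"
  shows "(\<Sum>i\<in>UNIV. b * f i) \<le> K * b * s"
proof -
  have "(\<Sum>i\<in>UNIV. b * f i) \<le> of_nat CARD('a) * (b * s)"
    by (rule sum_bounded_above) (simp add: assms mult_left_mono)
  also have "\<dots> \<le> K * (b * s)"
    using assms by (intro mult_right_mono) auto
  finally show ?thesis by (simp add: mult.assoc)
qed

lemma tame_vec:
  fixes g :: "complex \<Rightarrow> complex ^ 'n::finite"
  assumes "\<And>k. tame (\<lambda>\<zeta>. g \<zeta> $ k)"
  shows "tame g"
proof -
  have "continuous_on pcircle (\<lambda>\<zeta>. \<chi> k. g \<zeta> $ k)"
    using assms by (intro continuous_on_vec_lambda) (simp add: tame_def)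
  moreover have "tame (\<lambda>\<zeta>. \<Sum>k\<in>UNIV. norm (g \<zeta> $ k))"
    by (intro tame_intros assms)
  then obtain b where b: "\<And>\<zeta>. \<zeta> \<in> pcircle \<Longrightarrow> norm (\<Sum>k\<in>UNIV. norm (g \<zeta> $ k)) \<le> b"
    by (auto simp: tame_def bounded_iff)
  have "norm (g \<zeta>) \<le> b" if "\<zeta> \<in> pcircle" for \<zeta>
    using b[OF that] norm_le_sum_components[of "g \<zeta>"] by (metis abs_ge_self order_trans real_norm_def)
  ultimately show ?thesis by (auto simp: tame_def bounded_iff)
qed

lemma tame_Pair:
  assumes "tame f" "tame g"
  shows "tame (\<lambda>\<zeta>. (f \<zeta>, g \<zeta>))"
proof -
  obtain a b where a: "\<And>\<zeta>. \<zeta> \<in> pcircle \<Longrightarrow> norm (f \<zeta>) \<le> a" and b: "\<And>\<zeta>. \<zeta> \<in> pcircle \<Longrightarrow> norm (g \<zeta>) \<le> b"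
    using assms by (auto simp: tame_def bounded_iff)
  have "norm (f \<zeta>, g \<zeta>) \<le> a + b" if "\<zeta> \<in> pcircle" for \<zeta>
    using norm_Pair_le[of "f \<zeta>" "g \<zeta>"] a[OF that] b[OF that] by linarith
  then have "bounded ((\<lambda>\<zeta>. (f \<zeta>, g \<zeta>)) ` pcircle)" unfolding bounded_iff by blast
  then show ?thesis using assms by (simp add: tame_def continuous_on_Pair)
qed

lemma matrix_inv_left:
  assumes "invertible (M :: 'a::semiring_1 ^ 'n ^ 'm)"
  shows "matrix_inv M ** M = mat 1"
  using someI_ex[of "\<lambda>M'. M ** M' = mat 1 \<and> M' ** M = mat 1"] assms
  unfolding invertible_def matrix_inv_def by blast

lemma D_matrix_mult_vec: "(D_matrix A V *v x) $ k = (\<Sum>j\<in>UNIV. x $ j * (A j *v V) $ k)"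
  by (simp add: D_matrix_def matrix_vector_mult_def[of "\<chi> k j. _ k j"] mult.commute)

lemma conj_transpose_D_matrix_mult_vec:
  "(conj_transpose (D_matrix A V) *v x) $ j = (\<Sum>k\<in>UNIV. cnj ((A j *v V) $ k) * x $ k)"
  by (simp add: D_matrix_def conj_transpose_def map_matrix_def transpose_def matrix_vector_mult_def[of "\<chi> k j. _ k j"])

definition hardy_vec :: "(complex \<Rightarrow> complex ^ 'n) \<Rightarrow> bool" where
  "hardy_vec g \<longleftrightarrow> (\<forall>k. \<exists>a. hardy (\<lambda>\<zeta>. g \<zeta> $ k) a)"

lemma hardy_vec_tame: "hardy_vec g \<Longrightarrow> tame g" for g :: "complex \<Rightarrow> complex ^ 'n::finite"
  unfolding hardy_vec_def by (rule tame_vec) (metis hardy_tame)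

text \<open>The linearised boundary conditions for the quotient \<open>\<omega> = (z, w, p, q)\<close>, up to an error \<open>\<eta> \<bar>\<omega>\<bar>\<close>: the
quantities bounded here are, in this order, \<open>Im q\<close>, \<open>p + 2 (1 - cnj \<zeta>) cnj D q + cnj \<zeta> cnj (A z)\<close> and
\<open>Re (\<zeta> w) + 2 Re ((1 - \<zeta>) D\<^sup>* z)\<close>.\<close>

definition reduced_boundary_system ::
  "('d::finite \<Rightarrow> complex ^ 'n::finite ^ 'n) \<Rightarrow> real ^ 'd \<Rightarrow> complex ^ 'n \<Rightarrow> real \<Rightarrow> complex \<Rightarrow>
    complex ^ 'n \<Rightarrow> complex ^ 'd \<Rightarrow> complex ^ 'n \<Rightarrow> complex ^ 'd \<Rightarrow> bool" where
  "reduced_boundary_system A c V \<eta> \<zeta> z w p q \<longleftrightarrow>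
    (\<forall>j. \<bar>Im (q $ j)\<bar> \<le> \<eta> * norm ((z, w), (p, q))) \<and>
    (\<forall>k. norm (p $ k + 2 * (1 - cnj \<zeta>) * (\<Sum>j\<in>UNIV. q $ j * cnj ((A j *v V) $ k))
        + cnj \<zeta> * cnj ((pencil A c *v z) $ k)) \<le> \<eta> * norm ((z, w), (p, q))) \<and>
    (\<forall>j. \<bar>Re (\<zeta> * w $ j) + 2 * Re ((1 - \<zeta>) * (\<Sum>k\<in>UNIV. cnj ((A j *v V) $ k) * z $ k))\<bar>
        \<le> \<eta> * norm ((z, w), (p, q)))"

text \<open>The stable form of the argument that the homogeneous system has only the zero solution. With
\<open>e = \<eta> \<parallel>\<omega>\<parallel>\<close>, the norms of the following are bounded by multiples of \<open>e\<close>, one after the other: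
\<open>\<psi> = q - a\<close> for the real vector \<open>a\<close> of the real parts of the means of \<open>q\<close>; \<open>X = p + 2 cnj (D a)\<close> and
\<open>Y = A z - 2 D a\<close>; then \<open>Re (\<zeta> w) + 4 Re ((1 - \<zeta>) B a)\<close>, hence its mean \<open>4 (Re B) a\<close> and hence \<open>a\<close>;
and finally \<open>q\<close>, \<open>p\<close>, \<open>z\<close> and \<open>w\<close>. Every passage to a sum over matrix entries costs a factor \<open>K\<^sup>2\<close>: one
\<open>K\<close> for the entries and one for their number.\<close>

lemma linear_system_estimate:
  fixes A :: "'d::finite \<Rightarrow> complex ^ 'n::finite ^ 'n" and c :: "real ^ 'd" and V :: "complex ^ 'n"
    and z p :: "complex \<Rightarrow> complex ^ 'n" and w q :: "complex \<Rightarrow> complex ^ 'd"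
    and \<eta> K :: real
  defines "\<omega> \<equiv> \<lambda>\<zeta>. ((z \<zeta>, w \<zeta>), (p \<zeta>, q \<zeta>))"
  assumes P: "invertible (pencil A c)" and R: "invertible (map_matrix Re (B_matrix A c V))"
    and K: "1 \<le> K" "real CARD('n) \<le> K" "real CARD('d) \<le> K" "norm (D_matrix A V) \<le> K"
      "norm (matrix_inv (pencil A c)) \<le> K" "norm (B_matrix A c V) \<le> K"
      "norm (conj_transpose (D_matrix A V) ** matrix_inv (pencil A c)) \<le> K"
      "\<And>i j. \<bar>matrix_inv (map_matrix Re (B_matrix A c V)) $ i $ j\<bar> \<le> K"
    and H: "hardy_vec z" "hardy_vec w" "hardy_vec p" "hardy_vec q"
    and \<eta>: "0 \<le> \<eta>"
    and system: "\<And>\<zeta>. \<zeta> \<in> pcircle \<Longrightarrow> reduced_boundary_system A c V \<eta> \<zeta> (z \<zeta>) (w \<zeta>) (p \<zeta>) (q \<zeta>)"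
  shows "L2n \<omega> \<le> 400 * K ^ 11 * (\<eta> * L2n \<omega>)"
proof -
  have eq_q: "\<bar>Im (q \<zeta> $ j)\<bar> \<le> \<eta> * norm (\<omega> \<zeta>)"
    and eq_p: "norm (p \<zeta> $ k + 2 * (1 - cnj \<zeta>) * (\<Sum>j\<in>UNIV. q \<zeta> $ j * cnj ((A j *v V) $ k))
          + cnj \<zeta> * cnj ((pencil A c *v z \<zeta>) $ k)) \<le> \<eta> * norm (\<omega> \<zeta>)"
    and eq_w: "\<bar>Re (\<zeta> * w \<zeta> $ j) + 2 * Re ((1 - \<zeta>) * (\<Sum>k\<in>UNIV. cnj ((A j *v V) $ k) * z \<zeta> $ k))\<bar>
          \<le> \<eta> * norm (\<omega> \<zeta>)" if "\<zeta> \<in> pcircle" for \<zeta> j k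
    using system[OF that] unfolding reduced_boundary_system_def \<omega>_def by blast+
  obtain mz where hz: "\<And>k. hardy (\<lambda>\<zeta>. z \<zeta> $ k) (mz k)" using H(1) unfolding hardy_vec_def by metis
  obtain mw where hw: "\<And>j. hardy (\<lambda>\<zeta>. w \<zeta> $ j) (mw j)" using H(2) unfolding hardy_vec_def by metis
  obtain mp where hp: "\<And>k. hardy (\<lambda>\<zeta>. p \<zeta> $ k) (mp k)" using H(3) unfolding hardy_vec_def by metis
  obtain mq where hq: "\<And>j. hardy (\<lambda>\<zeta>. q \<zeta> $ j) (mq j)" using H(4) unfolding hardy_vec_def by metis
  note t = hardy_tame[OF hz] hardy_tame[OF hw] hardy_tame[OF hp] hardy_tame[OF hq]
  have t\<omega>: "tame \<omega>" unfolding \<omega>_def by (intro tame_Pair tame_vec t)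
  define e where "e = \<eta> * L2n \<omega>"
  have e: "0 \<le> e" using \<eta> L2n_nonneg[OF t\<omega>] by (simp add: e_def)
  have Kp: "K ^ m \<le> K ^ l" "1 \<le> K ^ m" if "m \<le> l" for m l using K(1) that by (simp_all add: power_increasing)
  note K0 = order_trans[OF zero_le_one K(1)]
  have Ke: "K ^ m * e \<le> K ^ l * e" if "m \<le> l" for m l using mult_right_mono[OF Kp(1)[OF that] e] .
  let ?P = "pencil A c" let ?D = "D_matrix A V" let ?B = "B_matrix A c V" let ?R = "map_matrix Re ?B"
  let ?M = "conj_transpose ?D ** matrix_inv ?P"
  define a where "a = (\<chi> j. Re (mq j))"
  define ac where "ac = (\<chi> j. complex_of_real (a $ j))"
  define Da where "Da = ?D *v ac"
  define \<psi> where "\<psi> j \<zeta> = q \<zeta> $ j - of_real (a $ j)" for j \<zeta>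
  have t\<psi>: "tame (\<psi> j)" for j unfolding \<psi>_def by (intro tame_intros t)
  have n\<psi>: "L2n (\<psi> j) \<le> 2 * e" for j
  proof -
    have "L2n (\<lambda>\<zeta>. Im (q \<zeta> $ j)) \<le> \<eta> * L2n \<omega> + (\<Sum>i\<in>{}. 0 * L2n \<omega>)"
      by (rule L2n_le) (use eq_q \<eta> in \<open>auto intro!: tame_intros t t\<omega>\<close>)
    then show ?thesis using L2n_hardy_Im[OF hq[of j]] by (simp add: \<psi>_def[abs_def] a_def e_def)
  qed
  have v: "norm ((A j *v V) $ k) \<le> K" for j k
    using order_trans[OF norm_entry_le K(4), of k j] by (simp add: D_matrix_def)
  define X Y where "X k \<zeta> = p \<zeta> $ k + 2 * cnj (Da $ k)" and "Y k \<zeta> = (?P *v z \<zeta>) $ k + (- (2 * Da $ k))" for k \<zeta>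
  have hX: "hardy (X k) (mp k + 2 * cnj (Da $ k))" for k
    unfolding X_def by (intro hardy_add hp hardy_const)
  have hY: "hardy (Y k) ((\<Sum>l\<in>UNIV. ?P $ k $ l * mz l) + (- (2 * Da $ k)))" for k
    unfolding Y_def matrix_vector_mult_def vec_lambda_beta by (intro hardy_add hardy_sum hardy_cmult hz hardy_const)
  have nXY: "L2n (X k) \<le> 9 * K\<^sup>2 * e" "L2n (Y k) \<le> 9 * K\<^sup>2 * e" for k
  proof -
    let ?E = "\<lambda>\<zeta>. X k \<zeta> + cnj \<zeta> * cnj (Y k \<zeta>)"
    have "L2n ?E \<le> \<eta> * L2n \<omega> + (\<Sum>j\<in>UNIV. 4 * K * L2n (\<psi> j))"
    proof (rule L2n_le)
      fix \<zeta> assume z: "\<zeta> \<in> pcircle"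
      have cn: "norm (1 - cnj \<zeta>) \<le> 2" using z norm_triangle_ineq4[of 1 "cnj \<zeta>"] by (simp add: pcircle_def)
      have D: "(\<Sum>j\<in>UNIV. q \<zeta> $ j * cnj ((A j *v V) $ k)) = cnj (Da $ k) + (\<Sum>j\<in>UNIV. \<psi> j \<zeta> * cnj ((A j *v V) $ k))"
        by (simp add: \<psi>_def Da_def ac_def D_matrix_mult_vec algebra_simps sum_subtractf)
      have "?E \<zeta> = (p \<zeta> $ k + 2 * (1 - cnj \<zeta>) * (\<Sum>j\<in>UNIV. q \<zeta> $ j * cnj ((A j *v V) $ k))
          + cnj \<zeta> * cnj ((?P *v z \<zeta>) $ k)) - 2 * (1 - cnj \<zeta>) * (\<Sum>j\<in>UNIV. \<psi> j \<zeta> * cnj ((A j *v V) $ k))"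
        unfolding D X_def Y_def by (simp add: algebra_simps)
      then have "norm (?E \<zeta>) \<le> norm (p \<zeta> $ k + 2 * (1 - cnj \<zeta>) * (\<Sum>j\<in>UNIV. q \<zeta> $ j * cnj ((A j *v V) $ k))
          + cnj \<zeta> * cnj ((?P *v z \<zeta>) $ k)) + norm (2 * (1 - cnj \<zeta>) * (\<Sum>j\<in>UNIV. \<psi> j \<zeta> * cnj ((A j *v V) $ k)))"
        by (simp only: norm_triangle_ineq4)
      also note add_right_mono[OF eq_p[OF z, of k]]
      also have "norm (2 * (1 - cnj \<zeta>) * (\<Sum>j\<in>UNIV. \<psi> j \<zeta> * cnj ((A j *v V) $ k))) \<le> 4 * norm (\<Sum>j\<in>UNIV. \<psi> j \<zeta> * cnj ((A j *v V) $ k))"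
        using cn unfolding norm_mult by (intro mult_right_mono) auto
      also have "\<dots> \<le> 4 * (\<Sum>j\<in>UNIV. K * norm (\<psi> j \<zeta>))"
        using v by (intro mult_left_mono sum_norm_le) (auto simp: norm_mult mult.commute[of K] intro!: mult_left_mono)
      finally show "norm (?E \<zeta>) \<le> \<eta> * norm (\<omega> \<zeta>) + (\<Sum>j\<in>UNIV. 4 * K * norm (\<psi> j \<zeta>))"
        by (simp add: sum_distrib_left mult.assoc)
    qed (use K0 \<eta> t\<psi> t\<omega> hardy_tame[OF hX] hardy_tame[OF hY] in \<open>auto intro!: tame_intros\<close>)
    also have "(\<Sum>j\<in>UNIV. 4 * K * L2n (\<psi> j)) \<le> K * (4 * K) * (2 * e)"
      by (rule sum_const_mult_le) (use K0 K n\<psi> e in auto)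
    finally have "L2n ?E \<le> e + 8 * (K\<^sup>2 * e)" by (simp add: e_def power2_eq_square)
    then have "L2n ?E \<le> 9 * K\<^sup>2 * e" using Ke[of 0 2] by simp
    then show "L2n (X k) \<le> 9 * K\<^sup>2 * e" "L2n (Y k) \<le> 9 * K\<^sup>2 * e"
      using L2n_hardy_le[OF hX hY, of k k] by linarith+
  qed
  have nR: "L2n (\<lambda>\<zeta>. Re (\<zeta> * w \<zeta> $ j) + 4 * Re ((1 - \<zeta>) * (?B *v ac) $ j)) \<le> 37 * K ^ 4 * e" for j
  proof -
    let ?E = "\<lambda>\<zeta>. Re (\<zeta> * w \<zeta> $ j) + 4 * Re ((1 - \<zeta>) * (?B *v ac) $ j)"
    have "L2n ?E \<le> \<eta> * L2n \<omega> + (\<Sum>k\<in>UNIV. 4 * K * L2n (Y k))"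
    proof (rule L2n_le)
      fix \<zeta> assume z: "\<zeta> \<in> pcircle"
      have cn: "norm (1 - \<zeta>) \<le> 2" using z norm_triangle_ineq4[of 1 \<zeta>] by (simp add: pcircle_def)
      let ?y = "\<chi> k. Y k \<zeta>"
      have "?P *v z \<zeta> = ?y + 2 *s Da" by (simp add: Y_def vec_eq_iff)
      moreover have "matrix_inv ?P *v (?P *v z \<zeta>) = z \<zeta>"
        using P by (simp add: matrix_vector_mul_assoc matrix_inv_left)
      ultimately have "z \<zeta> = matrix_inv ?P *v (?y + 2 *s Da)" by simp
      then have "conj_transpose ?D *v z \<zeta> = ?M *v ?y + 2 *s (?B *v ac)"
        by (simp add: Da_def B_matrix_def matrix_vector_mul_assoc[symmetric] matrix_vector_right_distrib vector_scalar_commute)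
      then have D: "(\<Sum>k\<in>UNIV. cnj ((A j *v V) $ k) * z \<zeta> $ k) = (?M *v ?y) $ j + 2 * (?B *v ac) $ j"
        unfolding conj_transpose_D_matrix_mult_vec[symmetric] by simp
      have "?E \<zeta> = (Re (\<zeta> * w \<zeta> $ j) + 2 * Re ((1 - \<zeta>) * (\<Sum>k\<in>UNIV. cnj ((A j *v V) $ k) * z \<zeta> $ k)))
          - 2 * Re ((1 - \<zeta>) * (?M *v ?y) $ j)"
        unfolding D by (simp add: algebra_simps)
      then have "\<bar>?E \<zeta>\<bar> \<le> \<eta> * norm (\<omega> \<zeta>) + 2 * \<bar>Re ((1 - \<zeta>) * (?M *v ?y) $ j)\<bar>"
        using eq_w[OF z, of j] by linarith
      also have "\<bar>Re ((1 - \<zeta>) * (?M *v ?y) $ j)\<bar> \<le> 2 * norm ((?M *v ?y) $ j)"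
        using abs_Re_le_cmod[of "(1 - \<zeta>) * (?M *v ?y) $ j"] mult_right_mono[OF cn norm_ge_zero, of "(?M *v ?y) $ j"]
        unfolding norm_mult by linarith
      also have "norm ((?M *v ?y) $ j) \<le> (\<Sum>k\<in>UNIV. K * norm (?y $ k))"
        by (rule norm_mult_vec_component_le[OF order_trans[OF norm_entry_le K(7)]])
      finally show "norm (?E \<zeta>) \<le> \<eta> * norm (\<omega> \<zeta>) + (\<Sum>k\<in>UNIV. 4 * K * norm (Y k \<zeta>))"
        by (simp add: sum_distrib_left mult.assoc)
    qed (use K0 \<eta> t\<omega> hardy_tame[OF hY] in \<open>auto intro!: tame_intros t\<close>)
    also have "(\<Sum>k\<in>UNIV. 4 * K * L2n (Y k)) \<le> K * (4 * K) * (9 * K\<^sup>2 * e)"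
      by (rule sum_const_mult_le) (use K0 K nXY e in auto)
    finally have "L2n ?E \<le> e + 36 * (K ^ 4 * e)" by (simp add: e_def power2_eq_square eval_nat_numeral)
    then show "L2n ?E \<le> 37 * K ^ 4 * e" using Ke[of 0 4] by simp
  qed
  have tE: "tame (\<lambda>\<zeta>. Re (\<zeta> * w \<zeta> $ j) + 4 * Re ((1 - \<zeta>) * (?B *v ac) $ j))" for j
    by (intro tame_intros t)
  \<comment> \<open>The mean of the holomorphic function \<open>?h\<close> is \<open>4 B a\<close>, because \<open>\<zeta> w\<close> and \<open>\<zeta> B a\<close> vanish at the centre.\<close>
  have ReB: "\<bar>(?R *v a) $ j\<bar> \<le> 10 * K ^ 4 * e" for j
  proof -
    let ?b = "(?B *v ac) $ j"
    let ?h = "\<lambda>\<zeta>. \<zeta> * w \<zeta> $ j + 4 * ((1 + (-1) * \<zeta>) * ?b)"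
    have h: "hardy ?h (0 * mw j + 4 * ((1 + (-1) * 0) * ?b))"
      by (intro hardy_add hardy_mult hardy_const hardy_ident hw)
    have "circle_mean (\<lambda>\<zeta>. Re (?h \<zeta>)) = Re (4 * ?b)"
      using hardy_circle_mean[OF h]
      by (subst circle_mean_bounded_linear[OF bounded_linear_Re hardy_tame[OF h]]) simp
    moreover have "(\<lambda>\<zeta>. Re (?h \<zeta>)) = (\<lambda>\<zeta>. Re (\<zeta> * w \<zeta> $ j) + 4 * Re ((1 - \<zeta>) * (?B *v ac) $ j))"
      by (simp add: fun_eq_iff)
    ultimately have "4 * \<bar>Re ?b\<bar> \<le> 37 * K ^ 4 * e"
      using circle_mean_le_L2n[OF tE, of j] nR[of j] by simp
    moreover have "Re ?b = (?R *v a) $ j"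
      by (simp add: matrix_vector_mult_def map_matrix_def ac_def)
    moreover have "0 \<le> K ^ 4 * e" using K0 e by simp
    ultimately show ?thesis by linarith
  qed
  have na: "\<bar>a $ j\<bar> \<le> 10 * K ^ 6 * e" for j
  proof -
    have "a = matrix_inv ?R *v (?R *v a)"
      using R by (simp add: matrix_vector_mul_assoc matrix_inv_left)
    then have "norm (a $ j) \<le> (\<Sum>i\<in>UNIV. K * norm ((?R *v a) $ i))"
      using norm_mult_vec_component_le[of "matrix_inv ?R" K "?R *v a" j] K(8) by simp
    also have "\<dots> \<le> K * K * (10 * K ^ 4 * e)"
      by (rule sum_const_mult_le) (use K0 K ReB e in auto)
    finally show ?thesis by (simp add: eval_nat_numeral mult_ac)
  qed
  have nDa: "norm (Da $ k) \<le> 10 * K ^ 8 * e" for k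
  proof -
    have "norm (Da $ k) \<le> (\<Sum>i\<in>UNIV. K * norm (ac $ i))"
      unfolding Da_def by (rule norm_mult_vec_component_le[OF order_trans[OF norm_entry_le K(4)]])
    also have "\<dots> \<le> K * K * (10 * K ^ 6 * e)"
      by (rule sum_const_mult_le) (use K0 K na e in \<open>auto simp: ac_def\<close>)
    finally show ?thesis by (simp add: eval_nat_numeral mult_ac)
  qed
  have nB: "norm ((?B *v ac) $ j) \<le> 10 * K ^ 8 * e" for j
  proof -
    have "norm ((?B *v ac) $ j) \<le> (\<Sum>i\<in>UNIV. K * norm (ac $ i))"
      by (rule norm_mult_vec_component_le[OF order_trans[OF norm_entry_le K(6)]])
    also have "\<dots> \<le> K * K * (10 * K ^ 6 * e)"
      by (rule sum_const_mult_le) (use K0 K na e in \<open>auto simp: ac_def\<close>)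
    finally show ?thesis by (simp add: eval_nat_numeral mult_ac)
  qed
  have nq: "L2n (\<lambda>\<zeta>. q \<zeta> $ j) \<le> 12 * K ^ 10 * e" for j
  proof -
    have "L2n (\<lambda>\<zeta>. q \<zeta> $ j) \<le> L2n (\<psi> j) + norm (complex_of_real (a $ j))"
      using L2n_triangle[OF t\<psi> tame_const, of j "complex_of_real (a $ j)"] by (simp add: L2n_const \<psi>_def)
    then show ?thesis using n\<psi>[of j] na[of j] Ke[of 0 10] Ke[of 6 10] by simp
  qed
  have np: "L2n (\<lambda>\<zeta>. p \<zeta> $ k) \<le> 29 * K ^ 10 * e" for k
  proof -
    have "L2n (\<lambda>\<zeta>. p \<zeta> $ k) \<le> L2n (X k) + norm (- 2 * cnj (Da $ k))"
      using L2n_triangle[OF hardy_tame[OF hX] tame_const, of k "- 2 * cnj (Da $ k)"] by (simp add: L2n_const X_def)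
    then show ?thesis using nXY(1)[of k] nDa[of k] Ke[of 2 10] Ke[of 8 10] by (simp add: norm_mult)
  qed
  have nPz: "L2n (\<lambda>\<zeta>. (?P *v z \<zeta>) $ k) \<le> 29 * K ^ 8 * e" for k
  proof -
    have "L2n (\<lambda>\<zeta>. (?P *v z \<zeta>) $ k) \<le> L2n (Y k) + norm (2 * Da $ k)"
      using L2n_triangle[OF hardy_tame[OF hY] tame_const, of k "2 * Da $ k"] by (simp add: L2n_const Y_def)
    then show ?thesis using nXY(2)[of k] nDa[of k] Ke[of 2 8] by (simp add: norm_mult)
  qed
  have tPz: "tame (\<lambda>\<zeta>. (?P *v z \<zeta>) $ k)" for k
    unfolding matrix_vector_mult_def vec_lambda_beta by (intro tame_intros t)
  have nz: "L2n (\<lambda>\<zeta>. z \<zeta> $ k) \<le> 29 * K ^ 10 * e" for k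
  proof -
    have "L2n (\<lambda>\<zeta>. z \<zeta> $ k) \<le> 0 * L2n \<omega> + (\<Sum>l\<in>UNIV. K * L2n (\<lambda>\<zeta>. (?P *v z \<zeta>) $ l))"
    proof (rule L2n_le)
      fix \<zeta>
      have "z \<zeta> = matrix_inv ?P *v (?P *v z \<zeta>)"
        using P by (simp add: matrix_vector_mul_assoc matrix_inv_left)
      then show "norm (z \<zeta> $ k) \<le> 0 * norm (\<omega> \<zeta>) + (\<Sum>l\<in>UNIV. K * norm ((?P *v z \<zeta>) $ l))"
        using norm_mult_vec_component_le[OF order_trans[OF norm_entry_le K(5)], of "?P *v z \<zeta>" k] by simp
    qed (use t t\<omega> tPz K0 in auto)
    also have "(\<Sum>l\<in>UNIV. K * L2n (\<lambda>\<zeta>. (?P *v z \<zeta>) $ l)) \<le> K * K * (29 * K ^ 8 * e)"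
      by (rule sum_const_mult_le) (use K0 K nPz e in auto)
    finally show ?thesis by (simp add: eval_nat_numeral mult_ac)
  qed
  have nw: "L2n (\<lambda>\<zeta>. w \<zeta> $ j) \<le> 300 * K ^ 10 * e" for j
  proof -
    let ?b = "(?B *v ac) $ j" 
    have h: "hardy (\<lambda>\<zeta>. \<zeta> * w \<zeta> $ j) 0" using hardy_mult[OF hardy_ident hw, of j] by simp
    have "L2n (\<lambda>\<zeta>. Re (\<zeta> * w \<zeta> $ j)) \<le> 1 * L2n (\<lambda>\<zeta>. Re (\<zeta> * w \<zeta> $ j) + 4 * Re ((1 - \<zeta>) * ?b))
        + (\<Sum>i\<in>{()}. 1 * L2n (\<lambda>\<zeta>. 8 * ?b))"
    proof (rule L2n_le)
      fix \<zeta> assume z: "\<zeta> \<in> pcircle"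
      have cn: "norm (1 - \<zeta>) \<le> 2" using z norm_triangle_ineq4[of 1 \<zeta>] by (simp add: pcircle_def)
      have "\<bar>Re ((1 - \<zeta>) * ?b)\<bar> \<le> 2 * norm ?b"
        using abs_Re_le_cmod[of "(1 - \<zeta>) * ?b"] mult_right_mono[OF cn norm_ge_zero, of ?b]
        unfolding norm_mult by linarith
      then show "norm (Re (\<zeta> * w \<zeta> $ j)) \<le> 1 * norm (Re (\<zeta> * w \<zeta> $ j) + 4 * Re ((1 - \<zeta>) * ?b)) + (\<Sum>i\<in>{()}. 1 * norm (8 * ?b))"
        unfolding real_norm_def norm_mult by simp
    qed (use tE t in \<open>auto intro!: tame_intros\<close>)
    then have "L2n (\<lambda>\<zeta>. Re (\<zeta> * w \<zeta> $ j)) \<le> 37 * K ^ 4 * e + 8 * norm ?b"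
      using nR[of j] by (simp add: L2n_const norm_mult)
    then have "L2n (\<lambda>\<zeta>. Re (\<zeta> * w \<zeta> $ j)) \<le> 120 * K ^ 10 * e"
      using nB[of j] Ke[of 4 10] Ke[of 8 10] mult_nonneg_nonneg[OF zero_le_power[OF K0, of 10] e] by simp
    moreover have "L2n (\<lambda>\<zeta>. w \<zeta> $ j) = L2n (\<lambda>\<zeta>. \<zeta> * w \<zeta> $ j)"
      by (rule L2n_cong) (simp add: norm_mult pcircle_def)
    ultimately show ?thesis using L2n_hardy_Re[OF h] mult_nonneg_nonneg[OF zero_le_power[OF K0, of 10] e] by simp
  qed
  have vec_bound: "L2n g \<le> K * b" if "\<And>i. tame (\<lambda>\<zeta>. g \<zeta> $ i)" "\<And>i. L2n (\<lambda>\<zeta>. g \<zeta> $ i) \<le> b" "0 \<le> b" "real CARD('i) \<le> K"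
    for g :: "complex \<Rightarrow> complex ^ 'i::finite" and b
  proof -
    have "L2n g \<le> 0 * L2n \<omega> + (\<Sum>i\<in>UNIV. 1 * L2n (\<lambda>\<zeta>. g \<zeta> $ i))"
      by (rule L2n_le) (use that t\<omega> norm_le_sum_components in \<open>auto intro: tame_vec\<close>)
    also have "(\<Sum>i\<in>UNIV. 1 * L2n (\<lambda>\<zeta>. g \<zeta> $ i)) \<le> K * 1 * b"
      by (rule sum_const_mult_le) (use that in auto)
    finally show ?thesis by simp
  qed
  have b0: "0 \<le> b * K ^ 10 * e" if "0 \<le> b" for b using that K0 e by simp
  have "L2n \<omega> \<le> 0 * L2n \<omega> + (\<Sum>i\<in>{..<4::nat}. 1 * L2n (\<lambda>\<zeta>. [norm (z \<zeta>), norm (w \<zeta>), norm (p \<zeta>), norm (q \<zeta>)] ! i))"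
  proof (rule L2n_le)
    show "norm (\<omega> \<zeta>) \<le> 0 * norm (\<omega> \<zeta>) + (\<Sum>i\<in>{..<4::nat}. 1 * norm ([norm (z \<zeta>), norm (w \<zeta>), norm (p \<zeta>), norm (q \<zeta>)] ! i))" for \<zeta>
      using norm_Pair_le[of "(z \<zeta>, w \<zeta>)" "(p \<zeta>, q \<zeta>)"] norm_Pair_le[of "z \<zeta>" "w \<zeta>"] norm_Pair_le[of "p \<zeta>" "q \<zeta>"]
      unfolding \<omega>_def by (simp add: eval_nat_numeral)
    show "tame (\<lambda>\<zeta>. [norm (z \<zeta>), norm (w \<zeta>), norm (p \<zeta>), norm (q \<zeta>)] ! i)" if "i \<in> {..<4}" for i
      using that by (auto simp: eval_nat_numeral less_Suc_eq intro!: tame_norm tame_vec t)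
  qed (use t\<omega> in auto)
  also have "\<dots> = L2n z + L2n w + L2n p + L2n q"
    by (simp add: eval_nat_numeral L2n_def)
  finally have "L2n \<omega> \<le> L2n z + L2n w + L2n p + L2n q" .
  moreover have "L2n z \<le> K * (29 * K ^ 10 * e)" "L2n w \<le> K * (300 * K ^ 10 * e)"
      "L2n p \<le> K * (29 * K ^ 10 * e)" "L2n q \<le> K * (12 * K ^ 10 * e)"
    by (intro vec_bound t nz nw np nq b0 K; simp)+
  moreover have "0 \<le> K ^ 11 * e" using K0 e by simp
  ultimately show ?thesis unfolding e_def[symmetric] by (simp add: eval_nat_numeral mult_ac)
qed

text \<open>For \<open>\<eta>\<close> below the reciprocal of the constant of the estimate, the norm of \<open>\<omega>\<close> is at most half of itself.\<close>

lemma linear_system_rigid: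
  fixes A :: "'d::finite \<Rightarrow> complex ^ 'n::finite ^ 'n" and c :: "real ^ 'd" and V :: "complex ^ 'n"
  assumes P: "invertible (pencil A c)" and R: "invertible (map_matrix Re (B_matrix A c V))"
  shows "\<exists>\<eta>>0. \<forall>z w p q. hardy_vec z \<longrightarrow> hardy_vec w \<longrightarrow> hardy_vec p \<longrightarrow> hardy_vec q \<longrightarrow>
    (\<forall>\<zeta>\<in>pcircle. reduced_boundary_system A c V \<eta> \<zeta> (z \<zeta>) (w \<zeta>) (p \<zeta>) (q \<zeta>)) \<longrightarrow>
    L2n (\<lambda>\<zeta>. ((z \<zeta>, w \<zeta>), (p \<zeta>, q \<zeta>))) = 0"
proof -
  let ?R = "matrix_inv (map_matrix Re (B_matrix A c V))"
  define K where "K = 1 + real CARD('n) + real CARD('d) + norm (D_matrix A V) + norm (matrix_inv (pencil A c))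
    + norm (B_matrix A c V) + norm (conj_transpose (D_matrix A V) ** matrix_inv (pencil A c)) + norm ?R"
  have K: "1 \<le> K" "real CARD('n) \<le> K" "real CARD('d) \<le> K" "norm (D_matrix A V) \<le> K"
      "norm (matrix_inv (pencil A c)) \<le> K" "norm (B_matrix A c V) \<le> K"
      "norm (conj_transpose (D_matrix A V) ** matrix_inv (pencil A c)) \<le> K" "norm ?R \<le> K"
    by (simp_all add: K_def)
  have KR: "\<bar>?R $ i $ j\<bar> \<le> K" for i j
    using Finite_Cartesian_Product.norm_nth_le[of "?R $ i" j] Finite_Cartesian_Product.norm_nth_le[of ?R i] K(8) by simp
  define \<eta> where "\<eta> = 1 / (800 * K ^ 11)"
  have K11: "0 < K ^ 11" using K(1) by simp
  then have \<eta>: "0 < \<eta>" "400 * K ^ 11 * \<eta> = 1 / 2" by (simp_all add: \<eta>_def)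
  show ?thesis
  proof (intro exI[of _ \<eta>] conjI allI impI \<eta>(1))
    fix z p :: "complex \<Rightarrow> complex ^ 'n" and w q :: "complex \<Rightarrow> complex ^ 'd"
    let ?\<omega> = "\<lambda>\<zeta>. ((z \<zeta>, w \<zeta>), (p \<zeta>, q \<zeta>))"
    assume H: "hardy_vec z" "hardy_vec w" "hardy_vec p" "hardy_vec q"
      and E: "\<forall>\<zeta>\<in>pcircle. reduced_boundary_system A c V \<eta> \<zeta> (z \<zeta>) (w \<zeta>) (p \<zeta>) (q \<zeta>)"
    have "L2n ?\<omega> \<le> 400 * K ^ 11 * (\<eta> * L2n ?\<omega>)"
      by (rule linear_system_estimate[OF P R K(1-7) KR H less_imp_le[OF \<eta>(1)] E[rule_format]])
    also have "\<dots> = 1 / 2 * L2n ?\<omega>"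
      unfolding mult.assoc[symmetric] \<eta>(2) ..
    finally have "L2n ?\<omega> \<le> 0" by simp
    moreover have "0 \<le> L2n ?\<omega>"
      by (intro L2n_nonneg tame_Pair hardy_vec_tame H)
    ultimately show "L2n ?\<omega> = 0" by simp
  qed
qed

section \<open>Small perturbations in the space of functions of class \<open>\<C>\<^sup>m\<close>\<close>

lemma Cspace_differentiable_at:
  assumes "f \<in> Cspace m" "set bs \<subseteq> Basis" "length bs < m" "x \<in> ball 0 1"
  shows "iter_deriv bs f differentiable at x"
proof -
  have "bs \<in> multi_indices m" using assms by (simp add: multi_indices_def)
  then have "iter_deriv bs f differentiable_on ball 0 1" using assms by (auto simp: Cspace_def)
  then show ?thesis using assms(4)
    by (metis differentiable_on_eq_differentiable_at open_ball)
qed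

text \<open>Differentiability is known at points of the open ball only, so linearity of the iterated derivatives is
proved there, using that the ball is open to pass to the next derivative.\<close>

lemma iter_deriv_diff:
  assumes f: "f \<in> Cspace m" and g: "g \<in> Cspace m"
    and "set bs \<subseteq> Basis" "length bs \<le> m" "x \<in> ball 0 1"
  shows "iter_deriv bs (\<lambda>x. f x - g x) x = iter_deriv bs f x - iter_deriv bs g x"
  using assms(3-5)
proof (induction bs arbitrary: x)
  case (Cons b bs)
  have d: "iter_deriv bs f differentiable at x" "iter_deriv bs g differentiable at x"
    using Cspace_differentiable_at[OF f, of bs x] Cspace_differentiable_at[OF g, of bs x] Cons.prems by auto
  have "((\<lambda>y. iter_deriv bs f y - iter_deriv bs g y) has_derivative
      (\<lambda>h. frechet_derivative (iter_deriv bs f) (at x) h - frechet_derivative (iter_deriv bs g) (at x) h)) (at x)"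
    using d by (intro has_derivative_diff) (simp_all add: frechet_derivative_works)
  then have "(iter_deriv bs (\<lambda>x. f x - g x) has_derivative
      (\<lambda>h. frechet_derivative (iter_deriv bs f) (at x) h - frechet_derivative (iter_deriv bs g) (at x) h)) (at x)"
    by (rule has_derivative_transform_within_open[OF _ open_ball Cons.prems(3)])
       (use Cons in auto)
  from frechet_derivative_at[OF this] show ?case by (simp add: fun_eq_iff)
qed simp

lemma Cspace_diff:
  assumes f: "f \<in> Cspace m" and g: "g \<in> Cspace m"
  shows "(\<lambda>x. f x - g x) \<in> Cspace m"
  unfolding Cspace_def mem_Collect_eq
proof (intro ballI conjI impI)
  fix bs :: "'a list" assume bs: "bs \<in> multi_indices m"
  then have e: "iter_deriv bs (\<lambda>x. f x - g x) x = iter_deriv bs f x - iter_deriv bs g x" if "x \<in> ball 0 1" for x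
    using iter_deriv_diff[OF f g _ _ that] by (simp add: multi_indices_def)
  have F: "continuous_on (ball 0 1) (iter_deriv bs f)" "bounded (iter_deriv bs f ` ball 0 1)"
    and G: "continuous_on (ball 0 1) (iter_deriv bs g)" "bounded (iter_deriv bs g ` ball 0 1)"
    using bs f g by (auto simp: Cspace_def)
  have "continuous_on (ball 0 1) (\<lambda>x. iter_deriv bs f x - iter_deriv bs g x)"
    by (intro continuous_on_diff F G)
  then show "continuous_on (ball 0 1) (iter_deriv bs (\<lambda>x. f x - g x))"
    by (rule continuous_on_eq) (simp add: e)
  have "bounded ((\<lambda>x. iter_deriv bs f x - iter_deriv bs g x) ` ball 0 1)"
    by (rule bounded_minus_comp[OF F(2) G(2)])
  moreover have "(\<lambda>x. iter_deriv bs f x - iter_deriv bs g x) ` ball 0 1 = iter_deriv bs (\<lambda>x. f x - g x) ` ball 0 1"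
    by (rule image_cong) (simp_all add: e)
  ultimately show "bounded (iter_deriv bs (\<lambda>x. f x - g x) ` ball 0 1)" by simp
  assume "length bs < m"
  then have "iter_deriv bs f differentiable_on ball 0 1" "iter_deriv bs g differentiable_on ball 0 1"
    using bs f g by (auto simp: Cspace_def)
  then have "(\<lambda>x. iter_deriv bs f x - iter_deriv bs g x) differentiable_on ball 0 1"
    by (rule differentiable_on_diff)
  then show "iter_deriv bs (\<lambda>x. f x - g x) differentiable_on ball 0 1"
    unfolding differentiable_on_def
    by (metis (no_types, lifting) differentiable_transform_within e zero_less_one)
qed

lemma norm_iter_deriv_le_Cnorm:
  fixes f :: "'a::euclidean_space \<Rightarrow> 'b::real_normed_vector"
  assumes f: "f \<in> Cspace m" and "set bs \<subseteq> Basis" "length bs \<le> m" "x \<in> ball 0 1"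
  shows "norm (iter_deriv bs f x) \<le> Cnorm m f"
proof -
  have "finite (multi_indices m :: 'a list set)"
    unfolding multi_indices_def by (rule finite_lists_length_le) simp
  moreover have "bounded (iter_deriv bs f ` ball 0 1)" if "bs \<in> multi_indices m" for bs
    using f that by (auto simp: Cspace_def)
  ultimately have "bounded (\<Union>bs\<in>multi_indices m. iter_deriv bs f ` ball 0 1)"
    by (intro bounded_UN) auto
  then obtain B where B: "\<And>bs x. bs \<in> multi_indices m \<Longrightarrow> x \<in> ball 0 1 \<Longrightarrow> norm (iter_deriv bs f x) \<le> B"
    unfolding bounded_iff by fastforce
  have "bdd_above ((\<lambda>(bs, x). norm (iter_deriv bs f x)) ` (multi_indices m \<times> ball 0 1))"
    by (rule bdd_aboveI[of _ B]) (use B in auto)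
  from cSUP_upper[OF _ this, of "(bs, x)"] show ?thesis
    using assms by (simp add: Cnorm_def multi_indices_def)
qed

lemma Cnorm_le:
  fixes f :: "'a::euclidean_space \<Rightarrow> 'b::real_normed_vector"
  assumes "\<And>bs x. set bs \<subseteq> Basis \<Longrightarrow> length bs \<le> m \<Longrightarrow> x \<in> ball 0 1 \<Longrightarrow> norm (iter_deriv bs f x) \<le> B"
  shows "Cnorm m f \<le> B"
proof -
  have "([], 0) \<in> multi_indices m \<times> (ball 0 1 :: 'a set)" by (simp add: multi_indices_def)
  then have "multi_indices m \<times> (ball 0 1 :: 'a set) \<noteq> {}" by blast
  then show ?thesis unfolding Cnorm_def
    by (rule cSUP_least) (use assms in \<open>auto simp: multi_indices_def\<close>)
qed

lemma Copen_Cnorm_ball: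
  assumes g: "g \<in> Cspace m"
  shows "Copen m {r \<in> Cspace m. Cnorm m (\<lambda>x. r x - g x) < \<delta>}"
  unfolding Copen_def
proof (intro conjI ballI)
  fix r assume "r \<in> {r \<in> Cspace m. Cnorm m (\<lambda>x. r x - g x) < \<delta>}"
  then have r: "r \<in> Cspace m" "Cnorm m (\<lambda>x. r x - g x) < \<delta>" by auto
  have "s \<in> {r \<in> Cspace m. Cnorm m (\<lambda>x. r x - g x) < \<delta>}"
    if s: "s \<in> Cspace m" "Cnorm m (\<lambda>x. s x - r x) < \<delta> - Cnorm m (\<lambda>x. r x - g x)" for s
  proof -
    have "Cnorm m (\<lambda>x. s x - g x) \<le> Cnorm m (\<lambda>x. s x - r x) + Cnorm m (\<lambda>x. r x - g x)"
    proof (rule Cnorm_le)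
      fix bs :: "'a list" and x :: 'a assume bx: "set bs \<subseteq> Basis" "length bs \<le> m" "x \<in> ball 0 1"
      have "iter_deriv bs (\<lambda>x. s x - g x) x = iter_deriv bs (\<lambda>x. s x - r x) x + iter_deriv bs (\<lambda>x. r x - g x) x"
        by (simp add: iter_deriv_diff[OF s(1) g bx] iter_deriv_diff[OF s(1) r(1) bx] iter_deriv_diff[OF r(1) g bx])
      then show "norm (iter_deriv bs (\<lambda>x. s x - g x) x) \<le> Cnorm m (\<lambda>x. s x - r x) + Cnorm m (\<lambda>x. r x - g x)"
        using norm_iter_deriv_le_Cnorm[OF Cspace_diff[OF s(1) r(1)] bx]
          norm_iter_deriv_le_Cnorm[OF Cspace_diff[OF r(1) g] bx]
        by (simp add: norm_triangle_mono)
    qed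
    then show ?thesis using s by simp
  qed
  then show "\<exists>\<delta>'>0. \<forall>s\<in>Cspace m. Cnorm m (\<lambda>x. s x - r x) < \<delta>' \<longrightarrow> s \<in> {r \<in> Cspace m. Cnorm m (\<lambda>x. r x - g x) < \<delta>}"
    using r(2) by (intro exI[of _ "\<delta> - Cnorm m (\<lambda>x. r x - g x)"]) simp
qed auto

lemma lipschitz_if_partial_derivatives_bounded:
  fixes f :: "'a::euclidean_space \<Rightarrow> 'b::real_normed_vector"
  assumes d: "\<And>x. x \<in> ball 0 1 \<Longrightarrow> f differentiable at x"
    and le: "\<And>x b. x \<in> ball 0 1 \<Longrightarrow> b \<in> Basis \<Longrightarrow> norm (frechet_derivative f (at x) b) \<le> \<delta>"
    and xy: "x \<in> ball 0 1" "y \<in> ball 0 1"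
  shows "norm (f x - f y) \<le> real DIM('a) * \<delta> * norm (x - y)"
proof (rule differentiable_bound[OF convex_ball[of 0 1] _ _ xy])
  fix x :: 'a assume x: "x \<in> ball 0 1"
  let ?L = "frechet_derivative f (at x)"
  have L: "(f has_derivative ?L) (at x)" using d[OF x] by (simp add: frechet_derivative_works)
  then show "(f has_derivative ?L) (at x within ball 0 1)" by (rule has_derivative_at_withinI)
  interpret bounded_linear ?L by (rule has_derivative_bounded_linear[OF L])
  show "onorm ?L \<le> real DIM('a) * \<delta>"
  proof (rule onorm_le)
    fix h :: 'a
    have "?L h = ?L (\<Sum>b\<in>Basis. (h \<bullet> b) *\<^sub>R b)" by (simp add: euclidean_representation)
    also have "\<dots> = (\<Sum>b\<in>Basis. (h \<bullet> b) *\<^sub>R ?L b)" by (simp add: sum scaleR)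
    finally have "norm (?L h) \<le> (\<Sum>b\<in>Basis. norm ((h \<bullet> b) *\<^sub>R ?L b))" by (metis norm_sum)
    also have "\<dots> \<le> (\<Sum>b\<in>(Basis :: 'a set). norm h * \<delta>)"
      unfolding norm_scaleR by (intro sum_mono mult_mono le[OF x] Basis_le_norm) auto
    finally show "norm (?L h) \<le> real DIM('a) * \<delta> * norm h" by (simp add: mult_ac)
  qed
qed

text \<open>The bounds through which a small \<open>\<C>\<^sup>m\<close> norm enters: \<open>s\<close> and its first partial derivatives have small Lipschitz
constants on the ball.\<close>

lemma Cspace_small:
  fixes s :: "'a::euclidean_space \<Rightarrow> 'b::real_normed_vector"
  assumes s: "s \<in> Cspace m" "2 \<le> m" "Cnorm m s \<le> \<delta>" and x: "x \<in> ball 0 1"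
  shows "s differentiable at x"
    and "b \<in> Basis \<Longrightarrow> norm (frechet_derivative s (at x) b) \<le> \<delta>"
    and "y \<in> ball 0 1 \<Longrightarrow> norm (s x - s y) \<le> real DIM('a) * \<delta> * norm (x - y)"
    and "y \<in> ball 0 1 \<Longrightarrow> b \<in> Basis \<Longrightarrow>
      norm (frechet_derivative s (at x) b - frechet_derivative s (at y) b) \<le> real DIM('a) * \<delta> * norm (x - y)"
proof -
  have d: "s differentiable at x" if "x \<in> ball 0 1" for x
    using Cspace_differentiable_at[OF s(1), of "[]" x] s(2) that by simp
  have le: "norm (frechet_derivative s (at x) b) \<le> \<delta>" if "x \<in> ball 0 1" "b \<in> Basis" for x b
    using norm_iter_deriv_le_Cnorm[OF s(1), of "[b]" x] s that by simp
  have d2: "(\<lambda>x. frechet_derivative s (at x) b) differentiable at x" if "x \<in> ball 0 1" "b \<in> Basis" for x b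
    using Cspace_differentiable_at[OF s(1), of "[b]" x] s(2) that by simp
  have le2: "norm (frechet_derivative (\<lambda>x. frechet_derivative s (at x) b) (at x) b') \<le> \<delta>"
    if "x \<in> ball 0 1" "b \<in> Basis" "b' \<in> Basis" for x b b'
    using norm_iter_deriv_le_Cnorm[OF s(1), of "[b', b]" x] s that by simp
  show "s differentiable at x" by (rule d[OF x])
  show "b \<in> Basis \<Longrightarrow> norm (frechet_derivative s (at x) b) \<le> \<delta>" by (rule le[OF x])
  show "y \<in> ball 0 1 \<Longrightarrow> norm (s x - s y) \<le> real DIM('a) * \<delta> * norm (x - y)"
    by (rule lipschitz_if_partial_derivatives_bounded[OF d le x])
  show "y \<in> ball 0 1 \<Longrightarrow> b \<in> Basis \<Longrightarrow>
      norm (frechet_derivative s (at x) b - frechet_derivative s (at y) b) \<le> real DIM('a) * \<delta> * norm (x - y)"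
    by (rule lipschitz_if_partial_derivatives_bounded[OF d2 le2 x])
qed

text \<open>Maps \<open>b x x + l x + k\<close> have partial derivatives of the same form (with \<open>b = 0\<close>), so that all iterated
derivatives are of this form, and such maps are smooth and bounded on the ball.\<close>

lemma quadratic_map_in_Cspace:
  fixes b :: "'a::euclidean_space \<Rightarrow> 'a \<Rightarrow> 'b::euclidean_space"
  assumes "bounded_bilinear b" "bounded_linear l"
  shows "(\<lambda>x. b x x + l x + k) \<in> Cspace m"
proof -
  have deriv: "((\<lambda>x. b x x + l x + k) has_derivative (\<lambda>h. b x h + b h x + l h)) (at x)"
    if "bounded_bilinear b" "bounded_linear l" for b :: "'a \<Rightarrow> 'a \<Rightarrow> 'b" and l k x
    using bounded_bilinear.FDERIV[OF that(1) has_derivative_ident has_derivative_ident]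
    by (auto intro!: derivative_eq_intros bounded_linear_imp_has_derivative that(2))
  have q: "\<exists>b' l' k'. bounded_bilinear b' \<and> bounded_linear l' \<and> iter_deriv bs (\<lambda>x. b x x + l x + k) = (\<lambda>x. b' x x + l' x + k')"
    for bs :: "'a list"
  proof (induction bs)
    case Nil
    then show ?case using assms by auto
  next
    case (Cons e bs)
    then obtain b' l' k' where *: "bounded_bilinear b'" "bounded_linear l'"
      "iter_deriv bs (\<lambda>x. b x x + l x + k) = (\<lambda>x. b' x x + l' x + k')" by blast
    have "iter_deriv (e # bs) (\<lambda>x. b x x + l x + k) = (\<lambda>x. 0 + (b' x e + b' e x) + l' e)"
      unfolding iter_deriv.simps * frechet_derivative_at[OF deriv[OF *(1,2)], symmetric] by simp
    moreover have "bounded_linear (\<lambda>x. b' x e + b' e x)"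
      by (intro bounded_linear_add bounded_bilinear.bounded_linear_left bounded_bilinear.bounded_linear_right *)
    moreover have "bounded_bilinear ((\<lambda>_ _. 0) :: 'a \<Rightarrow> 'a \<Rightarrow> 'b)" 
      unfolding bilinear_conv_bounded_bilinear[symmetric] bilinear_def by (auto intro!: linearI)
    ultimately show ?case by (intro exI[of _ "\<lambda>_ _. 0"] exI[of _ "\<lambda>x. b' x e + b' e x"] exI[of _ "l' e"]) simp
  qed
  show ?thesis
    unfolding Cspace_def mem_Collect_eq
  proof (intro ballI)
    fix bs :: "'a list"
    let ?f = "iter_deriv bs (\<lambda>x. b x x + l x + k)"
    obtain b' l' k' where *: "bounded_bilinear b'" "bounded_linear l'" "?f = (\<lambda>x. b' x x + l' x + k')" using q by blast
    have diff: "?f differentiable at x within S" for x S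
      unfolding * using deriv[OF *(1,2)] has_derivative_at_withinI unfolding differentiable_def by blast
    then have c: "continuous_on S ?f" for S
      using differentiable_imp_continuous_on[of ?f S] by (simp add: differentiable_on_def)
    have "bounded (?f ` cball 0 1)"
      by (intro compact_imp_bounded compact_continuous_image c compact_cball)
    then have "bounded (?f ` ball 0 1)"
      by (rule bounded_subset) auto
    then show "continuous_on (ball 0 1) ?f \<and> bounded (?f ` ball 0 1) \<and> (length bs < m \<longrightarrow> ?f differentiable_on ball 0 1)"
      using c diff by (simp add: differentiable_on_def)
  qed
qed

lemma quadric_in_Cspace: "quadric A \<in> Cspace m"
proof -
  let ?b = "\<lambda>(p :: ('a, 'b) cspace) (p' :: ('a, 'b) cspace). (\<chi> j. - Re (\<Sum>k\<in>UNIV. cnj (fst p $ k) * (A j *v fst p') $ k)) :: real ^ 'b"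
  let ?l = "\<lambda>p :: ('a, 'b) cspace. (\<chi> j. Re (snd p $ j)) :: real ^ 'b"
  have sc: "(A j *v (r *\<^sub>R x)) $ k = r *\<^sub>R (A j *v x) $ k" for j r x k
    by (simp add: matrix_vector_mult_def scaleR_sum_right)
  have "bilinear ?b"
    unfolding bilinear_def
    by (auto intro!: linearI simp: vec_eq_iff matrix_vector_right_distrib distrib_left distrib_right sum.distrib
        sc scaleR_sum_right[symmetric] simp del: Re_sum)
  moreover have "linear ?l"
    by (auto intro!: linearI simp: vec_eq_iff)
  moreover have "quadric A = (\<lambda>p. ?b p p + ?l p + 0)"
    by (simp add: quadric_def herm_form_def fun_eq_iff vec_eq_iff)
  ultimately show ?thesis
    using quadratic_map_in_Cspace[of ?b ?l 0 m] by (simp only: bilinear_conv_bounded_bilinear linear_conv_bounded_linear)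
qed

section \<open>Linearisation of the boundary conditions\<close>

lemma hermitian_adjoint:
  assumes "hermitian M"
  shows "(\<Sum>k\<in>UNIV. cnj ((M *v x) $ k) * y $ k) = (\<Sum>k\<in>UNIV. cnj (x $ k) * (M *v y) $ k)"
proof -
  have h: "cnj (M $ k $ l) = M $ l $ k" for k l using herm_swap[OF assms, of l k] by simp
  have "(\<Sum>k\<in>UNIV. cnj ((M *v x) $ k) * y $ k) = (\<Sum>k\<in>UNIV. \<Sum>l\<in>UNIV. cnj (M $ k $ l) * cnj (x $ l) * y $ k)"
    by (simp add: matrix_vector_mult_def sum_distrib_right)
  also have "\<dots> = (\<Sum>l\<in>UNIV. \<Sum>k\<in>UNIV. cnj (M $ k $ l) * cnj (x $ l) * y $ k)"
    by (rule sum.swap)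
  also have "\<dots> = (\<Sum>l\<in>UNIV. \<Sum>k\<in>UNIV. cnj (x $ l) * (M $ l $ k * y $ k))"
    by (intro sum.cong refl) (simp add: h mult_ac)
  finally show ?thesis by (simp add: matrix_vector_mult_def sum_distrib_left)
qed

text \<open>The polarised form \<open>x\<^sup>* M x - y\<^sup>* M y = (x + y)\<^sup>* M (x - y)\<close>, up to the imaginary terms
\<open>x\<^sup>* M y - y\<^sup>* M x\<close>.\<close>

lemma Re_herm_form_diff:
  assumes "hermitian M"
  shows "Re (herm_form M x) - Re (herm_form M y) = Re (\<Sum>k\<in>UNIV. cnj ((M *v (x + y)) $ k) * (x - y) $ k)"
proof -
  let ?i = "\<lambda>x y. \<Sum>k\<in>UNIV. cnj ((M *v x) $ k) * y $ k"
  have i: "?i (x + y) (x - y) = ?i x x - ?i x y + ?i y x - ?i y y"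
    by (simp add: matrix_vector_right_distrib algebra_simps sum.distrib sum_subtractf)
  have "?i y x = cnj (?i x y)"
    unfolding hermitian_adjoint[OF assms, of y x] by (simp add: mult.commute)
  moreover have "?i v v = herm_form M v" for v
    unfolding hermitian_adjoint[OF assms, of v v] by (simp add: herm_form_def)
  ultimately show ?thesis unfolding i by simp
qed

lemma sum_norm_mult_le:
  fixes f g :: "'a::finite \<Rightarrow> 'b::real_normed_algebra"
  assumes "\<And>i. norm (g i) \<le> b" "(\<Sum>i\<in>UNIV. norm (f i)) \<le> s" "0 \<le> b"
  shows "norm (\<Sum>i\<in>UNIV. f i * g i) \<le> s * b"
proof -
  have "norm (\<Sum>i\<in>UNIV. f i * g i) \<le> (\<Sum>i\<in>UNIV. norm (f i) * b)"
    by (intro sum_norm_le order_trans[OF norm_mult_ineq] mult_left_mono assms) simp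
  also have "\<dots> = (\<Sum>i\<in>UNIV. norm (f i)) * b" by (simp add: sum_distrib_right)
  also have "\<dots> \<le> s * b" using assms by (intro mult_right_mono) auto
  finally show ?thesis .
qed

text \<open>The boundary conditions linearised along the initial disc, for the difference \<open>u = (z, w, p, q)\<close> of two discs
and up to an error \<open>\<eta> \<bar>u\<bar>\<close>. For the quadric the conormal condition reads \<open>q = \<zeta> \<lambda> / 2\<close>,
\<open>p = - \<zeta> \<Sum>\<^sub>j \<lambda>\<^sub>j cnj (A\<^sub>j z)\<close> with real \<open>\<lambda>\<close>. Substituting \<open>2 cnj \<zeta> q\<close> for the variation of \<open>\<lambda>\<close>, and using
\<open>\<lambda> = c\<close> and first component \<open>(1 - \<zeta>) V\<close> along the initial disc, gives the first two lines. The third is the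
derivative of the defining functions.\<close>

definition boundary_system ::
  "('d::finite \<Rightarrow> complex ^ 'n::finite ^ 'n) \<Rightarrow> real ^ 'd \<Rightarrow> complex ^ 'n \<Rightarrow> real \<Rightarrow> complex \<Rightarrow>
    complex ^ 'n \<Rightarrow> complex ^ 'd \<Rightarrow> complex ^ 'n \<Rightarrow> complex ^ 'd \<Rightarrow> bool" where
  "boundary_system A c V \<eta> \<zeta> z w p q \<longleftrightarrow>
    (\<forall>l. \<bar>Im (cnj \<zeta> * q $ l)\<bar> \<le> \<eta> * norm ((z, w), (p, q))) \<and>
    (\<forall>k. norm (p $ k + 2 * (1 - cnj \<zeta>) * (\<Sum>j\<in>UNIV. q $ j * cnj ((A j *v V) $ k))
        + \<zeta> * cnj ((pencil A c *v z) $ k)) \<le> \<eta> * norm ((z, w), (p, q))) \<and>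
    (\<forall>l. \<bar>Re (w $ l) - 2 * Re (cnj (1 - \<zeta>) * (\<Sum>k\<in>UNIV. cnj ((A l *v V) $ k) * z $ k))\<bar>
        \<le> \<eta> * norm ((z, w), (p, q)))"

text \<open>All statements concern one boundary point \<open>\<zeta>\<close>. The \<open>l1\<close>, \<open>l2\<close> are the conormal multipliers of the two
discs, the \<open>e1\<close>, \<open>e2\<close> the contributions of the perturbation \<open>r - \<rho>\<close> to the conormal vectors and the \<open>s1\<close>,
\<open>s2\<close> its values; \<open>\<tau>\<close> measures both the perturbation and the distance to the initial disc.
The multipliers are determined by \<open>q1\<close>, \<open>q2\<close> up to a small error, so they are bounded, close to \<open>c\<close>, and their
difference \<open>\<mu>\<close> is controlled by \<open>N\<close>. Since \<open>\<mu>\<close> is real, \<open>cnj \<zeta> (q1 - q2)\<close> is almost real. Eliminating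
\<open>\<mu>\<close> from \<open>p1 - p2\<close> gives the second estimate, and the defining equation gives the third.\<close>

lemma boundary_linearization:
  fixes A :: "'d::finite \<Rightarrow> complex ^ 'n::finite ^ 'n" and c :: "real ^ 'd" and V :: "complex ^ 'n"
    and K \<tau> :: real and \<zeta> :: complex
    and z1 z2 p1 p2 :: "complex ^ 'n" and w1 w2 q1 q2 :: "complex ^ 'd" and l1 l2 :: "'d \<Rightarrow> real"
    and e1 e2 :: "'d \<Rightarrow> ('n, 'd) cspace" and s1 s2 :: "real ^ 'd"
  defines "N \<equiv> norm ((z1 - z2, w1 - w2), (p1 - p2, q1 - q2))"
  assumes herm: "\<And>j. hermitian (A j)"
    and K: "1 \<le> K" "real CARD('n) \<le> K" "real CARD('d) \<le> K" "norm V \<le> K" "\<And>l. \<bar>c $ l\<bar> \<le> K"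
      "\<And>j k x. norm ((A j *v x) $ k) \<le> K * norm x"
    and \<tau>: "0 \<le> \<tau>" "4 * K * \<tau> \<le> 1" and \<zeta>: "norm \<zeta> = 1"
    and close: "norm (z1 - (1 - \<zeta>) *s V) \<le> \<tau>" "norm (z2 - (1 - \<zeta>) *s V) \<le> \<tau>"
      "\<And>l. norm (q1 $ l - \<zeta> / 2 * of_real (c $ l)) \<le> \<tau>" "\<And>l. norm (q2 $ l - \<zeta> / 2 * of_real (c $ l)) \<le> \<tau>"
    and q: "\<And>l. q1 $ l = \<zeta> * (of_real (l1 l) / 2 + (\<Sum>j\<in>UNIV. of_real (l1 j) * snd (e1 j) $ l))"
      "\<And>l. q2 $ l = \<zeta> * (of_real (l2 l) / 2 + (\<Sum>j\<in>UNIV. of_real (l2 j) * snd (e2 j) $ l))"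
    and p: "\<And>k. p1 $ k = \<zeta> * (\<Sum>j\<in>UNIV. of_real (l1 j) * (fst (e1 j) $ k - cnj ((A j *v z1) $ k)))"
      "\<And>k. p2 $ k = \<zeta> * (\<Sum>j\<in>UNIV. of_real (l2 j) * (fst (e2 j) $ k - cnj ((A j *v z2) $ k)))"
    and w: "\<And>l. Re (w1 $ l) - Re (herm_form (A l) z1) + s1 $ l = 0"
      "\<And>l. Re (w2 $ l) - Re (herm_form (A l) z2) + s2 $ l = 0"
    and e: "\<And>j l. norm (snd (e1 j) $ l) \<le> \<tau>" "\<And>j l. norm (snd (e2 j) $ l) \<le> \<tau>" "\<And>j k. norm (fst (e1 j) $ k) \<le> \<tau>"
      "\<And>j l. norm (snd (e1 j) $ l - snd (e2 j) $ l) \<le> \<tau> * N" "\<And>j k. norm (fst (e1 j) $ k - fst (e2 j) $ k) \<le> \<tau> * N"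
    and s: "\<And>l. \<bar>s1 $ l - s2 $ l\<bar> \<le> \<tau> * N"
  shows "boundary_system A c V (78 * K ^ 5 * \<tau>) \<zeta> (z1 - z2) (w1 - w2) (p1 - p2) (q1 - q2)"
proof -
  have zz: "cnj \<zeta> * \<zeta> = 1" "\<zeta> * cnj \<zeta> = 1" using \<zeta> by (simp_all add: complex_norm_square[symmetric] mult.commute)
  have N: "0 \<le> N" by (simp add: N_def)
  note K0 = order_trans[OF zero_le_one K(1)]
  have nz: "norm (z1 - z2) \<le> N" and nq: "norm ((q1 - q2) $ l) \<le> N" for l
    using norm_fst_le[of "(z1 - z2, w1 - w2)" "(p1 - p2, q1 - q2)"] norm_fst_le[of "z1 - z2" "w1 - w2"]
      norm_snd_le[of "(p1 - p2, q1 - q2)" "(z1 - z2, w1 - w2)"] norm_snd_le[of "q1 - q2" "p1 - p2"]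
      Finite_Cartesian_Product.norm_nth_le[of "q1 - q2" l]
    unfolding N_def by linarith+
  have \<tau>N: "0 \<le> \<tau> * N" using \<tau> N by simp
  have Kp: "K ^ m * (\<tau> * N) \<le> K ^ n * (\<tau> * N)" if "m \<le> n" for m n
    using power_increasing[OF that K(1)] \<tau>N by (rule mult_right_mono)
  have d\<tau>: "real CARD('d) * (2 * \<tau>) \<le> 1 / 2"
    using mult_right_mono[OF K(3) \<tau>(1)] \<tau>(2) by simp
  \<comment> \<open>Absorbs the terms on the right that contain the quantity being estimated.\<close>
  have half: "x \<le> 2 * y" if "x \<le> y + real CARD('d) * (2 * \<tau>) * x" "0 \<le> x" for x y
    using that mult_right_mono[OF d\<tau> that(2)] by linarith
  have unit: "norm (\<zeta> * x) = norm x" "norm (cnj \<zeta> * x) = norm x" for x using \<zeta> by (simp_all add: norm_mult)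

  \<comment> \<open>The equation for \<open>q\<close> determines the multipliers up to an error proportional to their size.\<close>
  have multiplier_bound: "(\<Sum>j\<in>UNIV. \<bar>l j\<bar>) \<le> 4 * K\<^sup>2 \<and> (\<forall>i. \<bar>l i - c $ i\<bar> \<le> 10 * K\<^sup>2 * \<tau>)"
    if close: "\<And>l. norm (q $ l - \<zeta> / 2 * of_real (c $ l)) \<le> \<tau>"
      and q: "\<And>i. q $ i = \<zeta> * (of_real (l i) / 2 + (\<Sum>j\<in>UNIV. of_real (l j) * snd (e j) $ i))"
      and e: "\<And>j i. norm (snd (e j) $ i) \<le> \<tau>" for q :: "complex ^ 'd" and l :: "'d \<Rightarrow> real" and e :: "'d \<Rightarrow> ('n, 'd) cspace"
  proof -
    define m where "m = (\<Sum>j\<in>UNIV. \<bar>l j\<bar>)"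
    have m: "0 \<le> m" by (simp add: m_def sum_nonneg)
    have diff: "\<bar>l i - c $ i\<bar> \<le> 2 * \<tau> + 2 * \<tau> * m" for i
    proof -
      let ?S = "\<Sum>j\<in>UNIV. of_real (l j) * snd (e j) $ i"
      have S: "norm ?S \<le> m * \<tau>"
        by (rule sum_norm_mult_le) (use e \<tau> in \<open>auto simp: m_def\<close>)
      have "q $ i - \<zeta> / 2 * of_real (c $ i) = \<zeta> * (of_real (l i - c $ i) / 2 + ?S)"
        by (simp add: q field_simps)
      then have a: "norm (of_real (l i - c $ i) / 2 + ?S) \<le> \<tau>" using close[of i] by (simp add: unit)
      have b: "norm (complex_of_real (l i - c $ i) / 2) \<le> norm (of_real (l i - c $ i) / 2 + ?S) + norm ?S"
        using norm_triangle_ineq4[of "of_real (l i - c $ i) / 2 + ?S" ?S] by simp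
      have x: "norm (complex_of_real (l i - c $ i) / 2) = \<bar>l i - c $ i\<bar> / 2"
        by (simp add: norm_divide del: of_real_diff)
      have "x \<le> 2 * t + 2 * t * m" if "r \<le> t" "x / 2 \<le> r + s" "s \<le> m * t" for r s t x :: real
        using that by (simp add: mult.commute)
      from this[OF a b[unfolded x] S] show ?thesis .
    qed
    have "\<bar>l i\<bar> \<le> 2 * K + 2 * \<tau> * m" for i
    proof -
      have "2 * \<tau> \<le> K" using \<tau> K mult_right_mono[OF K(1) \<tau>(1)] by linarith
      then show ?thesis using diff[of i] K(5)[of i] by linarith
    qed
    then have "m \<le> real CARD('d) * (2 * K + 2 * \<tau> * m)"
      unfolding m_def by (intro sum_bounded_above) simp
    also have "\<dots> = real CARD('d) * (2 * K) + real CARD('d) * (2 * \<tau>) * m" by (simp add: algebra_simps)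
    finally have "m \<le> 2 * (real CARD('d) * (2 * K))" by (rule half[OF _ m])
    also have "\<dots> \<le> 2 * (K * (2 * K))" using K by (intro mult_left_mono mult_right_mono) auto
    finally have m4: "m \<le> 4 * K\<^sup>2" by (simp add: power2_eq_square)
    have "2 * \<tau> + 2 * \<tau> * m \<le> 10 * K\<^sup>2 * \<tau>"
    proof -
      have "\<tau> * m \<le> 4 * (K\<^sup>2 * \<tau>)" using mult_left_mono[OF m4 \<tau>(1)] by (simp add: mult_ac)
      moreover have "1 * \<tau> \<le> K\<^sup>2 * \<tau>" using K(1) \<tau> by (intro mult_right_mono) auto
      ultimately show ?thesis by simp
    qed
    then show ?thesis using m4 diff unfolding m_def by (meson order_trans)
  qed
  have m2: "(\<Sum>j\<in>UNIV. norm (complex_of_real (l2 j))) \<le> 4 * K\<^sup>2" and lc: "\<bar>l2 i - c $ i\<bar> \<le> 10 * K\<^sup>2 * \<tau>" for i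
    using multiplier_bound[OF close(4) q(2) e(2)] by auto

  \<comment> \<open>\<open>R\<close> is the deviation of \<open>cnj \<zeta> (q1 - q2)\<close> from the real vector \<open>\<mu> / 2\<close>.\<close>
  define \<mu> where "\<mu> j = l1 j - l2 j" for j
  define M where "M = (\<Sum>j\<in>UNIV. norm (complex_of_real (\<mu> j)))"
  define R where "R i = (\<Sum>j\<in>UNIV. of_real (\<mu> j) * snd (e1 j) $ i) + (\<Sum>j\<in>UNIV. of_real (l2 j) * (snd (e1 j) $ i - snd (e2 j) $ i))" for i
  have M: "0 \<le> M" by (simp add: M_def sum_nonneg)
  have R: "cnj \<zeta> * (q1 - q2) $ i = of_real (\<mu> i) / 2 + R i" for i
  proof -
    have "(q1 - q2) $ i = \<zeta> * (of_real (\<mu> i) / 2 + R i)"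
      by (simp add: q \<mu>_def R_def algebra_simps sum.distrib sum_subtractf diff_divide_distrib)
    then show ?thesis by (simp add: mult.assoc[symmetric] zz)
  qed
  have nR: "norm (R i) \<le> \<tau> * M + 4 * K\<^sup>2 * (\<tau> * N)" for i
  proof -
    have "norm (R i) \<le> M * \<tau> + 4 * K\<^sup>2 * (\<tau> * N)"
      unfolding R_def
      by (rule norm_triangle_mono; rule sum_norm_mult_le) (use e m2 \<tau> N in \<open>auto simp: M_def\<close>)
    then show ?thesis by (simp add: mult.commute)
  qed
  have M8: "M \<le> 8 * K\<^sup>2 * N"
  proof -
    have "norm (complex_of_real (\<mu> i)) \<le> (2 * N + 8 * K\<^sup>2 * (\<tau> * N)) + 2 * \<tau> * M" for i
    proof -
      have "norm (complex_of_real (\<mu> i) / 2) \<le> norm (cnj \<zeta> * (q1 - q2) $ i) + norm (R i)"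
        unfolding R using norm_triangle_ineq4[of "of_real (\<mu> i) / 2 + R i" "R i"] by simp
      then show ?thesis using nR[of i] nq[of i] unfolding unit by (simp add: norm_divide)
    qed
    then have "M \<le> real CARD('d) * ((2 * N + 8 * K\<^sup>2 * (\<tau> * N)) + 2 * \<tau> * M)"
      unfolding M_def[of] by (intro sum_bounded_above) simp
    also have "\<dots> = real CARD('d) * (2 * N + 8 * K\<^sup>2 * (\<tau> * N)) + real CARD('d) * (2 * \<tau>) * M"
      by (simp add: algebra_simps)
    finally have "M \<le> 2 * (real CARD('d) * (2 * N + 8 * K\<^sup>2 * (\<tau> * N)))"
      by (rule half[OF _ M])
    also have "\<dots> \<le> 2 * (K * (2 * N + 8 * K\<^sup>2 * (\<tau> * N)))"
      using K K0 N \<tau>N by (intro mult_left_mono mult_right_mono) auto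
    also have "\<dots> = 4 * (K * N) + 4 * K\<^sup>2 * ((4 * K * \<tau>) * N)"
      by (simp add: algebra_simps power2_eq_square)
    also have "\<dots> \<le> 4 * (K\<^sup>2 * N) + 4 * K\<^sup>2 * (1 * N)"
      using K(1) N \<tau>(2) by (intro add_mono mult_left_mono mult_right_mono) (auto simp: power2_eq_square)
    finally show ?thesis by (simp add: mult_ac)
  qed
  have \<tau>M: "\<tau> * M \<le> 8 * K\<^sup>2 * (\<tau> * N)"
    using mult_left_mono[OF M8 \<tau>(1)] by (simp add: mult_ac)
  have nR: "norm (R i) \<le> 12 * K\<^sup>2 * (\<tau> * N)" for i using nR[of i] \<tau>M by simp

  have est_q: "\<bar>Im (cnj \<zeta> * (q1 - q2) $ l)\<bar> \<le> 78 * K ^ 5 * (\<tau> * N)" for l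
  proof -
    have "\<bar>Im (cnj \<zeta> * (q1 - q2) $ l)\<bar> \<le> norm (R l)" unfolding R using abs_Im_le_cmod[of "R l"] by simp
    then show ?thesis using nR[of l] Kp[of 2 5] Kp[of 0 5] \<tau>N by simp
  qed

  define z0 where "z0 = (1 - \<zeta>) *s V"
  have c1: "norm (1 - \<zeta>) \<le> 2" using \<zeta> norm_triangle_ineq4[of 1 \<zeta>] by simp
  have Az0: "(A j *v z0) $ k = (1 - \<zeta>) * (A j *v V) $ k" for j k
    unfolding z0_def vector_scalar_commute by (rule vector_smult_component)
  have nAz0: "norm ((A j *v z0) $ k) \<le> 2 * K\<^sup>2" for j k
  proof -
    have "norm ((A j *v z0) $ k) \<le> 2 * (K * norm V)"
      unfolding Az0 norm_mult using c1 K(6)[of j V k] by (intro mult_mono) auto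
    also have "\<dots> \<le> 2 * (K * K)" using K K0 by (intro mult_left_mono) auto
    finally show ?thesis by (simp add: power2_eq_square)
  qed
  have est_p: "norm ((p1 - p2) $ k + 2 * (1 - cnj \<zeta>) * (\<Sum>j\<in>UNIV. (q1 - q2) $ j * cnj ((A j *v V) $ k))
      + \<zeta> * cnj ((pencil A c *v (z1 - z2)) $ k)) \<le> 78 * K ^ 5 * (\<tau> * N)" (is "norm ?T \<le> _") for k
  proof -
    \<comment> \<open>The four errors come from replacing \<open>z1\<close> by \<open>(1 - \<zeta>) V\<close> and dropping the perturbation, from the variation
      of the perturbation, from replacing \<open>l2\<close> by \<open>c\<close>, and from replacing \<open>\<mu>\<close> by \<open>2 cnj \<zeta> (q1 - q2)\<close>.\<close>
    let ?a = "\<Sum>j\<in>UNIV. of_real (\<mu> j) * (fst (e1 j) $ k - cnj ((A j *v (z1 - z0)) $ k))"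
    let ?b = "\<Sum>j\<in>UNIV. of_real (l2 j) * (fst (e1 j) $ k - fst (e2 j) $ k)"
    let ?c = "\<Sum>j\<in>UNIV. of_real (c $ j - l2 j) * cnj ((A j *v (z1 - z2)) $ k)"
    let ?d = "\<Sum>j\<in>UNIV. 2 * R j * cnj ((A j *v z0) $ k)"
    have "2 * (1 - cnj \<zeta>) * (\<Sum>j\<in>UNIV. (q1 - q2) $ j * cnj ((A j *v V) $ k))
        = \<zeta> * (\<Sum>j\<in>UNIV. 2 * (cnj \<zeta> * (q1 - q2) $ j) * cnj ((A j *v z0) $ k))"
    proof -
      have "2 * (1 - cnj \<zeta>) * (y * x) = \<zeta> * (2 * (cnj \<zeta> * y) * (cnj (1 - \<zeta>) * x))" for x y
        using zz by (simp add: mult_ac)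
      then show ?thesis unfolding Az0 complex_cnj_mult sum_distrib_left by (intro sum.cong refl)
    qed
    also have "\<dots> = \<zeta> * ((\<Sum>j\<in>UNIV. of_real (\<mu> j) * cnj ((A j *v z0) $ k)) + ?d)"
      unfolding R by (simp add: distrib_left distrib_right sum.distrib)
    finally have "?T = \<zeta> * (?a + ?b + ?c + ?d)"
      by (simp only:) (simp add: p \<mu>_def pencil_mv algebra_simps sum.distrib sum_subtractf sum_distrib_left)
    then have "norm ?T = norm (?a + ?b + ?c + ?d)" by (simp add: unit)
    moreover have "norm ?a \<le> M * (\<tau> + K * \<tau>)"
    proof (rule sum_norm_mult_le)
      show "norm (fst (e1 j) $ k - cnj ((A j *v (z1 - z0)) $ k)) \<le> \<tau> + K * \<tau>" for j
      proof -
        have "norm ((A j *v (z1 - z0)) $ k) \<le> K * \<tau>"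
          using K(6)[of j "z1 - z0" k] mult_left_mono[OF close(1) K0] unfolding z0_def by linarith
        then show ?thesis using norm_triangle_ineq4[of "fst (e1 j) $ k" "cnj ((A j *v (z1 - z0)) $ k)"] e(3)[of j k] by simp
      qed
    qed (use \<tau> K0 in \<open>auto simp: M_def\<close>)
    moreover have "M * (\<tau> + K * \<tau>) \<le> 16 * K ^ 5 * (\<tau> * N)"
    proof -
      have "M * (\<tau> + K * \<tau>) = \<tau> * M + K * (\<tau> * M)" by (simp add: algebra_simps)
      also have "\<dots> \<le> 8 * K\<^sup>2 * (\<tau> * N) + K * (8 * K\<^sup>2 * (\<tau> * N))"
        by (intro add_mono \<tau>M mult_left_mono K0)
      also have "\<dots> = 8 * (K\<^sup>2 * (\<tau> * N)) + 8 * (K ^ 3 * (\<tau> * N))"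
        by (simp add: eval_nat_numeral)
      finally show ?thesis using Kp[of 2 5] Kp[of 3 5] by simp
    qed
    moreover have "norm ?b \<le> 4 * K\<^sup>2 * (\<tau> * N)"
      by (rule sum_norm_mult_le) (use e m2 \<tau>N in auto)
    moreover have "norm ?c \<le> K * (10 * K\<^sup>2 * \<tau>) * (K * N)"
    proof (rule sum_norm_mult_le)
      show "norm (cnj ((A j *v (z1 - z2)) $ k)) \<le> K * N" for j
        using K(6)[of j "z1 - z2" k] mult_left_mono[OF nz K0] by simp
      have "(\<Sum>i\<in>UNIV. norm (complex_of_real (c $ i - l2 i))) \<le> real CARD('d) * (10 * K\<^sup>2 * \<tau>)"
        by (rule sum_bounded_above) (use lc in \<open>simp add: abs_minus_commute del: of_real_diff\<close>)
      also have "\<dots> \<le> K * (10 * K\<^sup>2 * \<tau>)" using K \<tau> by (intro mult_right_mono) auto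
      finally show "(\<Sum>i\<in>UNIV. norm (complex_of_real (c $ i - l2 i))) \<le> K * (10 * K\<^sup>2 * \<tau>)" .
    qed (use N K0 in auto)
    moreover have "norm ?d \<le> K * (24 * K\<^sup>2 * (\<tau> * N)) * (2 * K\<^sup>2)"
    proof (rule sum_norm_mult_le)
      have "(\<Sum>i\<in>UNIV. norm (2 * R i)) \<le> real CARD('d) * (24 * K\<^sup>2 * (\<tau> * N))"
        by (rule sum_bounded_above) (use nR in \<open>simp add: norm_mult mult_ac\<close>)
      also have "\<dots> \<le> K * (24 * K\<^sup>2 * (\<tau> * N))" using K \<tau>N by (intro mult_right_mono) auto
      finally show "(\<Sum>i\<in>UNIV. norm (2 * R i)) \<le> K * (24 * K\<^sup>2 * (\<tau> * N))" .
    qed (use nAz0 in auto)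
    moreover have "norm (?a + ?b + ?c + ?d) \<le> norm ?a + norm ?b + norm ?c + norm ?d"
      using norm_triangle_ineq[of "?a + ?b + ?c" ?d] norm_triangle_ineq[of "?a + ?b" ?c] norm_triangle_ineq[of ?a ?b] by linarith
    moreover have "K * (10 * K\<^sup>2 * \<tau>) * (K * N) = 10 * (K ^ 4 * (\<tau> * N))"
      "K * (24 * K\<^sup>2 * (\<tau> * N)) * (2 * K\<^sup>2) = 48 * (K ^ 5 * (\<tau> * N))"
      by (simp_all add: eval_nat_numeral mult_ac)
    moreover note Kp[of 4 5] Kp[of 2 5]
    ultimately show ?thesis by simp
  qed

  have est_w: "\<bar>Re ((w1 - w2) $ l) - 2 * Re (cnj (1 - \<zeta>) * (\<Sum>k\<in>UNIV. cnj ((A l *v V) $ k) * (z1 - z2) $ k))\<bar>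
      \<le> 78 * K ^ 5 * (\<tau> * N)" (is "\<bar>?T\<bar> \<le> _") for l
  proof -
    let ?S = "\<Sum>k\<in>UNIV. cnj ((A l *v (z1 - z0 + (z2 - z0))) $ k) * (z1 - z2) $ k"
    have "cnj (1 - \<zeta>) * (\<Sum>k\<in>UNIV. cnj ((A l *v V) $ k) * (z1 - z2) $ k) = (\<Sum>k\<in>UNIV. cnj ((A l *v z0) $ k) * (z1 - z2) $ k)"
      unfolding Az0 complex_cnj_mult by (simp add: sum_distrib_left mult.assoc)
    moreover have "(A l *v (z1 - z0 + (z2 - z0))) $ k = (A l *v (z1 + z2)) $ k - 2 * (A l *v z0) $ k" for k
      unfolding matrix_vector_right_distrib matrix_vector_mult_diff_distrib by simp
    then have "?S = (\<Sum>k\<in>UNIV. cnj ((A l *v (z1 + z2)) $ k) * (z1 - z2) $ k) - 2 * (\<Sum>k\<in>UNIV. cnj ((A l *v z0) $ k) * (z1 - z2) $ k)"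
      by (simp add: left_diff_distrib sum_subtractf sum_distrib_left mult.assoc)
    ultimately have "?T = Re ?S - (s1 $ l - s2 $ l)"
      using w(1)[of l] w(2)[of l] Re_herm_form_diff[OF herm[of l], of z1 z2] by simp
    then have "\<bar>?T\<bar> \<le> norm ?S + \<bar>s1 $ l - s2 $ l\<bar>"
      using abs_Re_le_cmod[of ?S] by linarith
    moreover have "norm ?S \<le> K * (K * (2 * \<tau>)) * N"
    proof (rule sum_norm_mult_le)
      have "norm (z1 - z0 + (z2 - z0)) \<le> 2 * \<tau>"
        using norm_triangle_ineq[of "z1 - z0" "z2 - z0"] close(1,2) unfolding z0_def by linarith
      then have "norm (cnj ((A l *v (z1 - z0 + (z2 - z0))) $ k)) \<le> K * (2 * \<tau>)" for k
        using K(6)[of l "z1 - z0 + (z2 - z0)" k] mult_left_mono[of _ "2 * \<tau>" K] K0 by (metis complex_mod_cnj order_trans)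
      then have "(\<Sum>k\<in>UNIV. norm (cnj ((A l *v (z1 - z0 + (z2 - z0))) $ k))) \<le> real CARD('n) * (K * (2 * \<tau>))"
        by (intro sum_bounded_above)
      also have "\<dots> \<le> K * (K * (2 * \<tau>))" using K K0 \<tau> by (intro mult_right_mono) auto
      finally show "(\<Sum>k\<in>UNIV. norm (cnj ((A l *v (z1 - z0 + (z2 - z0))) $ k))) \<le> K * (K * (2 * \<tau>))" .
      show "norm ((z1 - z2) $ k) \<le> N" for k
        using Finite_Cartesian_Product.norm_nth_le[of "z1 - z2" k] nz by linarith
    qed (rule N)
    moreover have "K * (K * (2 * \<tau>)) * N = 2 * (K\<^sup>2 * (\<tau> * N))" by (simp add: power2_eq_square mult_ac)
    ultimately show ?thesis using s[of l] Kp[of 2 5] Kp[of 0 5] \<tau>N by simp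
  qed

  show ?thesis
    unfolding boundary_system_def N_def[symmetric] mult.assoc[of "78 * K ^ 5"] using est_q est_p est_w by blast
qed

section \<open>Functions of class \<open>\<C>\<^bsup>1,\<alpha>\<^esup>\<close> on the circle\<close>

text \<open>Compares distances on the circle with differences of the parameter: with \<open>\<bar>sin x - x\<bar> \<le> \<bar>x\<bar>\<^sup>3 / 6\<close> and
\<open>\<bar>x\<bar> \<le> \<pi> / 2 < 2\<close> one has \<open>\<bar>sin x\<bar> \<ge> \<bar>x\<bar> / 3\<close>.\<close>

lemma chord_ge_angle:
  assumes "\<bar>s\<bar> \<le> pi"
  shows "\<bar>s\<bar> \<le> 3 * norm (cis s - 1)"
proof -
  have *: "(\<Sum>m<3. sin_coeff m * (s / 2) ^ m) = s / 2" "inverse (fact 3) = (1 / 6 :: real)"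
    by (simp_all add: eval_nat_numeral sin_coeff_def)
  have "\<bar>sin (s / 2) - s / 2\<bar> \<le> 1 / 6 * \<bar>s / 2\<bar> ^ 3"
    using Maclaurin_sin_bound[of "s / 2" 3] unfolding * .
  moreover have "\<bar>s / 2\<bar> ^ 3 \<le> 4 * \<bar>s / 2\<bar>"
  proof -
    have "\<bar>s / 2\<bar> \<le> 2" using assms pi_less_4 by simp
    then have "\<bar>s / 2\<bar> * (\<bar>s / 2\<bar> * \<bar>s / 2\<bar>) \<le> \<bar>s / 2\<bar> * (2 * 2)"
      by (intro mult_left_mono mult_mono) auto
    then show ?thesis by (simp add: eval_nat_numeral)
  qed
  ultimately have "\<bar>s / 2\<bar> \<le> 3 * \<bar>sin (s / 2)\<bar>" by linarith
  moreover have "norm (cis s - 1) = 2 * \<bar>sin (s / 2)\<bar>"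
    unfolding cis_conv_exp by (rule dist_exp_i_1)
  ultimately show ?thesis by simp
qed

lemma circle_deriv_works:
  "(\<lambda>t. v (cis t)) differentiable (at \<theta>) \<longleftrightarrow> ((\<lambda>t. v (cis t)) has_vector_derivative circle_deriv v \<theta>) (at \<theta>)"
  unfolding circle_deriv_def by (rule vector_derivative_works)

lemma C1_holder_iff:
  "C1_holder \<alpha> v \<longleftrightarrow> (\<exists>D K. (\<forall>\<theta>. ((\<lambda>t. v (cis t)) has_vector_derivative D \<theta>) (at \<theta>)) \<and>
     (\<forall>\<theta> \<phi>. norm (D \<theta> - D \<phi>) \<le> K * norm (cis \<theta> - cis \<phi>) powr \<alpha>))"
proof
  assume "C1_holder \<alpha> v"
  then show "\<exists>D K. (\<forall>\<theta>. ((\<lambda>t. v (cis t)) has_vector_derivative D \<theta>) (at \<theta>)) \<and>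
     (\<forall>\<theta> \<phi>. norm (D \<theta> - D \<phi>) \<le> K * norm (cis \<theta> - cis \<phi>) powr \<alpha>)"
    unfolding C1_holder_def circle_deriv_works dist_norm by blast
next
  assume "\<exists>D K. (\<forall>\<theta>. ((\<lambda>t. v (cis t)) has_vector_derivative D \<theta>) (at \<theta>)) \<and>
     (\<forall>\<theta> \<phi>. norm (D \<theta> - D \<phi>) \<le> K * norm (cis \<theta> - cis \<phi>) powr \<alpha>)"
  then obtain D K where D: "\<And>\<theta>. ((\<lambda>t. v (cis t)) has_vector_derivative D \<theta>) (at \<theta>)"
    and K: "\<And>\<theta> \<phi>. norm (D \<theta> - D \<phi>) \<le> K * norm (cis \<theta> - cis \<phi>) powr \<alpha>" by blast
  have "circle_deriv v \<theta> = D \<theta>" for \<theta>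
    unfolding circle_deriv_def by (rule vector_derivative_at[OF D])
  then show "C1_holder \<alpha> v"
    unfolding C1_holder_def dist_norm circle_deriv_works using D K by auto
qed

lemma C1_holderI:
  assumes "\<And>\<theta>. ((\<lambda>t. v (cis t)) has_vector_derivative D \<theta>) (at \<theta>)"
    and "\<And>\<theta> \<phi>. norm (D \<theta> - D \<phi>) \<le> K * norm (cis \<theta> - cis \<phi>) powr \<alpha>"
  shows "C1_holder \<alpha> v"
  unfolding C1_holder_iff using assms by (intro exI[of _ D] exI[of _ K]) simp

text \<open>The derivative is bounded because it is Hoelder continuous on a bounded set, and therefore \<open>v\<close> is Lipschitz
continuous in the angle, hence also for the distance on the circle.\<close>

lemma C1_holder_bounds:
  assumes v: "C1_holder \<alpha> v" and "0 < \<alpha>"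
  obtains M L K where "\<And>\<zeta>. \<zeta> \<in> sphere 0 1 \<Longrightarrow> norm (v \<zeta>) \<le> M" "\<And>\<theta>. norm (circle_deriv v \<theta>) \<le> M"
    "\<And>\<zeta> \<xi>. \<zeta> \<in> sphere 0 1 \<Longrightarrow> \<xi> \<in> sphere 0 1 \<Longrightarrow> norm (v \<zeta> - v \<xi>) \<le> L * norm (\<zeta> - \<xi>)"
    "\<And>\<theta> \<phi>. norm (circle_deriv v \<theta> - circle_deriv v \<phi>) \<le> K * norm (cis \<theta> - cis \<phi>) powr \<alpha>"
    "0 \<le> M" "0 \<le> L" "0 \<le> K"
proof -
  have D: "((\<lambda>t. v (cis t)) has_vector_derivative circle_deriv v \<theta>) (at \<theta>)" for \<theta>
    using v by (simp add: C1_holder_def circle_deriv_works)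
  obtain K' where K': "\<And>\<theta> \<phi>. norm (circle_deriv v \<theta> - circle_deriv v \<phi>) \<le> K' * norm (cis \<theta> - cis \<phi>) powr \<alpha>"
    using v by (auto simp: C1_holder_def dist_norm)
  define K where "K = \<bar>K'\<bar>"
  have K: "norm (circle_deriv v \<theta> - circle_deriv v \<phi>) \<le> K * norm (cis \<theta> - cis \<phi>) powr \<alpha>" for \<theta> \<phi>
    using K'[of \<theta> \<phi>] mult_right_mono[OF abs_ge_self, of "norm (cis \<theta> - cis \<phi>) powr \<alpha>" K'] unfolding K_def by simp
  define B where "B = norm (circle_deriv v 0) + K * 2 powr \<alpha>"
  have B: "norm (circle_deriv v \<theta>) \<le> B" for \<theta>
  proof -
    have "norm (cis \<theta> - cis 0) \<le> 2" using norm_triangle_ineq4[of "cis \<theta>" "cis 0"] by simp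
    then have "norm (cis \<theta> - cis 0) powr \<alpha> \<le> 2 powr \<alpha>" using assms(2) by (intro powr_mono2) auto
    then have "K * norm (cis \<theta> - cis 0) powr \<alpha> \<le> K * 2 powr \<alpha>" by (rule mult_left_mono) (simp add: K_def)
    then show ?thesis using K[of \<theta> 0] norm_triangle_sub[of "circle_deriv v \<theta>" "circle_deriv v 0"] unfolding B_def by linarith
  qed
  have B0: "0 \<le> B" using B[of 0] norm_ge_zero order_trans by blast
  have lip: "norm (v (cis a) - v (cis b)) \<le> B * norm (a - b)" for a b
    by (rule differentiable_bound[OF convex_UNIV, where f' = "\<lambda>\<theta> h. h *\<^sub>R circle_deriv v \<theta>"])
       (use D B in \<open>auto simp: has_vector_derivative_def onorm_scaleR_left onorm_id bounded_linear_ident\<close>)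
  have L: "norm (v \<zeta> - v \<xi>) \<le> 3 * B * norm (\<zeta> - \<xi>)" if "\<zeta> \<in> sphere 0 1" "\<xi> \<in> sphere 0 1" for \<zeta> \<xi>
  proof -
    define b s where "b = Arg \<xi>" and "s = Arg (\<zeta> / \<xi>)"
    have n: "norm \<zeta> = 1" "norm \<xi> = 1" "\<xi> \<noteq> 0" "\<zeta> \<noteq> 0" using that by auto
    have \<xi>: "\<xi> = cis b" using n cis_Arg[of \<xi>] by (simp add: b_def sgn_div_norm)
    have q: "\<zeta> / \<xi> = cis s" using n cis_Arg[of "\<zeta> / \<xi>"] by (simp add: s_def sgn_div_norm norm_divide)
    then have \<zeta>: "\<zeta> = cis (b + s)" using n \<xi> by (simp add: field_simps cis_mult[symmetric])
    have s: "\<bar>s\<bar> \<le> pi" using Arg_bounded[of "\<zeta> / \<xi>"] by (auto simp: s_def)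
    have "\<zeta> - \<xi> = \<xi> * (cis s - 1)" using n q by (simp add: field_simps)
    then have "norm (\<zeta> - \<xi>) = norm (cis s - 1)" using n by (simp add: norm_mult)
    then have "\<bar>s\<bar> \<le> 3 * norm (\<zeta> - \<xi>)" using chord_ge_angle[OF s] by simp
    then have "B * \<bar>s\<bar> \<le> B * (3 * norm (\<zeta> - \<xi>))" using B0 by (rule mult_left_mono)
    then show ?thesis using lip[of "b + s" b] \<zeta> \<xi> by simp
  qed
  define M where "M = norm (v 1) + 3 * B * 2"
  have M: "norm (v \<zeta>) \<le> M" if "\<zeta> \<in> sphere 0 1" for \<zeta>
  proof -
    have "norm (\<zeta> - 1) \<le> 2" using that norm_triangle_ineq4[of \<zeta> 1] by simp
    then have "3 * B * norm (\<zeta> - 1) \<le> 3 * B * 2" using B0 by (intro mult_left_mono) auto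
    then show ?thesis using L[OF that, of 1] norm_triangle_sub[of "v \<zeta>" "v 1"] unfolding M_def by simp
  qed
  have "norm (v \<zeta>) \<le> max M B" if "\<zeta> \<in> sphere 0 1" for \<zeta> using M[OF that] by simp
  moreover have "norm (circle_deriv v \<theta>) \<le> max M B" for \<theta> using B[of \<theta>] by simp
  ultimately show thesis
    using that[of "max M B" "3 * B" K] L K B0 by (simp add: K_def max.coboundedI2)
qed

text \<open>Each of the three suprema in the norm is taken over a bounded set of nonnegative numbers, so the first one is
at most their sum.\<close>

lemma norm_le_C1_holder_norm:
  assumes v: "C1_holder \<alpha> v" and "0 < \<alpha>" and \<zeta>: "\<zeta> \<in> sphere 0 1"
  shows "norm (v \<zeta>) \<le> C1_holder_norm \<alpha> v"
proof -
  obtain M L K where M: "\<And>\<zeta>. \<zeta> \<in> sphere 0 1 \<Longrightarrow> norm (v \<zeta>) \<le> M" "\<And>\<theta>. norm (circle_deriv v \<theta>) \<le> M"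
    and K: "\<And>\<theta> \<phi>. norm (circle_deriv v \<theta> - circle_deriv v \<phi>) \<le> K * norm (cis \<theta> - cis \<phi>) powr \<alpha>"
    using C1_holder_bounds[OF v assms(2)] by metis
  obtain \<theta> where \<theta>: "\<zeta> = cis \<theta>"
  proof -
    have "\<zeta> = cis (Arg \<zeta>)" using \<zeta> cis_Arg[of \<zeta>] by (cases "\<zeta> = 0") (auto simp: sgn_div_norm)
    then show thesis by (rule that)
  qed
  have "norm (v (cis \<theta>)) \<le> (SUP \<theta>. norm (v (cis \<theta>)))"
    by (rule cSUP_upper) (auto intro!: bdd_aboveI[of _ M] M)
  moreover have "norm (circle_deriv v 0) \<le> (SUP \<theta>. norm (circle_deriv v \<theta>))"
    by (rule cSUP_upper) (auto intro!: bdd_aboveI[of _ M] M)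
  moreover have "(case (0, pi) of (\<theta>, \<phi>) \<Rightarrow> norm (circle_deriv v \<theta> - circle_deriv v \<phi>) / dist (cis \<theta>) (cis \<phi>) powr \<alpha>)
      \<le> (SUP (\<theta>, \<phi>) \<in> {(\<theta>, \<phi>). cis \<theta> \<noteq> cis \<phi>}. norm (circle_deriv v \<theta> - circle_deriv v \<phi>) / dist (cis \<theta>) (cis \<phi>) powr \<alpha>)"
    by (rule cSUP_upper) (use K in \<open>auto intro!: bdd_aboveI[of _ K] simp: divide_le_eq dist_norm\<close>)
  moreover have "0 \<le> (case (0, pi) of (\<theta>, \<phi>) \<Rightarrow> norm (circle_deriv v \<theta> - circle_deriv v \<phi>) / dist (cis \<theta>) (cis \<phi>) powr \<alpha>)"
    by simp
  ultimately show ?thesis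
    unfolding C1_holder_norm_def \<theta> using norm_ge_zero[of "circle_deriv v 0"] by linarith
qed

lemma C1_holder_add:
  assumes "C1_holder \<alpha> u" "C1_holder \<alpha> v"
  shows "C1_holder \<alpha> (\<lambda>\<zeta>. u \<zeta> + v \<zeta>)"
proof -
  obtain D K E L where D: "\<And>\<theta>. ((\<lambda>t. u (cis t)) has_vector_derivative D \<theta>) (at \<theta>)"
    and K: "\<And>\<theta> \<phi>. norm (D \<theta> - D \<phi>) \<le> K * norm (cis \<theta> - cis \<phi>) powr \<alpha>"
    and E: "\<And>\<theta>. ((\<lambda>t. v (cis t)) has_vector_derivative E \<theta>) (at \<theta>)"
    and L: "\<And>\<theta> \<phi>. norm (E \<theta> - E \<phi>) \<le> L * norm (cis \<theta> - cis \<phi>) powr \<alpha>"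
    using assms unfolding C1_holder_iff by blast
  have "norm ((D \<theta> + E \<theta>) - (D \<phi> + E \<phi>)) \<le> (K + L) * norm (cis \<theta> - cis \<phi>) powr \<alpha>" for \<theta> \<phi>
    using norm_triangle_mono[OF K[of \<theta> \<phi>] L[of \<theta> \<phi>]] by (simp add: algebra_simps)
  with has_vector_derivative_add[OF D E] show ?thesis by (rule C1_holderI)
qed

lemma C1_holder_bounded_linear:
  assumes F: "bounded_linear F" and "C1_holder \<alpha> v"
  shows "C1_holder \<alpha> (\<lambda>\<zeta>. F (v \<zeta>))"
proof -
  interpret bounded_linear F by (rule F)
  obtain B where B: "0 \<le> B" "\<And>x. norm (F x) \<le> norm x * B" using nonneg_bounded by blast
  obtain D K where D: "\<And>\<theta>. ((\<lambda>t. v (cis t)) has_vector_derivative D \<theta>) (at \<theta>)"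
    and K: "\<And>\<theta> \<phi>. norm (D \<theta> - D \<phi>) \<le> K * norm (cis \<theta> - cis \<phi>) powr \<alpha>"
    using assms(2) unfolding C1_holder_iff by blast
  have "norm (F (D \<theta>) - F (D \<phi>)) \<le> (K * B) * norm (cis \<theta> - cis \<phi>) powr \<alpha>" for \<theta> \<phi>
    using B(2)[of "D \<theta> - D \<phi>"] mult_right_mono[OF K[of \<theta> \<phi>] B(1)] by (simp add: diff mult_ac)
  with bounded_linear.has_vector_derivative[OF F D] show ?thesis by (rule C1_holderI)
qed

lemma C1_holder_const: "C1_holder \<alpha> (\<lambda>_. a)"
  by (rule C1_holderI[where D = "\<lambda>_. 0" and K = 0]) simp_all

lemma C1_holder_sum: "(\<And>i. i \<in> I \<Longrightarrow> C1_holder \<alpha> (v i)) \<Longrightarrow> C1_holder \<alpha> (\<lambda>\<zeta>. \<Sum>i\<in>I. v i \<zeta>)"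
  by (induction I rule: infinite_finite_induct) (auto simp: C1_holder_const intro: C1_holder_add)

lemma bounded_linear_axis: "bounded_linear (axis k :: complex \<Rightarrow> complex ^ 'n::finite)"
  unfolding linear_conv_bounded_linear[symmetric] by (auto intro!: linearI simp: vec_eq_iff axis_def)

lemma sum_axis_components: "(\<Sum>k\<in>UNIV. axis k (x $ k)) = (x :: complex ^ 'n::finite)"
  by (simp add: vec_eq_iff axis_def if_distrib cong: if_cong)

lemma C1_holder_vec:
  fixes g :: "complex \<Rightarrow> complex ^ 'n::finite"
  assumes "\<And>k. C1_holder \<alpha> (\<lambda>\<zeta>. g \<zeta> $ k)"
  shows "C1_holder \<alpha> g"
proof -
  have "C1_holder \<alpha> (\<lambda>\<zeta>. \<Sum>k\<in>UNIV. axis k (g \<zeta> $ k))"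
    by (intro C1_holder_sum C1_holder_bounded_linear[OF bounded_linear_axis] assms)
  then show ?thesis by (simp add: sum_axis_components)
qed

lemma C1_holder_Pair:
  assumes "C1_holder \<alpha> f" "C1_holder \<alpha> g"
  shows "C1_holder \<alpha> (\<lambda>\<zeta>. (f \<zeta>, g \<zeta>))"
proof -
  have "bounded_linear (\<lambda>x. (x, 0))" "bounded_linear (\<lambda>x. (0, x))"
    by (intro bounded_linear_Pair bounded_linear_ident bounded_linear_zero)+
  from C1_holder_add[OF C1_holder_bounded_linear[OF this(1) assms(1)] C1_holder_bounded_linear[OF this(2) assms(2)]]
  show ?thesis by simp
qed

lemma C1_holder_diff: "C1_holder \<alpha> u \<Longrightarrow> C1_holder \<alpha> v \<Longrightarrow> C1_holder \<alpha> (\<lambda>\<zeta>. u \<zeta> - v \<zeta>)"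
  using C1_holder_add[of \<alpha> u "\<lambda>\<zeta>. - v \<zeta>"] C1_holder_bounded_linear[of uminus \<alpha> v]
  by (simp add: bounded_linear_minus bounded_linear_ident)

text \<open>Distances on the circle are at most \<open>2\<close>, so Lipschitz bounds imply Hoelder bounds there.\<close>

lemma le_powr_on_unit_scale:
  fixes x :: real
  assumes "0 \<le> x" "x \<le> 2" "0 < \<alpha>" "\<alpha> < 1"
  shows "x \<le> 2 * x powr \<alpha>"
proof (cases "x = 0")
  case False
  have "x powr (1 - \<alpha>) \<le> 2 powr (1 - \<alpha>)" using assms by (intro powr_mono2) auto
  also have "\<dots> \<le> 2 powr 1" using assms by (intro powr_mono) auto
  finally have "x powr (1 - \<alpha>) * x powr \<alpha> \<le> 2 * x powr \<alpha>" by (intro mult_right_mono) auto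
  moreover have "x powr (1 - \<alpha>) * x powr \<alpha> = x" using False assms by (simp add: powr_add[symmetric])
  ultimately show ?thesis by simp
qed simp

lemma C1_holder_mult_1_minus:
  fixes v :: "complex \<Rightarrow> complex"
  assumes v: "C1_holder \<alpha> v" and \<alpha>: "0 < \<alpha>" "\<alpha> < 1"
  shows "C1_holder \<alpha> (\<lambda>\<zeta>. (1 - \<zeta>) * v \<zeta>)"
proof -
  obtain M L K where M: "\<And>\<zeta>. \<zeta> \<in> sphere 0 1 \<Longrightarrow> norm (v \<zeta>) \<le> M" "\<And>\<theta>. norm (circle_deriv v \<theta>) \<le> M"
    and L: "\<And>\<zeta> \<xi>. \<zeta> \<in> sphere 0 1 \<Longrightarrow> \<xi> \<in> sphere 0 1 \<Longrightarrow> norm (v \<zeta> - v \<xi>) \<le> L * norm (\<zeta> - \<xi>)"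
    and K: "\<And>\<theta> \<phi>. norm (circle_deriv v \<theta> - circle_deriv v \<phi>) \<le> K * norm (cis \<theta> - cis \<phi>) powr \<alpha>"
    and pos: "0 \<le> M" "0 \<le> L" "0 \<le> K"
    using C1_holder_bounds[OF v \<alpha>(1)] by metis
  define E where "E \<theta> = (1 - cis \<theta>) * circle_deriv v \<theta> + (- (\<i> * cis \<theta>)) * v (cis \<theta>)" for \<theta>
  have cis: "(cis has_vector_derivative (\<i> * cis \<theta>)) (at \<theta>)" for \<theta>
    unfolding has_vector_derivative_def by (auto intro!: derivative_eq_intros simp: scaleR_conv_of_real mult_ac)
  have D: "((\<lambda>t. v (cis t)) has_vector_derivative circle_deriv v \<theta>) (at \<theta>)" for \<theta>
    using v by (simp add: C1_holder_def circle_deriv_works)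
  have c: "((\<lambda>t. 1 - cis t) has_vector_derivative (- (\<i> * cis \<theta>))) (at \<theta>)" for \<theta>
    using has_vector_derivative_diff[OF has_vector_derivative_const cis] by simp
  have "((\<lambda>t. (1 - cis t) * v (cis t)) has_vector_derivative E \<theta>) (at \<theta>)" for \<theta>
    unfolding E_def by (rule has_vector_derivative_mult[OF c D])
  moreover have "norm (E \<theta> - E \<phi>) \<le> (2 * K + 2 * (M + L + M)) * norm (cis \<theta> - cis \<phi>) powr \<alpha>" for \<theta> \<phi>
  proof -
    define d where "d = norm (cis \<theta> - cis \<phi>)"
    have d2: "norm (1 - cis \<theta>) \<le> 2" "d \<le> 2"
      using norm_triangle_ineq4[of 1 "cis \<theta>"] norm_triangle_ineq4[of "cis \<theta>" "cis \<phi>"] by (simp_all add: d_def)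
    have "E \<theta> - E \<phi> = (1 - cis \<theta>) * (circle_deriv v \<theta> - circle_deriv v \<phi>) + (cis \<phi> - cis \<theta>) * circle_deriv v \<phi>
       + (- \<i> * cis \<theta>) * (v (cis \<theta>) - v (cis \<phi>)) + (\<i> * (cis \<phi> - cis \<theta>)) * v (cis \<phi>)"
      by (simp add: E_def algebra_simps)
    also have "norm \<dots> \<le> 2 * (K * d powr \<alpha>) + d * M + 1 * (L * d) + d * M"
    proof (intro norm_triangle_mono)
      show "norm ((1 - cis \<theta>) * (circle_deriv v \<theta> - circle_deriv v \<phi>)) \<le> 2 * (K * d powr \<alpha>)"
        unfolding norm_mult using d2 K by (intro mult_mono) (auto simp: d_def)
      show "norm ((cis \<phi> - cis \<theta>) * circle_deriv v \<phi>) \<le> d * M"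
        unfolding norm_mult using M by (intro mult_mono) (auto simp: d_def norm_minus_commute)
      show "norm ((- \<i> * cis \<theta>) * (v (cis \<theta>) - v (cis \<phi>))) \<le> 1 * (L * d)"
        unfolding norm_mult using L by (intro mult_mono) (auto simp: d_def)
      show "norm ((\<i> * (cis \<phi> - cis \<theta>)) * v (cis \<phi>)) \<le> d * M"
        unfolding norm_mult using M by (intro mult_mono) (auto simp: d_def norm_minus_commute)
    qed
    also have "\<dots> = 2 * K * d powr \<alpha> + (M + L + M) * d" by (simp add: algebra_simps)
    also have "\<dots> \<le> 2 * K * d powr \<alpha> + (M + L + M) * (2 * d powr \<alpha>)"
      using le_powr_on_unit_scale[OF _ d2(2) \<alpha>] pos by (intro add_left_mono mult_left_mono) (auto simp: d_def)
    finally show ?thesis by (simp add: d_def algebra_simps)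
  qed
  ultimately show ?thesis by (rule C1_holderI)
qed

lemma A1_diff:
  assumes "u \<in> A1 \<alpha>" "v \<in> A1 \<alpha>"
  shows "(\<lambda>\<zeta>. u \<zeta> - v \<zeta>) \<in> A1 \<alpha>"
  using assms by (simp add: A1_def continuous_on_diff holomorphic_on_diff C1_holder_diff)

lemma A1_vec_diff: "g \<in> A1_vec \<alpha> \<Longrightarrow> h \<in> A1_vec \<alpha> \<Longrightarrow> (\<lambda>\<zeta>. g \<zeta> - h \<zeta>) \<in> A1_vec \<alpha>"
  by (simp add: A1_vec_def A1_diff)

text \<open>By the Lipschitz bound, \<open>\<bar>v \<zeta>\<bar> = \<bar>v \<zeta> - v 1\<bar> \<le> L \<bar>\<zeta> - 1\<bar>\<close>.\<close>

lemma hardy_divide_1_minus: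
  assumes v: "v \<in> A1 \<alpha>" and "0 < \<alpha>" and v1: "v 1 = 0"
  shows "hardy (\<lambda>\<zeta>. v \<zeta> / (1 - \<zeta>)) (v 0)"
proof (rule hardyI[where k = 1])
  show c: "continuous_on (cball 0 1) v" and "v holomorphic_on ball 0 1" using v by (auto simp: A1_def)
  show "(1 - \<zeta>) ^ 1 * (v \<zeta> / (1 - \<zeta>)) = v \<zeta>" if "\<zeta> \<in> pcircle" for \<zeta>
    using that by (simp add: pcircle_def)
  have "C1_holder \<alpha> v" using v by (simp add: A1_def)
  then obtain L where L: "\<And>\<zeta> \<xi>. \<zeta> \<in> sphere 0 1 \<Longrightarrow> \<xi> \<in> sphere 0 1 \<Longrightarrow> norm (v \<zeta> - v \<xi>) \<le> L * norm (\<zeta> - \<xi>)"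
    using C1_holder_bounds[OF _ assms(2)] by metis
  have "norm (v \<zeta> / (1 - \<zeta>)) \<le> L" if "\<zeta> \<in> pcircle" for \<zeta>
    using L[of \<zeta> 1] that by (simp add: v1 norm_divide pcircle_def divide_le_eq norm_minus_commute)
  then have "bounded ((\<lambda>\<zeta>. v \<zeta> / (1 - \<zeta>)) ` pcircle)" unfolding bounded_iff by blast
  moreover have "continuous_on pcircle (\<lambda>\<zeta>. v \<zeta> / (1 - \<zeta>))"
    by (intro continuous_intros continuous_on_subset[OF c]) (auto simp: pcircle_def)
  ultimately show "tame (\<lambda>\<zeta>. v \<zeta> / (1 - \<zeta>))" by (simp add: tame_def)
qed

lemma A1_vec_scale_C1_holder:
  fixes k :: "complex \<Rightarrow> complex ^ 'k::finite"
  assumes "k \<in> A1_vec \<alpha>" "0 < \<alpha>" "\<alpha> < 1"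
  shows "C1_holder \<alpha> (\<lambda>\<zeta>. (1 - \<zeta>) *s k \<zeta>)"
proof (rule C1_holder_vec)
  show "C1_holder \<alpha> (\<lambda>\<zeta>. ((1 - \<zeta>) *s k \<zeta>) $ i)" for i
    unfolding vector_smult_component
    by (intro C1_holder_mult_1_minus) (use assms in \<open>simp_all add: A1_vec_def A1_def\<close>)
qed

lemma affine_discs_diff:
  fixes f f' :: "('n::finite, 'd::finite) disc"
  assumes "f \<in> affine_discs \<alpha> c" "f' \<in> affine_discs \<alpha> c"
  shows "\<exists>h g h' g'. h \<in> A1_vec \<alpha> \<and> g \<in> A1_vec \<alpha> \<and> h' \<in> A1_vec \<alpha> \<and> g' \<in> A1_vec \<alpha> \<and>
    (\<forall>\<zeta>\<in>cball 0 1. f \<zeta> - f' \<zeta> = (((1 - \<zeta>) *s h \<zeta>, (1 - \<zeta>) *s g \<zeta>), ((1 - \<zeta>) *s h' \<zeta>, (1 - \<zeta>) *s g' \<zeta>)))"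
proof -
  obtain h1 g1 h1' g1' where 1: "h1 \<in> A1_vec \<alpha>" "g1 \<in> A1_vec \<alpha>" "h1' \<in> A1_vec \<alpha>" "g1' \<in> A1_vec \<alpha>"
    "f = restrict (\<lambda>\<zeta>. (((1 - \<zeta>) *s h1 \<zeta>, (1 - \<zeta>) *s g1 \<zeta>),
         ((1 - \<zeta>) *s h1' \<zeta>, (1 - \<zeta>) *s g1' \<zeta> + (\<chi> j. \<zeta> / 2 * of_real (c $ j))))) (cball 0 1)"
    using assms(1) unfolding affine_discs_def by blast
  obtain h2 g2 h2' g2' where 2: "h2 \<in> A1_vec \<alpha>" "g2 \<in> A1_vec \<alpha>" "h2' \<in> A1_vec \<alpha>" "g2' \<in> A1_vec \<alpha>"
    "f' = restrict (\<lambda>\<zeta>. (((1 - \<zeta>) *s h2 \<zeta>, (1 - \<zeta>) *s g2 \<zeta>),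
         ((1 - \<zeta>) *s h2' \<zeta>, (1 - \<zeta>) *s g2' \<zeta> + (\<chi> j. \<zeta> / 2 * of_real (c $ j))))) (cball 0 1)"
    using assms(2) unfolding affine_discs_def by blast
  define h g h' g' where "h = (\<lambda>\<zeta>. h1 \<zeta> - h2 \<zeta>)" and "g = (\<lambda>\<zeta>. g1 \<zeta> - g2 \<zeta>)"
    and "h' = (\<lambda>\<zeta>. h1' \<zeta> - h2' \<zeta>)" and "g' = (\<lambda>\<zeta>. g1' \<zeta> - g2' \<zeta>)"
  have A: "h \<in> A1_vec \<alpha>" "g \<in> A1_vec \<alpha>" "h' \<in> A1_vec \<alpha>" "g' \<in> A1_vec \<alpha>"
    unfolding h_def g_def h'_def g'_def by (intro A1_vec_diff 1 2)+
  let ?u = "\<lambda>\<zeta>. (((1 - \<zeta>) *s h \<zeta>, (1 - \<zeta>) *s g \<zeta>), ((1 - \<zeta>) *s h' \<zeta>, (1 - \<zeta>) *s g' \<zeta>))"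
  have "f \<zeta> - f' \<zeta> = ?u \<zeta>" if "\<zeta> \<in> cball 0 1" for \<zeta>
    using that by (simp add: 1 2 h_def g_def h'_def g'_def vec_eq_iff algebra_simps)
  then show ?thesis using A by blast
qed

lemma affine_discs_C1_holder_diff:
  fixes f f' :: "('n::finite, 'd::finite) disc"
  assumes "f \<in> affine_discs \<alpha> c" "f' \<in> affine_discs \<alpha> c" and \<alpha>: "0 < \<alpha>" "\<alpha> < 1"
  shows "C1_holder \<alpha> (\<lambda>\<zeta>. f \<zeta> - f' \<zeta>)"
proof -
  obtain h g h' g' where A: "h \<in> A1_vec \<alpha>" "g \<in> A1_vec \<alpha>" "h' \<in> A1_vec \<alpha>" "g' \<in> A1_vec \<alpha>"
    and u: "\<forall>\<zeta>\<in>cball 0 1. f \<zeta> - f' \<zeta> = (((1 - \<zeta>) *s h \<zeta>, (1 - \<zeta>) *s g \<zeta>), ((1 - \<zeta>) *s h' \<zeta>, (1 - \<zeta>) *s g' \<zeta>))"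
    using affine_discs_diff[OF assms(1,2)] by (elim exE conjE)
  let ?u = "\<lambda>\<zeta>. (((1 - \<zeta>) *s h \<zeta>, (1 - \<zeta>) *s g \<zeta>), ((1 - \<zeta>) *s h' \<zeta>, (1 - \<zeta>) *s g' \<zeta>))"
  have "C1_holder \<alpha> ?u" by (intro C1_holder_Pair A1_vec_scale_C1_holder A \<alpha>)
  moreover have "C1_holder \<alpha> (\<lambda>\<zeta>. f \<zeta> - f' \<zeta>) = C1_holder \<alpha> ?u"
    unfolding C1_holder_iff using u by simp
  ultimately show ?thesis by simp
qed

section \<open>Conormal multipliers for perturbed quadrics\<close>

text \<open>The multipliers are indexed by \<open>j\<close> and not by the spanning vectors, which may coincide.\<close>

lemma conormalE:
  fixes r :: "('n::finite, 'd::finite) cspace \<Rightarrow> real ^ 'd"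
  assumes "y \<in> conormal r q"
  obtains l :: "'d \<Rightarrow> real" where "y = (\<Sum>j\<in>UNIV. l j *\<^sub>R del (\<lambda>p. r p $ j) q)"
proof -
  let ?v = "\<lambda>j. del (\<lambda>p. r p $ j) q"
  let ?S = "range (\<lambda>l. \<Sum>j\<in>UNIV. l j *\<^sub>R ?v j)"
  have "subspace ?S"
    unfolding subspace_def
  proof (intro conjI ballI allI)
    show "0 \<in> ?S" by (rule image_eqI[of _ _ "\<lambda>_. 0"]) simp_all
  next
    fix x y assume "x \<in> ?S" "y \<in> ?S"
    then obtain l m where "x = (\<Sum>j\<in>UNIV. l j *\<^sub>R ?v j)" "y = (\<Sum>j\<in>UNIV. m j *\<^sub>R ?v j)" by blast
    then show "x + y \<in> ?S" by (intro image_eqI[of _ _ "\<lambda>j. l j + m j"]) (simp_all add: sum.distrib scaleR_add_left)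
  next
    fix x and a :: real assume "x \<in> ?S"
    then obtain l where "x = (\<Sum>j\<in>UNIV. l j *\<^sub>R ?v j)" by blast
    then show "a *\<^sub>R x \<in> ?S" by (intro image_eqI[of _ _ "\<lambda>j. a * l j"]) (simp_all add: scaleR_sum_right)
  qed
  moreover have "range ?v \<subseteq> ?S"
  proof
    fix x assume "x \<in> range ?v"
    then obtain i where "x = ?v i" by blast
    then show "x \<in> ?S"
      by (intro image_eqI[of _ _ "\<lambda>j. if j = i then 1 else 0"]) (simp_all add: if_distrib[of "\<lambda>a. a *\<^sub>R _"] cong: if_cong)
  qed
  ultimately have "span (range ?v) \<subseteq> ?S" by (intro span_minimal)
  then show thesis using assms that unfolding conormal_def by blast
qed

lemma del_quadric_perturbed:
  fixes s :: "('n::finite, 'd::finite) cspace \<Rightarrow> real ^ 'd"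
  assumes "hermitian (A j)" and s: "s differentiable at q"
  defines "L \<equiv> frechet_derivative s (at q)"
  shows "del (\<lambda>p. quadric A p $ j + s p $ j) q =
    ((\<chi> k. (of_real (L (axis k 1, 0) $ j) - \<i> * of_real (L (axis k \<i>, 0) $ j)) / 2 - cnj ((A j *v fst q) $ k)),
     (\<chi> l. (of_real (L (0, axis l 1) $ j) - \<i> * of_real (L (0, axis l \<i>) $ j)) / 2 + axis j (1 / 2) $ l))"
proof -
  obtain z w where q: "q = (z, w)" by (cases q)
  let ?Q = "frechet_derivative (\<lambda>p. quadric A p $ j) (at q)"
  have Q: "((\<lambda>p. quadric A p $ j) has_derivative ?Q) (at q)"
    using quadric_deriv unfolding q frechet_derivative_works[symmetric] differentiable_def by blast
  have "((\<lambda>p. s p $ j) has_derivative (\<lambda>h. L h $ j)) (at q)"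
    using s unfolding L_def frechet_derivative_works by (rule bounded_linear.has_derivative[OF bounded_linear_vec_nth])
  from frechet_derivative_at[OF has_derivative_add[OF Q this]]
  have F: "frechet_derivative (\<lambda>p. quadric A p $ j + s p $ j) (at q) = (\<lambda>h. ?Q h + L h $ j)" by simp
  have "fst (del (\<lambda>p. quadric A p $ j) q) $ k = - cnj ((A j *v fst q) $ k)"
    "snd (del (\<lambda>p. quadric A p $ j) q) $ l = axis j (1 / 2) $ l" for k l
    unfolding q del_quadric[of A j, OF assms(1)] by (simp_all add: conj_vec_def)
  then have Q': "(of_real (?Q (axis k 1, 0)) - \<i> * of_real (?Q (axis k \<i>, 0))) / 2 = - cnj ((A j *v fst q) $ k)"
    "(of_real (?Q (0, axis l 1)) - \<i> * of_real (?Q (0, axis l \<i>))) / 2 = axis j (1 / 2) $ l" for k l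
    by (simp_all add: del_def Let_def)
  have split: "(of_real (a + a') - \<i> * of_real (b + b')) / 2
      = (of_real a' - \<i> * of_real b') / 2 + (of_real a - \<i> * of_real b) / (2 :: complex)" for a b a' b'
    by (simp add: field_simps)
  show ?thesis
    unfolding del_def F Let_def prod.inject vec_eq_iff vec_lambda_beta split Q' by simp
qed

lemma axis_pair_in_Basis:
  "(axis k 1, 0) \<in> (Basis :: ('n::finite, 'd::finite) cspace set)"
  "(axis k \<i>, 0) \<in> (Basis :: ('n, 'd) cspace set)"
  "(0, axis l 1) \<in> (Basis :: ('n, 'd) cspace set)"
  "(0, axis l \<i>) \<in> (Basis :: ('n, 'd) cspace set)"
  by (auto simp: Basis_prod_def Basis_vec_def Basis_complex_def)

lemma norm_half_complex_le:
  assumes "\<bar>a\<bar> \<le> t" "\<bar>b\<bar> \<le> t"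
  shows "norm ((of_real a - \<i> * of_real b) / 2 :: complex) \<le> t"
  using norm_triangle_ineq4[of "of_real a :: complex" "\<i> * of_real b"] assms by (simp add: norm_divide norm_mult)

lemma boundary_system_mono:
  assumes "boundary_system A c V \<eta> \<zeta> z w p q" "\<eta> \<le> \<eta>'"
  shows "boundary_system A c V \<eta>' \<zeta> z w p q"
  using assms(1) mult_right_mono[OF assms(2) norm_ge_zero[of "((z, w), (p, q))"]]
  unfolding boundary_system_def by (meson order_trans)

text \<open>For points of the submanifold with conormal vectors, the perturbation \<open>s = r - \<rho>\<close> enters through its first
partial derivatives. On the ball, \<open>s\<close> and these derivatives have Lipschitz constants at most \<open>\<delta>\<close> times the
dimension, which is why \<open>\<delta>\<close> is \<open>\<tau>\<close> divided by the dimension.\<close>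

lemma conormal_boundary_estimate:
  fixes A :: "'d::finite \<Rightarrow> complex ^ 'n::finite ^ 'n" and c :: "real ^ 'd" and V :: "complex ^ 'n"
  assumes herm: "\<And>j. hermitian (A j)" and "0 < \<eta>"
  shows "\<exists>\<tau>>0. \<exists>\<delta>>0. \<forall>r \<zeta> z1 w1 p1 q1 z2 w2 p2 q2.
      r \<in> Cspace 4 \<longrightarrow> Cnorm 4 (\<lambda>p. r p - quadric A p) < \<delta> \<longrightarrow> norm \<zeta> = 1 \<longrightarrow>
      (z1, w1) \<in> ball 0 1 \<longrightarrow> r (z1, w1) = 0 \<longrightarrow> (p1, q1) \<in> cscale \<zeta> ` conormal r (z1, w1) \<longrightarrow>
      norm (((z1, w1), (p1, q1)) - initial_disc A c V \<zeta>) < \<tau> \<longrightarrow>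
      (z2, w2) \<in> ball 0 1 \<longrightarrow> r (z2, w2) = 0 \<longrightarrow> (p2, q2) \<in> cscale \<zeta> ` conormal r (z2, w2) \<longrightarrow>
      norm (((z2, w2), (p2, q2)) - initial_disc A c V \<zeta>) < \<tau> \<longrightarrow>
      boundary_system A c V \<eta> \<zeta> (z1 - z2) (w1 - w2) (p1 - p2) (q1 - q2)"
proof -
  define K where "K = 1 + real CARD('n) + real CARD('d) + norm V + norm c + (\<Sum>j\<in>UNIV. real CARD('n) * norm (A j))"
  have S: "0 \<le> (\<Sum>j\<in>UNIV. real CARD('n) * norm (A j))" by (intro sum_nonneg) simp
  then have K: "1 \<le> K" "real CARD('n) \<le> K" "real CARD('d) \<le> K" "norm V \<le> K" "norm c \<le> K"
      "(\<Sum>j\<in>UNIV. real CARD('n) * norm (A j)) \<le> K"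
    by (simp_all add: K_def add_nonneg_nonneg)
  have Kc: "\<bar>c $ l\<bar> \<le> K" for l
    using Finite_Cartesian_Product.norm_nth_le[of c l] K(5) by simp
  have KA: "norm ((A j *v x) $ k) \<le> K * norm x" for j k x
  proof -
    have "norm ((A j *v x) $ k) \<le> (\<Sum>i\<in>UNIV. norm (A j) * norm (x $ i))"
      by (rule norm_mult_vec_component_le[OF norm_entry_le])
    also have "\<dots> \<le> real CARD('n) * (norm (A j) * norm x)"
      by (rule sum_bounded_above) (simp add: mult_left_mono Finite_Cartesian_Product.norm_nth_le)
    also have "\<dots> = (real CARD('n) * norm (A j)) * norm x" by simp
    also have "real CARD('n) * norm (A j) \<le> (\<Sum>j\<in>UNIV. real CARD('n) * norm (A j))"
      by (rule member_le_sum) auto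
    finally show ?thesis using mult_right_mono[OF K(6) norm_ge_zero[of x]] by (simp add: mult_right_mono)
  qed
  define \<tau> where "\<tau> = min (1 / (4 * K)) (\<eta> / (78 * K ^ 5))"
  have K5: "0 < K ^ 5" using K(1) by simp
  have \<tau>: "0 < \<tau>" "4 * K * \<tau> \<le> 1" "78 * K ^ 5 * \<tau> \<le> \<eta>"
  proof -
    show "0 < \<tau>" using K(1) K5 assms(2) by (simp add: \<tau>_def)
    have "4 * K * \<tau> \<le> 4 * K * (1 / (4 * K))" using K(1) by (intro mult_left_mono) (auto simp: \<tau>_def)
    then show "4 * K * \<tau> \<le> 1" using K(1) by simp
    have "78 * K ^ 5 * \<tau> \<le> 78 * K ^ 5 * (\<eta> / (78 * K ^ 5))" using K5 by (intro mult_left_mono) (auto simp: \<tau>_def)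
    then show "78 * K ^ 5 * \<tau> \<le> \<eta>" using K5 by simp
  qed
  define D where "D = real DIM(('n, 'd) cspace)"
  have D: "1 \<le> D" unfolding D_def real_of_nat_ge_one_iff using DIM_positive[where 'a = "('n, 'd) cspace"] by linarith
  define \<delta> where "\<delta> = \<tau> / D"
  have \<delta>: "0 < \<delta>" "\<delta> \<le> \<tau>" "D * \<delta> = \<tau>"
    using D \<tau>(1) by (simp_all add: \<delta>_def divide_le_eq)
  show ?thesis
  proof (rule exI[of _ \<tau>], intro conjI \<tau>(1), rule exI[of _ \<delta>], intro conjI allI impI \<delta>(1))
    fix r :: "('n, 'd) cspace \<Rightarrow> real ^ 'd" and \<zeta> :: complex and z1 p1 z2 p2 :: "complex ^ 'n" and w1 q1 w2 q2 :: "complex ^ 'd"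
    assume r: "r \<in> Cspace 4" "Cnorm 4 (\<lambda>p. r p - quadric A p) < \<delta>" and \<zeta>: "norm \<zeta> = 1"
      and x1: "(z1, w1) \<in> ball 0 1" "r (z1, w1) = 0" "(p1, q1) \<in> cscale \<zeta> ` conormal r (z1, w1)"
        "norm (((z1, w1), (p1, q1)) - initial_disc A c V \<zeta>) < \<tau>"
      and x2: "(z2, w2) \<in> ball 0 1" "r (z2, w2) = 0" "(p2, q2) \<in> cscale \<zeta> ` conormal r (z2, w2)"
        "norm (((z2, w2), (p2, q2)) - initial_disc A c V \<zeta>) < \<tau>"
    define s where "s p = r p - quadric A p" for p
    define N where "N = norm ((z1 - z2, w1 - w2), (p1 - p2, q1 - q2))"
    have s: "s \<in> Cspace 4" "Cnorm 4 s \<le> \<delta>"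
      using Cspace_diff[OF r(1) quadric_in_Cspace] r(2) by (simp_all add: s_def[abs_def])
    note small = Cspace_small[OF s(1) _ s(2)]
    define e where "e x j = (let L = frechet_derivative s (at x) in
       ((\<chi> k. (of_real (L (axis k 1, 0) $ j) - \<i> * of_real (L (axis k \<i>, 0) $ j)) / 2) :: complex ^ 'n,
        (\<chi> l. (of_real (L (0, axis l 1) $ j) - \<i> * of_real (L (0, axis l \<i>) $ j)) / 2) :: complex ^ 'd))" for x j
    have e: "norm (fst (e x j) $ k) \<le> \<tau>" "norm (snd (e x j) $ l) \<le> \<tau>" if "x \<in> ball 0 1" for x j k l
    proof -
      have "\<bar>frechet_derivative s (at x) b $ j\<bar> \<le> \<tau>" if "b \<in> Basis" for b
        using small(2)[OF _ \<open>x \<in> ball 0 1\<close> that] \<delta>(2) Finite_Cartesian_Product.norm_nth_le[of "frechet_derivative s (at x) b" j]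
        by simp
      then show "norm (fst (e x j) $ k) \<le> \<tau>" "norm (snd (e x j) $ l) \<le> \<tau>"
        unfolding e_def Let_def fst_conv snd_conv vec_lambda_beta
        by (intro norm_half_complex_le axis_pair_in_Basis; blast intro: axis_pair_in_Basis)+
    qed
    have xN: "norm ((z1, w1) - (z2, w2)) \<le> N"
      unfolding N_def using norm_fst_le[of "(z1 - z2, w1 - w2)" "(p1 - p2, q1 - q2)"] by simp
    have ed: "norm (fst (e (z1, w1) j) $ k - fst (e (z2, w2) j) $ k) \<le> \<tau> * N"
      "norm (snd (e (z1, w1) j) $ l - snd (e (z2, w2) j) $ l) \<le> \<tau> * N" for j k l
    proof -
      let ?d = "\<lambda>b. frechet_derivative s (at (z1, w1)) b - frechet_derivative s (at (z2, w2)) b"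
      have "\<bar>?d b $ j\<bar> \<le> \<tau> * N" if "b \<in> Basis" for b
      proof -
        have "\<bar>?d b $ j\<bar> \<le> D * \<delta> * norm ((z1, w1) - (z2, w2))"
          using small(4)[OF _ x1(1) x2(1) that] Finite_Cartesian_Product.norm_nth_le[of "?d b" j] by (simp add: D_def)
        also have "\<dots> \<le> \<tau> * N" unfolding \<delta>(3) using xN \<tau>(1) by (intro mult_left_mono) auto
        finally show ?thesis .
      qed
      then have b: "\<bar>frechet_derivative s (at (z1, w1)) b $ j - frechet_derivative s (at (z2, w2)) b $ j\<bar> \<le> \<tau> * N" if "b \<in> Basis" for b
        using that by simp
      have x: "(of_real a - \<i> * of_real b) / 2 - (of_real a' - \<i> * of_real b') / 2
          = (of_real (a - a') - \<i> * of_real (b - b')) / (2 :: complex)" for a b a' b'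
        by (simp add: field_simps)
      show "norm (fst (e (z1, w1) j) $ k - fst (e (z2, w2) j) $ k) \<le> \<tau> * N"
        "norm (snd (e (z1, w1) j) $ l - snd (e (z2, w2) j) $ l) \<le> \<tau> * N"
        unfolding e_def Let_def fst_conv snd_conv vec_lambda_beta x
        by (intro norm_half_complex_le b axis_pair_in_Basis)+
    qed
    have sl: "\<bar>s (z1, w1) $ l - s (z2, w2) $ l\<bar> \<le> \<tau> * N" for l
    proof -
      have "\<bar>(s (z1, w1) - s (z2, w2)) $ l\<bar> \<le> D * \<delta> * norm ((z1, w1) - (z2, w2))"
        using small(3)[OF _ x1(1) x2(1)] Finite_Cartesian_Product.norm_nth_le[of "s (z1, w1) - s (z2, w2)" l] by (simp add: D_def)
      also have "\<dots> \<le> \<tau> * N" unfolding \<delta>(3) using xN \<tau>(1) by (intro mult_left_mono) auto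
      finally show ?thesis by simp
    qed
    have rep: "\<exists>l. (\<forall>i. q $ i = \<zeta> * (of_real (l i) / 2 + (\<Sum>j\<in>UNIV. of_real (l j) * snd (e (z, w) j) $ i))) \<and>
        (\<forall>k. p $ k = \<zeta> * (\<Sum>j\<in>UNIV. of_real (l j) * (fst (e (z, w) j) $ k - cnj ((A j *v z) $ k))))"
      if x: "(z, w) \<in> ball 0 1" and y: "(p, q) \<in> cscale \<zeta> ` conormal r (z, w)" for z w p q
    proof -
      obtain y where y: "(p, q) = cscale \<zeta> y" "y \<in> conormal r (z, w)" using y by blast
      obtain l where l: "y = (\<Sum>j\<in>UNIV. l j *\<^sub>R del (\<lambda>p. r p $ j) (z, w))" using conormalE[OF y(2)] .
      have "(\<lambda>p. r p $ j) = (\<lambda>p. quadric A p $ j + s p $ j)" for j by (simp add: s_def)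
      then have d: "del (\<lambda>p. r p $ j) (z, w) = ((\<chi> k. fst (e (z, w) j) $ k - cnj ((A j *v z) $ k)), (\<chi> i. snd (e (z, w) j) $ i + axis j (1 / 2) $ i))" for j
        using del_quadric_perturbed[of A j, OF herm small(1)[OF _ x]] by (simp add: e_def Let_def)
      have ax: "(\<Sum>j\<in>UNIV. of_real (l j) * axis j (1 / 2) $ i) = (of_real (l i) / 2 :: complex)" for i
        by (simp add: axis_def if_distrib cong: if_cong)
      have "p = \<zeta> *s fst y" "q = \<zeta> *s snd y" using y(1) by (simp_all add: cscale_def)
      then show ?thesis
        by (intro exI[of _ l])
           (simp add: l d fst_sum snd_sum scaleR_conv_of_real[where 'a = complex] distrib_left sum.distrib ax add.commute)
    qed
    obtain l1 where l1: "\<And>i. q1 $ i = \<zeta> * (of_real (l1 i) / 2 + (\<Sum>j\<in>UNIV. of_real (l1 j) * snd (e (z1, w1) j) $ i))"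
        "\<And>k. p1 $ k = \<zeta> * (\<Sum>j\<in>UNIV. of_real (l1 j) * (fst (e (z1, w1) j) $ k - cnj ((A j *v z1) $ k)))"
      using rep[OF x1(1,3)] by blast
    obtain l2 where l2: "\<And>i. q2 $ i = \<zeta> * (of_real (l2 i) / 2 + (\<Sum>j\<in>UNIV. of_real (l2 j) * snd (e (z2, w2) j) $ i))"
        "\<And>k. p2 $ k = \<zeta> * (\<Sum>j\<in>UNIV. of_real (l2 j) * (fst (e (z2, w2) j) $ k - cnj ((A j *v z2) $ k)))"
      using rep[OF x2(1,3)] by blast
    have w: "Re (w $ l) - Re (herm_form (A l) z) + s (z, w) $ l = 0" if "r (z, w) = 0" for z w l
      using that by (simp add: s_def quadric_def)
    have close: "norm (z - (1 - \<zeta>) *s V) \<le> \<tau>" "norm (q $ l - \<zeta> / 2 * of_real (c $ l)) \<le> \<tau>"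
      if "norm (((z, w), (p, q)) - initial_disc A c V \<zeta>) < \<tau>" for z w p q l
    proof -
      obtain z0 w0 p0 q0 where f: "initial_disc A c V \<zeta> = ((z0, w0), (p0, q0))" by (metis surj_pair)
      have zq: "z0 = (1 - \<zeta>) *s V" "q0 $ l = \<zeta> / 2 * of_real (c $ l)"
        using f \<zeta> by (auto simp: initial_disc_def)
      have "norm (z - z0) \<le> norm ((z - z0, w - w0), (p - p0, q - q0))"
        using norm_fst_le[of "(z - z0, w - w0)" "(p - p0, q - q0)"] norm_fst_le[of "z - z0" "w - w0"] by linarith
      moreover have "norm ((q - q0) $ l) \<le> norm ((z - z0, w - w0), (p - p0, q - q0))"
        using norm_snd_le[of "(p - p0, q - q0)" "(z - z0, w - w0)"] norm_snd_le[of "q - q0" "p - p0"]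
          Finite_Cartesian_Product.norm_nth_le[of "q - q0" l] by linarith
      ultimately show "norm (z - (1 - \<zeta>) *s V) \<le> \<tau>" "norm (q $ l - \<zeta> / 2 * of_real (c $ l)) \<le> \<tau>"
        using that unfolding f zq(1)[symmetric] zq(2)[symmetric] by simp_all
    qed
    note est = boundary_linearization[of A K V c \<tau> \<zeta> z1 z2 q1 q2 l1 "e (z1, w1)" l2 "e (z2, w2)" p1 p2 w1 "s (z1, w1)" w2 "s (z2, w2)",
        OF herm K(1-4) Kc KA less_imp_le[OF \<tau>(1)] \<tau>(2) \<zeta> close(1)[OF x1(4)] close(1)[OF x2(4)] close(2)[OF x1(4)] close(2)[OF x2(4)]
          l1(1) l2(1) l1(2) l2(2) w[OF x1(2)] w[OF x2(2)] e(2)[OF x1(1)] e(2)[OF x2(1)] e(1)[OF x1(1)]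
          ed(2)[unfolded N_def] ed(1)[unfolded N_def] sl[unfolded N_def]]
    from boundary_system_mono[OF est \<tau>(3)]
    show "boundary_system A c V \<eta> \<zeta> (z1 - z2) (w1 - w2) (p1 - p2) (q1 - q2)" .
  qed
qed

section \<open>Jets at the boundary point 1\<close>

lemma has_derivative_vec:
  fixes f :: "'k::finite \<Rightarrow> 'a::real_normed_vector \<Rightarrow> complex"
  assumes "\<And>i. (f i has_derivative f' i) F"
  shows "((\<lambda>x. \<chi> i. f i x) has_derivative (\<lambda>h. \<chi> i. f' i h)) F"
proof -
  have "((\<lambda>x. \<Sum>i\<in>UNIV. axis i (f i x)) has_derivative (\<lambda>h. \<Sum>i\<in>UNIV. axis i (f' i h))) F"
    by (intro has_derivative_sum bounded_linear.has_derivative[OF bounded_linear_axis] assms)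
  then show ?thesis using sum_axis_components[of "\<chi> i. f i _"] sum_axis_components[of "\<chi> i. f' i _"] by simp
qed

lemma has_derivative_1_minus_scale:
  fixes k :: "complex \<Rightarrow> complex ^ 'k::finite"
  assumes "k \<in> A1_vec \<alpha>"
  shows "((\<lambda>\<zeta>. (1 - \<zeta>) *s k \<zeta>) has_derivative (\<lambda>t. t *s (- k 1))) (at 1 within cball 0 1)"
proof -
  have "((\<lambda>\<zeta>. (1 - \<zeta>) * k \<zeta> $ i) has_field_derivative - k 1 $ i) (at 1 within cball 0 1)" for i
  proof -
    have "continuous_on (cball 0 1) (\<lambda>\<zeta>. k \<zeta> $ i)" using assms by (simp add: A1_vec_def A1_def)
    then have "((\<lambda>\<zeta>. - k \<zeta> $ i) \<longlongrightarrow> - k 1 $ i) (at 1 within cball 0 1)"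
      by (intro tendsto_minus) (simp add: continuous_on_def)
    moreover have "\<forall>\<^sub>F \<zeta> in at 1 within cball 0 1. ((1 - \<zeta>) * k \<zeta> $ i - (1 - 1) * k 1 $ i) / (\<zeta> - 1) = - k \<zeta> $ i"
      unfolding eventually_at_filter by (rule always_eventually) (auto simp: field_simps)
    ultimately show ?thesis
      unfolding has_field_derivative_iff by (subst tendsto_cong) auto
  qed
  then have "((\<lambda>\<zeta>. \<chi> i. (1 - \<zeta>) * k \<zeta> $ i) has_derivative (\<lambda>t. \<chi> i. (- k 1 $ i) * t)) (at 1 within cball 0 1)"
    unfolding has_field_derivative_def by (rule has_derivative_vec)
  then show ?thesis by (simp add: vector_scalar_mult_def mult.commute)
qed

lemma complex_derivative_at_1_unique:
  fixes f :: "('n::finite, 'd::finite) disc"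
  assumes "(f has_derivative (\<lambda>t. (cscale t (fst D), cscale t (snd D)))) (at 1 within cball 0 1)"
    and "(f has_derivative (\<lambda>t. (cscale t (fst E), cscale t (snd E)))) (at 1 within cball 0 1)"
  shows "D = E"
proof -
  \<comment> \<open>The disc lies on one side of its tangent at \<open>1\<close>, so the derivatives are compared along the
    inward radius only.\<close>
  let ?\<gamma> = "\<lambda>s :: real. 1 - complex_of_real s"
  have \<gamma>: "(?\<gamma> has_derivative (\<lambda>s. - of_real s)) (at 0 within cbox 0 1)"
    by (auto intro!: derivative_eq_intros)
  have sub: "?\<gamma> ` cbox 0 1 \<subseteq> cball 0 1"
  proof
    fix z assume "z \<in> ?\<gamma> ` cbox 0 1"
    then obtain s where s: "0 \<le> s" "s \<le> 1" "z = of_real (1 - s)" by (auto simp: cbox_interval)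
    then show "z \<in> cball 0 1" by (simp del: of_real_diff)
  qed
  have path: "((\<lambda>s. f (?\<gamma> s)) has_vector_derivative - F) (at 0 within cbox 0 1)"
    if "(f has_derivative (\<lambda>t. (cscale t (fst F), cscale t (snd F)))) (at 1 within cball 0 1)" for F
  proof -
    have "(f has_derivative (\<lambda>t. (cscale t (fst F), cscale t (snd F)))) (at (?\<gamma> 0) within ?\<gamma> ` cbox 0 1)"
      using has_derivative_subset[OF that sub] by simp
    from diff_chain_within[OF \<gamma> this]
    have "((\<lambda>s. f (?\<gamma> s)) has_derivative (\<lambda>s. (cscale (- of_real s) (fst F), cscale (- of_real s) (snd F)))) (at 0 within cbox 0 1)"
      by (simp add: o_def)
    moreover have "(cscale (- of_real s) (fst F), cscale (- of_real s) (snd F)) = s *\<^sub>R (- F)" for s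
      by (simp add: cscale_def prod_eq_iff vec_eq_iff scaleR_conv_of_real[where 'a = complex])
    ultimately show ?thesis unfolding has_vector_derivative_def by simp
  qed
  have "- D = - E"
    by (rule vector_derivative_unique_within_closed_interval[OF _ _ path[OF assms(1)] path[OF assms(2)]]) auto
  then show ?thesis by simp
qed

lemma scaled_disc_has_derivative:
  assumes "h \<in> A1_vec \<alpha>" "g \<in> A1_vec \<alpha>" "h' \<in> A1_vec \<alpha>" "g' \<in> A1_vec \<alpha>"
  shows "((\<lambda>\<zeta>. (((1 - \<zeta>) *s h \<zeta>, (1 - \<zeta>) *s g \<zeta>), ((1 - \<zeta>) *s h' \<zeta>, (1 - \<zeta>) *s g' \<zeta>))) has_derivative
    (\<lambda>t. (cscale t (- h 1, - g 1), cscale t (- h' 1, - g' 1)))) (at 1 within cball 0 1)"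
  unfolding cscale_def fst_conv snd_conv
  by (intro has_derivative_Pair) (rule has_derivative_1_minus_scale assms)+

lemma affine_disc_has_derivative_at_1:
  fixes f :: "('n::finite, 'd::finite) disc"
  assumes "f \<in> affine_discs \<alpha> c"
  shows "(f has_derivative (\<lambda>t. (cscale t (fst (deriv_at_1 f)), cscale t (snd (deriv_at_1 f))))) (at 1 within cball 0 1)"
proof -
  obtain h g h' g' where 1: "h \<in> A1_vec \<alpha>" "g \<in> A1_vec \<alpha>" "h' \<in> A1_vec \<alpha>" "g' \<in> A1_vec \<alpha>"
    "f = restrict (\<lambda>\<zeta>. (((1 - \<zeta>) *s h \<zeta>, (1 - \<zeta>) *s g \<zeta>),
         ((1 - \<zeta>) *s h' \<zeta>, (1 - \<zeta>) *s g' \<zeta> + (\<chi> j. \<zeta> / 2 * of_real (c $ j))))) (cball 0 1)"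
    using assms unfolding affine_discs_def by blast
  let ?u = "\<lambda>\<zeta>. (((1 - \<zeta>) *s h \<zeta>, (1 - \<zeta>) *s g \<zeta>), ((1 - \<zeta>) *s h' \<zeta>, (1 - \<zeta>) *s g' \<zeta>))"
  let ?l = "\<lambda>\<zeta>. (0, (0, \<chi> j. \<zeta> / 2 * of_real (c $ j))) :: ('n, 'd) cspace \<times> ('n, 'd) cspace"
  let ?D = "((- h 1, - g 1), (- h' 1, - g' 1 + (\<chi> j. of_real (c $ j) / 2)))"
  have "(?l has_derivative ?l) (at 1 within cball 0 1)"
    by (intro has_derivative_Pair has_derivative_const has_derivative_vec) (auto intro!: derivative_eq_intros)
  from has_derivative_add[OF scaled_disc_has_derivative[OF 1(1-4)] this]
  have "((\<lambda>\<zeta>. ?u \<zeta> + ?l \<zeta>) has_derivative (\<lambda>t. (cscale t (fst ?D), cscale t (snd ?D)))) (at 1 within cball 0 1)"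
    by (rule has_derivative_eq_rhs) (simp add: fun_eq_iff cscale_def prod_eq_iff vec_eq_iff algebra_simps)
  then have D: "(f has_derivative (\<lambda>t. (cscale t (fst ?D), cscale t (snd ?D)))) (at 1 within cball 0 1)"
    by (rule has_derivative_transform[rotated 2]) (simp_all add: 1)
  moreover have "deriv_at_1 f = ?D"
    unfolding deriv_at_1_def
  proof (rule the_equality)
    show "(f has_derivative (\<lambda>t. (cscale t (fst ?D), cscale t (snd ?D)))) (at 1 within cball 0 1)" by (rule D)
  qed (rule complex_derivative_at_1_unique[OF _ D])
  ultimately show ?thesis by simp
qed

text \<open>On the space \<open>\<A>\<close> all discs agree at \<open>1\<close>, and the derivative of \<open>(1 - \<zeta>) h\<close> at \<open>1\<close> is \<open>- h 1\<close>.\<close>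

lemma equal_jets_imp_double_zero:
  assumes "f \<in> affine_discs \<alpha> c" "f' \<in> affine_discs \<alpha> c" "jet1 f = jet1 f'"
    and H: "h \<in> A1_vec \<alpha>" "g \<in> A1_vec \<alpha>" "h' \<in> A1_vec \<alpha>" "g' \<in> A1_vec \<alpha>"
    and diff: "\<And>\<zeta>. \<zeta> \<in> cball 0 1 \<Longrightarrow>
      f \<zeta> - f' \<zeta> = (((1 - \<zeta>) *s h \<zeta>, (1 - \<zeta>) *s g \<zeta>), ((1 - \<zeta>) *s h' \<zeta>, (1 - \<zeta>) *s g' \<zeta>))"
  shows "h 1 = 0" "g 1 = 0" "h' 1 = 0" "g' 1 = 0"
proof -
  let ?D = "deriv_at_1 f"
  have D: "deriv_at_1 f' = ?D" using assms(3) by (simp add: jet1_def)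
  have "((\<lambda>\<zeta>. f \<zeta> - f' \<zeta>) has_derivative (\<lambda>t. (cscale t (fst 0), cscale t (snd 0)))) (at 1 within cball 0 1)"
    using has_derivative_diff[OF affine_disc_has_derivative_at_1[OF assms(1)] affine_disc_has_derivative_at_1[OF assms(2)]]
    by (simp add: D cscale_def zero_prod_def)
  moreover have "((\<lambda>\<zeta>. f \<zeta> - f' \<zeta>) has_derivative
      (\<lambda>t. (cscale t (fst ((- h 1, - g 1), (- h' 1, - g' 1))), cscale t (snd ((- h 1, - g 1), (- h' 1, - g' 1)))))) (at 1 within cball 0 1)"
    unfolding fst_conv snd_conv
    by (rule has_derivative_transform[OF _ diff scaled_disc_has_derivative[OF H]]) simp_all
  ultimately have "0 = ((- h 1, - g 1), (- h' 1, - g' 1))" by (rule complex_derivative_at_1_unique)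
  then show "h 1 = 0" "g 1 = 0" "h' 1 = 0" "g' 1 = 0" by (simp_all add: zero_prod_def)
qed

section \<open>Discs are determined by their jets\<close>

lemma norm_smult_vec: "norm (a *s (x :: complex ^ 'n::finite)) = norm a * norm x"
  by (simp add: norm_vec_def norm_mult L2_set_right_distrib)

lemma norm_smult_pairs:
  "norm ((a *s x, a *s y), (a *s p, a *s q)) = norm a * norm ((x, y), (p, q))"
  for x :: "complex ^ 'a::finite" and y :: "complex ^ 'b::finite" and p :: "complex ^ 'c::finite" and q :: "complex ^ 'e::finite"
proof -
  have "norm ((a *s x, a *s y), (a *s p, a *s q)) = sqrt ((norm a)\<^sup>2 * (norm ((x, y), (p, q)))\<^sup>2)"
    by (simp add: norm_Pair norm_smult_vec power_mult_distrib algebra_simps)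
  then show ?thesis by (simp add: real_sqrt_mult)
qed

text \<open>On the circle \<open>cnj \<zeta> (1 - \<zeta>)\<^sup>2 = - \<bar>1 - \<zeta>\<bar>\<^sup>2\<close>, so the substitution \<open>u = (1 - \<zeta>)\<^sup>2 \<omega>\<close> turns every term
of the system into \<open>\<bar>1 - \<zeta>\<bar>\<^sup>2\<close> times the corresponding reduced one (up to sign, or up to the unimodular factor
\<open>(1 - \<zeta>)\<^sup>2 / \<bar>1 - \<zeta>\<bar>\<^sup>2\<close> in the second line).\<close>

lemma boundary_system_divided:
  fixes A :: "'d::finite \<Rightarrow> complex ^ 'n::finite ^ 'n" and c :: "real ^ 'd" and V :: "complex ^ 'n"
    and z p :: "complex ^ 'n" and w q :: "complex ^ 'd"
  assumes \<zeta>: "\<zeta> \<in> pcircle"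
    and system: "boundary_system A c V \<eta> \<zeta> ((1 - \<zeta>)\<^sup>2 *s z) ((1 - \<zeta>)\<^sup>2 *s w) ((1 - \<zeta>)\<^sup>2 *s p) ((1 - \<zeta>)\<^sup>2 *s q)"
  shows "reduced_boundary_system A c V \<eta> \<zeta> z w p q"
proof -
  define a where "a = (1 - \<zeta>)\<^sup>2"
  define N where "N = norm ((a *s z, a *s w), (a *s p, a *s q))"
  define d where "d = (norm (1 - \<zeta>))\<^sup>2"
  have d: "0 < d" using \<zeta> by (simp add: d_def pcircle_def)
  have N: "N = d * norm ((z, w), (p, q))"
    by (simp only: N_def norm_smult_pairs) (simp add: a_def d_def norm_power)
  have cancel: "x \<le> \<eta> * norm ((z, w), (p, q))" if "d * x \<le> \<eta> * N" for x
    using that d unfolding N by (simp add: mult.left_commute[of \<eta> d])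
  have zz: "\<zeta> * cnj \<zeta> = 1" using \<zeta> by (simp add: complex_norm_square[symmetric] pcircle_def)
  have dd: "complex_of_real d = (1 - \<zeta>) * (1 - cnj \<zeta>)"
    using complex_norm_square[of "1 - \<zeta>"] by (simp add: d_def)
  have a1: "cnj \<zeta> * a = - complex_of_real d" "a = - (complex_of_real d * \<zeta>)" "cnj (1 - \<zeta>) * a = complex_of_real d * (1 - \<zeta>)"
    "\<zeta> * cnj a = cnj \<zeta> * a"
    using zz unfolding dd a_def by (simp_all add: power2_eq_square, algebra+)
  have hq: "\<bar>Im (cnj \<zeta> * (a *s q) $ l)\<bar> \<le> \<eta> * N"
    and hp: "norm ((a *s p) $ k + 2 * (1 - cnj \<zeta>) * (\<Sum>j\<in>UNIV. (a *s q) $ j * cnj ((A j *v V) $ k))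
        + \<zeta> * cnj ((pencil A c *v (a *s z)) $ k)) \<le> \<eta> * N"
    and hw: "\<bar>Re ((a *s w) $ l) - 2 * Re (cnj (1 - \<zeta>) * (\<Sum>k\<in>UNIV. cnj ((A l *v V) $ k) * (a *s z) $ k))\<bar> \<le> \<eta> * N"
    for l k
    using system unfolding boundary_system_def a_def N_def by blast+
  have "\<bar>Im (q $ l)\<bar> \<le> \<eta> * norm ((z, w), (p, q))" for l
  proof -
    have "cnj \<zeta> * (a *s q) $ l = - (of_real d * q $ l)"
      by (simp add: mult.assoc[symmetric] a1(1))
    then have "d * \<bar>Im (q $ l)\<bar> \<le> \<eta> * N" using hq[of l] d by (simp add: abs_mult)
    then show ?thesis by (rule cancel)
  qed
  moreover have "norm (p $ k + 2 * (1 - cnj \<zeta>) * (\<Sum>j\<in>UNIV. q $ j * cnj ((A j *v V) $ k))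
        + cnj \<zeta> * cnj ((pencil A c *v z) $ k)) \<le> \<eta> * norm ((z, w), (p, q))" for k
  proof -
    have Az: "\<zeta> * cnj ((pencil A c *v (a *s z)) $ k) = a * (cnj \<zeta> * cnj ((pencil A c *v z) $ k))"
    proof -
      have "\<zeta> * cnj ((pencil A c *v (a *s z)) $ k) = (\<zeta> * cnj a) * cnj ((pencil A c *v z) $ k)"
        by (simp add: vector_scalar_commute)
      then show ?thesis unfolding a1(4) by (simp add: mult_ac)
    qed
    have "(\<Sum>j\<in>UNIV. (a *s q) $ j * cnj ((A j *v V) $ k)) = a * (\<Sum>j\<in>UNIV. q $ j * cnj ((A j *v V) $ k))"
      by (simp add: sum_distrib_left mult_ac)
    then have "(a *s p) $ k + 2 * (1 - cnj \<zeta>) * (\<Sum>j\<in>UNIV. (a *s q) $ j * cnj ((A j *v V) $ k))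
        + \<zeta> * cnj ((pencil A c *v (a *s z)) $ k)
      = a * (p $ k + 2 * (1 - cnj \<zeta>) * (\<Sum>j\<in>UNIV. q $ j * cnj ((A j *v V) $ k)) + cnj \<zeta> * cnj ((pencil A c *v z) $ k))"
      unfolding Az by (simp add: algebra_simps)
    moreover have "norm a = d" by (simp add: a_def d_def norm_power)
    ultimately have "d * norm (p $ k + 2 * (1 - cnj \<zeta>) * (\<Sum>j\<in>UNIV. q $ j * cnj ((A j *v V) $ k))
        + cnj \<zeta> * cnj ((pencil A c *v z) $ k)) \<le> \<eta> * N" using hp[of k] by (simp only: norm_mult)
    then show ?thesis by (rule cancel)
  qed
  moreover have "\<bar>Re (\<zeta> * w $ l) + 2 * Re ((1 - \<zeta>) * (\<Sum>k\<in>UNIV. cnj ((A l *v V) $ k) * z $ k))\<bar>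
      \<le> \<eta> * norm ((z, w), (p, q))" for l
  proof -
    let ?S = "\<Sum>k\<in>UNIV. cnj ((A l *v V) $ k) * z $ k"
    have "cnj (1 - \<zeta>) * (\<Sum>k\<in>UNIV. cnj ((A l *v V) $ k) * (a *s z) $ k) = (cnj (1 - \<zeta>) * a) * ?S"
      unfolding mult.assoc by (simp add: sum_distrib_left mult_ac)
    also have "\<dots> = of_real d * ((1 - \<zeta>) * ?S)" unfolding a1(3) by (rule mult.assoc)
    finally have S: "Re (cnj (1 - \<zeta>) * (\<Sum>k\<in>UNIV. cnj ((A l *v V) $ k) * (a *s z) $ k)) = d * Re ((1 - \<zeta>) * ?S)"
      by simp
    have "(a *s w) $ l = of_real d * (- (\<zeta> * w $ l))" unfolding vector_smult_component by (subst a1(2)) (simp add: mult.assoc)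
    then have W: "Re ((a *s w) $ l) = - d * Re (\<zeta> * w $ l)" by simp
    have "\<bar>- d * x - 2 * (d * y)\<bar> = d * \<bar>x + 2 * y\<bar>" for x y
    proof -
      have "- d * x - 2 * (d * y) = - (d * (x + 2 * y))" by (simp add: algebra_simps)
      then show ?thesis using d by (simp only: abs_minus_cancel abs_mult abs_of_pos)
    qed
    then have "d * \<bar>Re (\<zeta> * w $ l) + 2 * Re ((1 - \<zeta>) * ?S)\<bar> \<le> \<eta> * N" using hw[of l] unfolding S W by metis
    then show ?thesis by (rule cancel)
  qed
  ultimately show ?thesis unfolding reduced_boundary_system_def by blast
qed

lemma hardy_inverse_scale:
  fixes k :: "complex \<Rightarrow> complex ^ 'k::finite"
  assumes "k \<in> A1_vec \<alpha>" "0 < \<alpha>" "k 1 = 0"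
  shows "hardy_vec (\<lambda>\<zeta>. inverse (1 - \<zeta>) *s k \<zeta>)"
  unfolding hardy_vec_def
proof
  fix i
  have "(\<lambda>\<zeta>. k \<zeta> $ i) \<in> A1 \<alpha>" using assms by (simp add: A1_vec_def)
  from hardy_divide_1_minus[OF this assms(2)] assms(3) show "\<exists>a. hardy (\<lambda>\<zeta>. (inverse (1 - \<zeta>) *s k \<zeta>) $ i) a"
    by (auto simp: divide_inverse mult.commute)
qed

lemma square_smult_inverse:
  "\<zeta> \<in> pcircle \<Longrightarrow> (1 - \<zeta>)\<^sup>2 *s (inverse (1 - \<zeta>) *s k) = (1 - \<zeta>) *s (k :: complex ^ 'k::finite)"
  by (auto simp: vec_eq_iff pcircle_def power2_eq_square field_simps)

theorem proposition3p3:
  fixes A :: "'d::finite \<Rightarrow> complex ^ 'n::finite ^ 'n"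
    and c :: "real ^ 'd" and V :: "complex ^ 'n" and \<alpha> :: real
  assumes "0 < \<alpha>" and "\<alpha> < 1"
    and "\<And>j. hermitian (A j)"
    and "D_nondegenerate A"
    and "cond_t A c" and "cond_d A c V"
  shows "\<exists>U \<epsilon>. Copen 4 U \<and> quadric A \<in> U \<and> \<epsilon> > 0 \<and>
    (\<forall>r\<in>U. inj_on jet1
       {f \<in> stationary_lifts0 \<alpha> c (ball 0 1) r.
          C1_holder_norm \<alpha> (\<lambda>\<zeta>. f \<zeta> - initial_disc A c V \<zeta>) < \<epsilon>})"
proof -
  let ?f0 = "initial_disc A c V"
  obtain \<eta> where \<eta>: "0 < \<eta>" and rigid: "\<forall>z w p q. hardy_vec z \<longrightarrow> hardy_vec w \<longrightarrow> hardy_vec p \<longrightarrow> hardy_vec q \<longrightarrow>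
      (\<forall>\<zeta>\<in>pcircle. reduced_boundary_system A c V \<eta> \<zeta> (z \<zeta>) (w \<zeta>) (p \<zeta>) (q \<zeta>)) \<longrightarrow>
      L2n (\<lambda>\<zeta>. ((z \<zeta>, w \<zeta>), (p \<zeta>, q \<zeta>))) = 0"
    using linear_system_rigid[OF assms(5,6)[unfolded cond_t_def cond_d_def]] by (elim exE conjE)
  obtain \<tau> \<delta> where \<tau>: "0 < \<tau>" "0 < \<delta>"
    and est: "\<forall>r \<zeta> z1 w1 p1 q1 z2 w2 p2 q2.
      r \<in> Cspace 4 \<longrightarrow> Cnorm 4 (\<lambda>p. r p - quadric A p) < \<delta> \<longrightarrow> norm \<zeta> = 1 \<longrightarrow>
      (z1, w1) \<in> ball 0 1 \<longrightarrow> r (z1, w1) = 0 \<longrightarrow> (p1, q1) \<in> cscale \<zeta> ` conormal r (z1, w1) \<longrightarrow>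
      norm (((z1, w1), (p1, q1)) - ?f0 \<zeta>) < \<tau> \<longrightarrow>
      (z2, w2) \<in> ball 0 1 \<longrightarrow> r (z2, w2) = 0 \<longrightarrow> (p2, q2) \<in> cscale \<zeta> ` conormal r (z2, w2) \<longrightarrow>
      norm (((z2, w2), (p2, q2)) - ?f0 \<zeta>) < \<tau> \<longrightarrow>
      boundary_system A c V \<eta> \<zeta> (z1 - z2) (w1 - w2) (p1 - p2) (q1 - q2)"
    using conormal_boundary_estimate[of A \<eta> c V, OF assms(3) \<eta>] by (elim exE conjE)
  define U where "U = {r \<in> Cspace 4. Cnorm 4 (\<lambda>p. r p - quadric A p) < \<delta>}"
  have U: "Copen 4 U" unfolding U_def by (rule Copen_Cnorm_ball[OF quadric_in_Cspace])
  have "Cnorm 4 (\<lambda>p. quadric A p - quadric A p) \<le> 0"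
    by (rule Cnorm_le, subst iter_deriv_diff[OF quadric_in_Cspace quadric_in_Cspace]) auto
  then have QU: "quadric A \<in> U" using \<tau> by (simp add: U_def quadric_in_Cspace)
  have "f1 = f2"
    if r: "r \<in> U" and f1: "f1 \<in> stationary_lifts0 \<alpha> c (ball 0 1) r" "C1_holder_norm \<alpha> (\<lambda>\<zeta>. f1 \<zeta> - ?f0 \<zeta>) < \<tau>"
      and f2: "f2 \<in> stationary_lifts0 \<alpha> c (ball 0 1) r" "C1_holder_norm \<alpha> (\<lambda>\<zeta>. f2 \<zeta> - ?f0 \<zeta>) < \<tau>"
      and jet: "jet1 f1 = jet1 f2" for r f1 f2
  proof -
    have r': "r \<in> Cspace 4" "Cnorm 4 (\<lambda>p. r p - quadric A p) < \<delta>" using r by (auto simp: U_def)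
    have f0: "?f0 \<in> affine_discs \<alpha> c"
      using initial_disc_in_lifts[of A c V \<alpha>, OF assms(3,5,6)] by (simp add: stationary_lifts0_def)
    have aff: "f1 \<in> affine_discs \<alpha> c" "f2 \<in> affine_discs \<alpha> c" using f1 f2 by (auto simp: stationary_lifts0_def)
    have bdry: "fst (f \<zeta>) \<in> ball 0 1 \<and> r (fst (f \<zeta>)) = 0 \<and> snd (f \<zeta>) \<in> cscale \<zeta> ` conormal r (fst (f \<zeta>))
        \<and> norm (f \<zeta> - ?f0 \<zeta>) < \<tau>"
      if f: "f \<in> stationary_lifts0 \<alpha> c (ball 0 1) r" "C1_holder_norm \<alpha> (\<lambda>\<zeta>. f \<zeta> - ?f0 \<zeta>) < \<tau>" and \<zeta>: "\<zeta> \<in> sphere 0 1" for f \<zeta>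
    proof -
      have "f \<in> affine_discs \<alpha> c" using f(1) by (simp add: stationary_lifts0_def)
      then have "C1_holder \<alpha> (\<lambda>\<zeta>. f \<zeta> - ?f0 \<zeta>)" by (rule affine_discs_C1_holder_diff[OF _ f0 assms(1,2)])
      from norm_le_C1_holder_norm[OF this assms(1) \<zeta>] f(2) have "norm (f \<zeta> - ?f0 \<zeta>) < \<tau>" by simp
      moreover have "f \<in> stationary_lifts (ball 0 1) r" using f(1) by (simp add: stationary_lifts0_def)
      ultimately show ?thesis using \<zeta> unfolding stationary_lifts_def by blast
    qed
    obtain h g h' g' where H: "h \<in> A1_vec \<alpha>" "g \<in> A1_vec \<alpha>" "h' \<in> A1_vec \<alpha>" "g' \<in> A1_vec \<alpha>"
      and diff': "\<forall>\<zeta>\<in>cball 0 1.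
        f1 \<zeta> - f2 \<zeta> = (((1 - \<zeta>) *s h \<zeta>, (1 - \<zeta>) *s g \<zeta>), ((1 - \<zeta>) *s h' \<zeta>, (1 - \<zeta>) *s g' \<zeta>))"
      using affine_discs_diff[OF aff] by (elim exE conjE)
    note diff = bspec[OF diff']
    note at1 = equal_jets_imp_double_zero[OF aff jet H diff]
    \<comment> \<open>The quotient of \<open>f1 - f2\<close> by \<open>(1 - \<zeta>)\<^sup>2\<close>.\<close>
    define z w p q where "z \<zeta> = inverse (1 - \<zeta>) *s h \<zeta>" and "w \<zeta> = inverse (1 - \<zeta>) *s g \<zeta>"
      and "p \<zeta> = inverse (1 - \<zeta>) *s h' \<zeta>" and "q \<zeta> = inverse (1 - \<zeta>) *s g' \<zeta>" for \<zeta>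
    let ?\<omega> = "\<lambda>\<zeta>. ((z \<zeta>, w \<zeta>), (p \<zeta>, q \<zeta>))"
    have hardy: "hardy_vec z" "hardy_vec w" "hardy_vec p" "hardy_vec q"
      unfolding z_def w_def p_def q_def
      using hardy_inverse_scale[OF H(1) assms(1) at1(1)] hardy_inverse_scale[OF H(2) assms(1) at1(2)]
        hardy_inverse_scale[OF H(3) assms(1) at1(3)] hardy_inverse_scale[OF H(4) assms(1) at1(4)] by simp_all
    have system: "reduced_boundary_system A c V \<eta> \<zeta> (z \<zeta>) (w \<zeta>) (p \<zeta>) (q \<zeta>)"
      if \<zeta>: "\<zeta> \<in> pcircle" for \<zeta>
    proof -
      have s: "\<zeta> \<in> sphere 0 1" "\<zeta> \<in> cball 0 1" "norm \<zeta> = 1" using \<zeta> by (auto simp: pcircle_def)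
      obtain z1 w1 p1 q1 where F1: "f1 \<zeta> = ((z1, w1), (p1, q1))" by (metis surj_pair)
      obtain z2 w2 p2 q2 where F2: "f2 \<zeta> = ((z2, w2), (p2, q2))" by (metis surj_pair)
      have "z1 - z2 = (1 - \<zeta>)\<^sup>2 *s z \<zeta>" "w1 - w2 = (1 - \<zeta>)\<^sup>2 *s w \<zeta>"
        "p1 - p2 = (1 - \<zeta>)\<^sup>2 *s p \<zeta>" "q1 - q2 = (1 - \<zeta>)\<^sup>2 *s q \<zeta>"
        using diff[OF s(2)] unfolding F1 F2 z_def w_def p_def q_def square_smult_inverse[OF \<zeta>] by auto
      moreover have "boundary_system A c V \<eta> \<zeta> (z1 - z2) (w1 - w2) (p1 - p2) (q1 - q2)"
        by (rule est[rule_format, OF r' s(3)])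
           (use bdry[OF f1 s(1)] bdry[OF f2 s(1)] in \<open>unfold F1 F2 fst_conv snd_conv, blast\<close>)+
      ultimately show ?thesis by (intro boundary_system_divided[OF \<zeta>]) simp
    qed
    have zero: "L2n ?\<omega> = 0"
      using rigid hardy system by blast
    have t: "tame ?\<omega>"
      by (intro tame_Pair hardy_vec_tame hardy)
    have vanish: "h \<zeta> $ k = 0" "g \<zeta> $ j = 0" "h' \<zeta> $ k = 0" "g' \<zeta> $ j = 0" if "\<zeta> \<in> cball 0 1" for \<zeta> k j
      by (rule eq_zero_if_L2n_eq_zero[OF _ _ t zero _ that];
          use H in \<open>simp add: A1_vec_def A1_def z_def w_def p_def q_def pcircle_def zero_prod_def vec_eq_iff\<close>)+
    have "f1 \<zeta> = f2 \<zeta>" if "\<zeta> \<in> cball 0 1" for \<zeta>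
    proof -
      have "h \<zeta> = 0" "g \<zeta> = 0" "h' \<zeta> = 0" "g' \<zeta> = 0" using vanish[OF that] by (simp_all add: vec_eq_iff)
      then have "f1 \<zeta> - f2 \<zeta> = 0" unfolding diff[OF that] by (simp add: zero_prod_def)
      then show ?thesis by simp
    qed
    moreover have "f1 \<in> extensional (cball 0 1)" "f2 \<in> extensional (cball 0 1)"
      using f1 f2 by (auto simp: stationary_lifts0_def stationary_lifts_def)
    ultimately show "f1 = f2" by (intro extensionalityI)
  qed
  then show ?thesis
    using U QU \<tau>(1) by (intro exI[of _ U] exI[of _ \<tau>]) (auto simp: inj_on_def)
qed

end
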